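(* Let $(V, \mathfrak{m}, \mathbb{K})$ be a commutative artinian local ring with residue field $\mathbb{K}$ of characteristic $p>0$, and suppose given a bijective ring homomorphism $F : V \to V$ inducing the Frobenius morphism on $\mathbb{K}$. Let $R = V[x_1,\dots,x_n]$ be a polynomial ring over $V$, and let $f \in R$ be a nonzerodivisor. Then all the Bernstein--Sato roots of $f$ are rational, i.e. lie in the subring $\mathbb{Z}_{(p)} \subseteq \mathbb{Z}_p$.
   Context: $\mathbb{Z}_{(p)}$ is the ring of rational numbers whose denominator is not divisible by $p$, viewed as a subring of $\mathbb{Z}_p$. For a commutative $V$-algebra $S$, let $\mathcal{D}_S \subseteq \operatorname{End}_V(S)$ be the ring of $V$-linear differential operators on $S$ in Grothendieck's sense: with $S \otimes_V S$ acting on $\operatorname{End}_V(S)$ by $((r\otimes s)\cdot\varphi)(x) = r\varphi(sx)$ and $J = \ker(S\otimes_V S \to S)$ the kernel of multiplication, $\mathcal{D}_S = \{\varphi : J^n\cdot \varphi = 0 \text{ for some } n \gg 0\}$. Let $C(\mathbb{Z}_p, V)$ be the ring (pointwise operations) of continuous functions $\mathbb{Z}_p \to V$, with $V$ discrete. For $\alpha \in \mathbb{Z}_p$, $(\mathfrak{m}:\alpha) = \{\varphi \in C(\mathbb{Z}_p,V) : \varphi(\alpha) \in \mathfrak{m}\}$ is a maximal ideal. Grade $R[t]$ by $\deg R = 0$, $\deg t = 1$, inducing a $\mathbb{Z}$-grading on $\mathcal{D}_{R[t]}$ with degree-zero subring $(\mathcal{D}_{R[t]})_0$. Each $\varphi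 \in C(\mathbb{Z}_p, V)$ defines an operator $\tilde\varphi \in (\mathcal{D}_{R[t]})_0$ by $\tilde\varphi(r t^a) = \varphi(-1-a) r t^a$ ($r \in R$, $a \ge 0$), so every $(\mathcal{D}_{R[t]})_0$-module is a $C(\mathbb{Z}_p,V)$-module. Localizations of $R[t]$ carry the unique $\mathcal{D}_{R[t]}$-module structures extending that on $R[t]$. Let $H_f = R[t,f^{-1},(f-t)^{-1}]/R[t,f^{-1}]$, $\delta_0 = [(f-t)^{-1}] \in H_f$, and $N_f = \big((\mathcal{D}_{R[t]})_0\cdot\delta_0\big)/\big((\mathcal{D}_{R[t]})_0\cdot f\delta_0\big)$. A $p$-adic integer $\alpha \in \mathbb{Z}_p$ is a Bernstein--Sato root of $f$ if the localization $(N_f)_\alpha$ of the $C(\mathbb{Z}_p,V)$-module $N_f$ at $(\mathfrak{m}:\alpha)$ is nonzero. *)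

theory Defs
  imports
    "HOL-Analysis.Analysis"
    "HOL-Computational_Algebra.Polynomial"
    "HOL-Library.Poly_Mapping"
    "HOL-Library.Set_Algebras"
begin

section \<open>The base ring\<close>

definition unital_ring_hom :: "('a::comm_ring_1 \<Rightarrow> 'b::comm_ring_1) \<Rightarrow> bool" where
  "unital_ring_hom h \<longleftrightarrow>
     h 1 = 1 \<and> (\<forall>a b. h (a + b) = h a + h b) \<and> (\<forall>a b. h (a * b) = h a * h b)"

text \<open>Ideals of a commutative ring are its submodules under multiplication.\<close>

abbreviation ring_ideal :: "'a::comm_ring_1 set \<Rightarrow> bool" where
  "ring_ideal \<equiv> module.subspace ((*) :: 'a \<Rightarrow> 'a \<Rightarrow> 'a)"

definition artinian_ring :: "'a::comm_ring_1 itself \<Rightarrow> bool" where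
  "artinian_ring _ \<longleftrightarrow>
     (\<forall>I :: nat \<Rightarrow> 'a set.
        (\<forall>k. ring_ideal (I k)) \<and> (\<forall>k. I (Suc k) \<subseteq> I k) \<longrightarrow> (\<exists>N. \<forall>k\<ge>N. I k = I N))"

definition max_ideal :: "'a::comm_ring_1 set \<Rightarrow> bool" where
  "max_ideal M \<longleftrightarrow>
     ring_ideal M \<and> M \<noteq> UNIV \<and> (\<forall>I. ring_ideal I \<and> M \<subseteq> I \<longrightarrow> I = M \<or> I = UNIV)"

definition local_ring_with :: "'a::comm_ring_1 set \<Rightarrow> bool" where
  "local_ring_with M \<longleftrightarrow> (\<forall>I. max_ideal I \<longleftrightarrow> I = M)"

text \<open>The field \<open>'k\<close> is the residue field of a local ring with maximal ideal \<open>M\<close> via the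
  quotient map \<open>\<pi>\<close>.\<close>

definition residue_map :: "'a::comm_ring_1 set \<Rightarrow> ('a \<Rightarrow> 'k::field) \<Rightarrow> bool" where
  "residue_map M \<pi> \<longleftrightarrow> unital_ring_hom \<pi> \<and> surj \<pi> \<and> {v. \<pi> v = 0} = M"

definition nonzerodivisor :: "'a::comm_ring_1 \<Rightarrow> bool" where
  "nonzerodivisor a \<longleftrightarrow> (\<forall>b. a * b = 0 \<longrightarrow> b = 0)"


section \<open>Polynomial rings in finitely many variables\<close>

text \<open>The value, in a \<open>V\<close>-algebra with structure map \<open>c\<close>, of a formal polynomial (a finitely
  supported family of coefficients indexed by exponent vectors) at the points \<open>x 0, x 1, \<dots>\<close>.\<close>

definition eval_formal_poly ::
  "('v::comm_ring_1 \<Rightarrow> 'r::comm_ring_1) \<Rightarrow> (nat \<Rightarrow> 'r) \<Rightarrow> ((nat \<Rightarrow>\<^sub>0 nat) \<Rightarrow>\<^sub>0 'v) \<Rightarrow> 'r" where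
  "eval_formal_poly c x P =
     (\<Sum>m\<in>Poly_Mapping.keys P.
        c (Poly_Mapping.lookup P m) * (\<Prod>i\<in>Poly_Mapping.keys m. x i ^ Poly_Mapping.lookup m i))"

text \<open>The whole type \<open>'r\<close>, with coefficient embedding \<open>c\<close>, is the polynomial ring
  \<open>V[x 0, \<dots>, x (n - 1)]\<close>: each element is the value of exactly one formal polynomial in
  the first \<open>n\<close> indeterminates. Stating this for an arbitrary carrier type, rather than for one
  fixed type of polynomials in variables indexed by a (necessarily nonempty) finite type, keeps
  the case \<open>n = 0\<close>.\<close>

definition is_polynomial_ring ::
  "('v::comm_ring_1 \<Rightarrow> 'r::comm_ring_1) \<Rightarrow> nat \<Rightarrow> (nat \<Rightarrow> 'r) \<Rightarrow> bool" where
  "is_polynomial_ring c n x \<longleftrightarrow>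
     unital_ring_hom c \<and>
     bij_betw (eval_formal_poly c x)
       {P. \<forall>m\<in>Poly_Mapping.keys P. Poly_Mapping.keys m \<subseteq> {..<n}} UNIV"


section \<open>Differential operators\<close>

text \<open>Throughout this section \<open>S\<close> is a commutative \<open>V\<close>-algebra with structure map \<open>e\<close>.
  A list \<open>[(r\<^sub>1, s\<^sub>1), \<dots>, (r\<^sub>k, s\<^sub>k)]\<close> represents the element
  \<open>r\<^sub>1 \<otimes> s\<^sub>1 + \<dots> + r\<^sub>k \<otimes> s\<^sub>k\<close> of \<open>S \<otimes>\<^sub>V S\<close>; every element has such representatives.
  The action on \<open>End\<^sub>V(S)\<close>, the multiplication map to \<open>S\<close> and the product
  depend on the represented tensors only; the lemmas below check the defining relations.\<close>

type_synonym 's tensor = "('s \<times> 's) list"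

definition tensor_act :: "'s::comm_ring_1 tensor \<Rightarrow> ('s \<Rightarrow> 's) \<Rightarrow> 's \<Rightarrow> 's" where
  "tensor_act T \<phi> = (\<lambda>x. \<Sum>(r, s)\<leftarrow>T. r * \<phi> (s * x))"

definition tensor_mult :: "'s::comm_ring_1 tensor \<Rightarrow> 's tensor \<Rightarrow> 's tensor" where
  "tensor_mult T U = map (\<lambda>((r, s), (r', s')). (r * r', s * s')) (List.product T U)"

definition multiplication_map :: "'s::comm_ring_1 tensor \<Rightarrow> 's" where
  "multiplication_map T = (\<Sum>(r, s)\<leftarrow>T. r * s)"

definition diagonal_ideal :: "'s::comm_ring_1 tensor set" where
  "diagonal_ideal = {T. multiplication_map T = 0}"

primrec diagonal_ideal_power :: "nat \<Rightarrow> 's::comm_ring_1 tensor set" where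
  "diagonal_ideal_power 0 = UNIV"
| "diagonal_ideal_power (Suc k) =
     {concat (map (\<lambda>(T, U). tensor_mult T U) TUs) |TUs.
        set TUs \<subseteq> diagonal_ideal \<times> diagonal_ideal_power k}"

definition linear_endos :: "('v::comm_ring_1 \<Rightarrow> 's::comm_ring_1) \<Rightarrow> ('s \<Rightarrow> 's) set" where
  "linear_endos e = {\<phi>. module_hom (\<lambda>v x. e v * x) (\<lambda>v x. e v * x) \<phi>}"

definition diff_ops :: "('v::comm_ring_1 \<Rightarrow> 's::comm_ring_1) \<Rightarrow> ('s \<Rightarrow> 's) set" where
  "diff_ops e =
     {\<phi> \<in> linear_endos e. \<exists>k. \<forall>T\<in>diagonal_ideal_power k. tensor_act T \<phi> = (\<lambda>_. 0)}"

lemma tensor_act_append: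
  "tensor_act (T @ U) \<phi> = (\<lambda>x. tensor_act T \<phi> x + tensor_act U \<phi> x)"
  by (simp add: tensor_act_def)

lemma tensor_act_add_left:
  "tensor_act [(r + r', s)] \<phi> = tensor_act [(r, s), (r', s)] \<phi>"
  by (simp add: tensor_act_def algebra_simps)

lemma tensor_act_add_right:
  assumes "\<phi> \<in> linear_endos e"
  shows "tensor_act [(r, s + s')] \<phi> = tensor_act [(r, s), (r, s')] \<phi>"
proof -
  interpret module_hom "\<lambda>v x. e v * x" "\<lambda>v x. e v * x" \<phi>
    using assms by (simp add: linear_endos_def)
  show ?thesis
    by (simp add: tensor_act_def add distrib_left distrib_right)
qed

lemma tensor_act_balanced:
  assumes "\<phi> \<in> linear_endos e"
  shows "tensor_act [(e v * r, s)] \<phi> = tensor_act [(r, e v * s)] \<phi>"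
proof -
  interpret module_hom "\<lambda>v x. e v * x" "\<lambda>v x. e v * x" \<phi>
    using assms by (simp add: linear_endos_def)
  show ?thesis
    by (simp add: tensor_act_def scale mult.assoc mult.left_commute[of r])
qed

lemma multiplication_map_relations:
  "multiplication_map (T @ U) = multiplication_map T + multiplication_map U"
  "multiplication_map [(r + r', s)] = multiplication_map [(r, s), (r', s)]"
  "multiplication_map [(r, s + s')] = multiplication_map [(r, s), (r, s')]"
  "multiplication_map [(e v * r, s)] = multiplication_map [(r, e v * s)]"
  by (simp_all add: multiplication_map_def algebra_simps)

lemma tensor_act_tensor_mult:
  assumes "\<phi> \<in> linear_endos e"
  shows "tensor_act (tensor_mult T U) \<phi> = tensor_act T (tensor_act U \<phi>)"
proof
  fix x
  show "tensor_act (tensor_mult T U) \<phi> x = tensor_act T (tensor_act U \<phi>) x"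
  proof (induction T)
    case Nil
    then show ?case by (simp add: tensor_act_def tensor_mult_def)
  next
    case (Cons rs T)
    have "(\<Sum>(r', s')\<leftarrow>map (\<lambda>(r', s'). (fst rs * r', snd rs * s')) U. r' * \<phi> (s' * x))
        = fst rs * (\<Sum>(r', s')\<leftarrow>U. r' * \<phi> (s' * (snd rs * x)))"
      by (induction U) (auto simp: algebra_simps)
    then show ?case
      using Cons by (cases rs)
        (simp add: tensor_act_def tensor_mult_def o_def case_prod_unfold)
  qed
qed


section \<open>The total ring of fractions\<close>

text \<open>Localizations at nonzerodivisors are formed inside the total ring of fractions.\<close>

definition frac_rel :: "'a::comm_ring_1 \<times> 'a \<Rightarrow> 'a \<times> 'a \<Rightarrow> bool" where
  "frac_rel x y \<longleftrightarrow>
     nonzerodivisor (snd x) \<and> nonzerodivisor (snd y) \<and> fst x * snd y = fst y * snd x"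

lemma nonzerodivisor_one [simp]: "nonzerodivisor 1"
  by (simp add: nonzerodivisor_def)

lemma nonzerodivisor_mult: "nonzerodivisor a \<Longrightarrow> nonzerodivisor b \<Longrightarrow> nonzerodivisor (a * b)"
  unfolding nonzerodivisor_def by (metis mult.assoc)

lemma nonzerodivisor_cancel: "nonzerodivisor a \<Longrightarrow> a * b = a * c \<Longrightarrow> b = c"
  unfolding nonzerodivisor_def by (metis eq_iff_diff_eq_0 right_diff_distrib)

lemma part_equivp_frac_rel: "part_equivp (frac_rel :: 'a::comm_ring_1 \<times> 'a \<Rightarrow> _)"
proof (rule part_equivpI)
  show "\<exists>x :: 'a \<times> 'a. frac_rel x x"
    by (rule exI[of _ "(0, 1)"]) (simp add: frac_rel_def)
  show "symp (frac_rel :: 'a \<times> 'a \<Rightarrow> _)"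
    by (auto simp: symp_def frac_rel_def)
  show "transp (frac_rel :: 'a \<times> 'a \<Rightarrow> _)"
  proof (rule transpI)
    fix x y z :: "'a \<times> 'a"
    assume xy: "frac_rel x y" and yz: "frac_rel y z"
    have "snd y * (fst x * snd z) = (fst x * snd y) * snd z"
      by (simp add: mult_ac)
    also have "\<dots> = (fst y * snd z) * snd x"
      using xy by (simp add: frac_rel_def mult_ac)
    also have "\<dots> = snd y * (fst z * snd x)"
      using yz by (simp add: frac_rel_def mult_ac)
    finally have "snd y * (fst x * snd z) = snd y * (fst z * snd x)" .
    then show "frac_rel x z"
      using xy yz nonzerodivisor_cancel unfolding frac_rel_def by blast
  qed
qed

quotient_type (overloaded) 'a total_frac = "'a::comm_ring_1 \<times> 'a" / partial: frac_rel
  by (rule part_equivp_frac_rel)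

text \<open>\<open>Frac a b\<close> is \<open>a / b\<close>; it is \<open>0\<close> if \<open>b\<close> is a zerodivisor.\<close>

lift_definition Frac :: "'a::comm_ring_1 \<Rightarrow> 'a \<Rightarrow> 'a total_frac"
  is "\<lambda>a b. if nonzerodivisor b then (a, b) else (0, 1)"
  by (simp add: frac_rel_def)

lemma Frac_cases [cases type: total_frac]:
  obtains a b where "q = Frac a b" "nonzerodivisor b"
proof -
  obtain x where "frac_rel x x" "q = abs_total_frac x"
    using Quotient_total_frac by (metis Quotient_abs_rep Quotient_rep_reflp)
  then show thesis
    using that[of "fst x" "snd x"] by (simp add: Frac_def frac_rel_def)
qed

lemma Frac_eq_iff:
  "nonzerodivisor b \<Longrightarrow> nonzerodivisor d \<Longrightarrow> Frac a b = Frac c d \<longleftrightarrow> a * d = c * b"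
  by transfer (simp add: frac_rel_def)

instantiation total_frac :: (comm_ring_1) comm_ring_1
begin

lift_definition zero_total_frac :: "'a total_frac" is "(0, 1)"
  by (simp add: frac_rel_def)

lift_definition one_total_frac :: "'a total_frac" is "(1, 1)"
  by (simp add: frac_rel_def)

lift_definition plus_total_frac :: "'a total_frac \<Rightarrow> 'a total_frac \<Rightarrow> 'a total_frac"
  is "\<lambda>q r. (fst q * snd r + fst r * snd q, snd q * snd r)"
proof -
  fix q q' r r' :: "'a \<times> 'a"
  assume "frac_rel q q'" "frac_rel r r'"
  then have n: "nonzerodivisor (snd q)" "nonzerodivisor (snd q')"
      "nonzerodivisor (snd r)" "nonzerodivisor (snd r')"
    and q: "fst q * snd q' = fst q' * snd q" and r: "fst r * snd r' = fst r' * snd r"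
    by (auto simp: frac_rel_def)
  have "(fst q * snd r + fst r * snd q) * (snd q' * snd r')
      = (fst q * snd q') * (snd r * snd r') + (fst r * snd r') * (snd q * snd q')"
    by (simp add: algebra_simps)
  also have "\<dots> = (fst q' * snd q) * (snd r * snd r') + (fst r' * snd r) * (snd q * snd q')"
    by (simp only: q r)
  also have "\<dots> = (fst q' * snd r' + fst r' * snd q') * (snd q * snd r)"
    by (simp add: algebra_simps)
  finally show "frac_rel (fst q * snd r + fst r * snd q, snd q * snd r)
      (fst q' * snd r' + fst r' * snd q', snd q' * snd r')"
    unfolding frac_rel_def fst_conv snd_conv by (intro conjI nonzerodivisor_mult n)
qed

lift_definition uminus_total_frac :: "'a total_frac \<Rightarrow> 'a total_frac"
  is "\<lambda>q. (- fst q, snd q)"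
  by (simp add: frac_rel_def)

definition minus_total_frac :: "'a total_frac \<Rightarrow> 'a total_frac \<Rightarrow> 'a total_frac" where
  "q - r = q + - (r :: 'a total_frac)"

lift_definition times_total_frac :: "'a total_frac \<Rightarrow> 'a total_frac \<Rightarrow> 'a total_frac"
  is "\<lambda>q r. (fst q * fst r, snd q * snd r)"
proof -
  fix q q' r r' :: "'a \<times> 'a"
  assume "frac_rel q q'" "frac_rel r r'"
  then have n: "nonzerodivisor (snd q)" "nonzerodivisor (snd q')"
      "nonzerodivisor (snd r)" "nonzerodivisor (snd r')"
    and q: "fst q * snd q' = fst q' * snd q" and r: "fst r * snd r' = fst r' * snd r"
    by (auto simp: frac_rel_def)
  have "(fst q * fst r) * (snd q' * snd r') = (fst q * snd q') * (fst r * snd r')"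
    by (simp add: algebra_simps)
  also have "\<dots> = (fst q' * snd q) * (fst r' * snd r)"
    by (simp only: q r)
  also have "\<dots> = (fst q' * fst r') * (snd q * snd r)"
    by (simp add: algebra_simps)
  finally show "frac_rel (fst q * fst r, snd q * snd r) (fst q' * fst r', snd q' * snd r')"
    unfolding frac_rel_def fst_conv snd_conv by (intro conjI nonzerodivisor_mult n)
qed

instance
proof
  fix q r s :: "'a total_frac"
  show "q * r * s = q * (r * s)"
    by transfer (simp add: frac_rel_def nonzerodivisor_mult algebra_simps)
  show "q * r = r * q"
    by transfer (simp add: frac_rel_def nonzerodivisor_mult algebra_simps)
  show "1 * q = q"
    by transfer (auto simp: frac_rel_def)
  show "q + r + s = q + (r + s)"
    by transfer (simp add: frac_rel_def nonzerodivisor_mult algebra_simps)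
  show "q + r = r + q"
    by transfer (simp add: frac_rel_def nonzerodivisor_mult algebra_simps)
  show "0 + q = q"
    by transfer (auto simp: frac_rel_def)
  show "- q + q = 0"
    by transfer (simp add: frac_rel_def nonzerodivisor_mult algebra_simps)
  show "q - r = q + - r"
    by (rule minus_total_frac_def)
  show "(q + r) * s = q * s + r * s"
    by transfer (simp add: frac_rel_def nonzerodivisor_mult algebra_simps)
  show "(0 :: 'a total_frac) \<noteq> 1"
    by transfer (simp add: frac_rel_def)
qed

end

text \<open>A structure of \<open>D\<^sub>S\<close>-module on a localization \<open>L\<close> of \<open>S\<close> (a subring of the total ring of
  fractions containing \<open>S\<close>) that extends both the given \<open>S\<close>-module structure of \<open>L\<close>, where
  \<open>S \<subseteq> D\<^sub>S\<close> acts by multiplication, and the \<open>D\<^sub>S\<close>-module structure of \<open>S\<close>. There is exactly one,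
  up to the values of \<open>act\<close> outside \<open>D\<^sub>S\<close> and \<open>L\<close>.\<close>

definition extends_diff_op_action ::
  "('v::comm_ring_1 \<Rightarrow> 's::comm_ring_1) \<Rightarrow> 's total_frac set \<Rightarrow>
     (('s \<Rightarrow> 's) \<Rightarrow> 's total_frac \<Rightarrow> 's total_frac) \<Rightarrow> bool" where
  "extends_diff_op_action e L act \<longleftrightarrow>
     (\<forall>\<delta>\<in>diff_ops e. \<forall>x\<in>L. act \<delta> x \<in> L) \<and>
     (\<forall>\<delta>\<in>diff_ops e. \<forall>x\<in>L. \<forall>y\<in>L. act \<delta> (x + y) = act \<delta> x + act \<delta> y) \<and>
     (\<forall>\<delta>\<in>diff_ops e. \<forall>\<epsilon>\<in>diff_ops e. \<forall>x\<in>L. act (\<lambda>y. \<delta> y + \<epsilon> y) x = act \<delta> x + act \<epsilon> x) \<and>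
     (\<forall>\<delta>\<in>diff_ops e. \<forall>\<epsilon>\<in>diff_ops e. \<forall>x\<in>L. act (\<delta> \<circ> \<epsilon>) x = act \<delta> (act \<epsilon> x)) \<and>
     (\<forall>s. \<forall>x\<in>L. act (\<lambda>y. s * y) x = Frac s 1 * x) \<and>
     (\<forall>\<delta>\<in>diff_ops e. \<forall>s. act \<delta> (Frac s 1) = Frac (\<delta> s) 1)"


section \<open>The $p$-adic integers\<close>

text \<open>A $p$-adic integer is the sequence of its residues modulo \<open>p ^ k\<close>, normalized to lie in
  \<open>{0..<p ^ k}\<close>. The $p$-adic topology is the subspace topology of the product topology on
  \<open>nat \<Rightarrow> int\<close> (the factors being discrete), i.e. the inverse limit topology.\<close>

definition padic_int :: "nat \<Rightarrow> (nat \<Rightarrow> int) set" where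
  "padic_int p =
     {\<alpha>. \<forall>k. \<alpha> k \<in> {0..<int p ^ k} \<and> \<alpha> (Suc k) mod int p ^ k = \<alpha> k}"

definition padic_of_int :: "nat \<Rightarrow> int \<Rightarrow> nat \<Rightarrow> int" where
  "padic_of_int p z = (\<lambda>k. z mod int p ^ k)"

definition padic_mult :: "nat \<Rightarrow> (nat \<Rightarrow> int) \<Rightarrow> (nat \<Rightarrow> int) \<Rightarrow> nat \<Rightarrow> int" where
  "padic_mult p \<alpha> \<beta> = (\<lambda>k. (\<alpha> k * \<beta> k) mod int p ^ k)"

text \<open>\<open>\<int>\<^sub>(\<^sub>p\<^sub>)\<close> as a subring of \<open>\<int>\<^sub>p\<close>: a rational \<open>q = a / b\<close> in lowest terms with
  \<open>p\<close> not dividing \<open>b\<close> is the $p$-adic integer \<open>\<alpha>\<close> with \<open>b \<alpha> = a\<close>.\<close>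

definition padic_rationals :: "nat \<Rightarrow> (nat \<Rightarrow> int) set" where
  "padic_rationals p =
     {\<alpha> \<in> padic_int p. \<exists>q :: rat.
        \<not> int p dvd snd (quotient_of q) \<and>
        padic_mult p (padic_of_int p (snd (quotient_of q))) \<alpha> =
          padic_of_int p (fst (quotient_of q))}"

text \<open>Continuous functions from \<open>\<int>\<^sub>p\<close> to the discrete ring \<open>V\<close>.\<close>

definition padic_cont_fns :: "nat \<Rightarrow> ((nat \<Rightarrow> int) \<Rightarrow> 'v) set" where
  "padic_cont_fns p =
     {\<phi> \<in> extensional (padic_int p).
        continuous_map (top_of_set (padic_int p)) (discrete_topology UNIV) \<phi>}"

definition colon_ideal ::
  "nat \<Rightarrow> 'v set \<Rightarrow> (nat \<Rightarrow> int) \<Rightarrow> ((nat \<Rightarrow> int) \<Rightarrow> 'v) set" where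
  "colon_ideal p M \<alpha> = {\<phi> \<in> padic_cont_fns p. \<phi> \<alpha> \<in> M}"


section \<open>Localization of modules\<close>

text \<open>Localization of a module with carrier \<open>N\<close> at a multiplicative subset \<open>W\<close> of the
  scalars; the pair \<open>(m, s)\<close> stands for \<open>m / s\<close>.\<close>

definition localization_rel ::
  "('c \<Rightarrow> 'm \<Rightarrow> 'm) \<Rightarrow> 'm set \<Rightarrow> 'c set \<Rightarrow> (('m \<times> 'c) \<times> ('m \<times> 'c)) set" where
  "localization_rel smul N W =
     {((m, s), (m', s')). m \<in> N \<and> s \<in> W \<and> m' \<in> N \<and> s' \<in> W \<and>
        (\<exists>u\<in>W. smul u (smul s' m) = smul u (smul s m'))}"

definition localized_module ::
  "('c \<Rightarrow> 'm \<Rightarrow> 'm) \<Rightarrow> 'm set \<Rightarrow> 'c set \<Rightarrow> ('m \<times> 'c) set set" where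
  "localized_module smul N W = (N \<times> W) // localization_rel smul N W"


section \<open>Bernstein--Sato roots\<close>

text \<open>Here \<open>R\<close> is a \<open>V\<close>-algebra with structure map \<open>c\<close>, and \<open>R[t]\<close> is the type \<open>'r poly\<close>
  with \<open>t = [:0, 1:]\<close>; so \<open>f - t = [:f, -1:]\<close>.\<close>

definition poly_algebra_map :: "('v \<Rightarrow> 'r::comm_ring_1) \<Rightarrow> 'v \<Rightarrow> 'r poly" where
  "poly_algebra_map c v = [:c v:]"

definition diff_ops_deg0 ::
  "('v::comm_ring_1 \<Rightarrow> 'r::comm_ring_1) \<Rightarrow> ('r poly \<Rightarrow> 'r poly) set" where
  "diff_ops_deg0 c =
     {\<delta> \<in> diff_ops (poly_algebra_map c). \<forall>r a. \<exists>r'. \<delta> (monom r a) = monom r' a}"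

text \<open>The operator \<open>r t\<^sup>a \<mapsto> \<phi> (-1 - a) r t\<^sup>a\<close>.\<close>

definition cont_fn_op ::
  "nat \<Rightarrow> ('v \<Rightarrow> 'r::comm_ring_1) \<Rightarrow> ((nat \<Rightarrow> int) \<Rightarrow> 'v) \<Rightarrow> 'r poly \<Rightarrow> 'r poly" where
  "cont_fn_op p c \<phi> g =
     (\<Sum>a\<le>degree g. monom (c (\<phi> (padic_of_int p (- 1 - int a))) * coeff g a) a)"

text \<open>\<open>R[t, f\<^sup>-\<^sup>1, (f - t)\<^sup>-\<^sup>1]\<close> and its subring \<open>R[t, f\<^sup>-\<^sup>1]\<close>.\<close>

definition loc_f_ft :: "'r::comm_ring_1 \<Rightarrow> 'r poly total_frac set" where
  "loc_f_ft f = {Frac g ([:f:] ^ i * [:f, -1:] ^ j) |g i j. True}"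

definition loc_f :: "'r::comm_ring_1 \<Rightarrow> 'r poly total_frac set" where
  "loc_f f = {Frac g ([:f:] ^ i) |g i. True}"

text \<open>Let \<open>act\<close> be the action of differential operators on a module, \<open>K\<close> a submodule. Elements
  of the quotient by \<open>K\<close> are cosets \<open>x +o K\<close>, added as sets, and \<open>quotient_act K act \<delta>\<close> maps
  \<open>x +o K\<close> to \<open>act \<delta> x +o K\<close>.\<close>

definition quotient_act ::
  "'m::plus set \<Rightarrow> ('d \<Rightarrow> 'm \<Rightarrow> 'm) \<Rightarrow> 'd \<Rightarrow> 'm set \<Rightarrow> 'm set" where
  "quotient_act K act \<delta> X = act \<delta> ` X + K"

text \<open>In the following definitions, \<open>act\<close> is the action of \<open>D\<close> on \<open>R[t, f\<^sup>-\<^sup>1, (f - t)\<^sup>-\<^sup>1]\<close>.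
  An element of \<open>H\<^sub>f\<close> is a coset of \<open>R[t, f\<^sup>-\<^sup>1]\<close>.\<close>

definition H_act ::
  "'r::comm_ring_1 \<Rightarrow> (('r poly \<Rightarrow> 'r poly) \<Rightarrow> 'r poly total_frac \<Rightarrow> 'r poly total_frac) \<Rightarrow>
     ('r poly \<Rightarrow> 'r poly) \<Rightarrow> 'r poly total_frac set \<Rightarrow> 'r poly total_frac set" where
  "H_act f act = quotient_act (loc_f f) act"

definition delta0 :: "'r::comm_ring_1 \<Rightarrow> 'r poly total_frac set" where
  "delta0 f = Frac 1 [:f, -1:] +o loc_f f"

definition D0_delta0 ::
  "('v::comm_ring_1 \<Rightarrow> 'r::comm_ring_1) \<Rightarrow> 'r \<Rightarrow>
     (('r poly \<Rightarrow> 'r poly) \<Rightarrow> 'r poly total_frac \<Rightarrow> 'r poly total_frac) \<Rightarrow>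
     'r poly total_frac set set" where
  "D0_delta0 c f act = {H_act f act \<delta> (delta0 f) |\<delta>. \<delta> \<in> diff_ops_deg0 c}"

definition D0_f_delta0 ::
  "('v::comm_ring_1 \<Rightarrow> 'r::comm_ring_1) \<Rightarrow> 'r \<Rightarrow>
     (('r poly \<Rightarrow> 'r poly) \<Rightarrow> 'r poly total_frac \<Rightarrow> 'r poly total_frac) \<Rightarrow>
     'r poly total_frac set set" where
  "D0_f_delta0 c f act =
     {H_act f act \<delta> (H_act f act (\<lambda>g. [:f:] * g) (delta0 f)) |\<delta>. \<delta> \<in> diff_ops_deg0 c}"

definition N_module ::
  "('v::comm_ring_1 \<Rightarrow> 'r::comm_ring_1) \<Rightarrow> 'r \<Rightarrow>
     (('r poly \<Rightarrow> 'r poly) \<Rightarrow> 'r poly total_frac \<Rightarrow> 'r poly total_frac) \<Rightarrow>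
     'r poly total_frac set set set" where
  "N_module c f act = {X +o D0_f_delta0 c f act |X. X \<in> D0_delta0 c f act}"

definition N_smul ::
  "nat \<Rightarrow> ('v::comm_ring_1 \<Rightarrow> 'r::comm_ring_1) \<Rightarrow> 'r \<Rightarrow>
     (('r poly \<Rightarrow> 'r poly) \<Rightarrow> 'r poly total_frac \<Rightarrow> 'r poly total_frac) \<Rightarrow>
     ((nat \<Rightarrow> int) \<Rightarrow> 'v) \<Rightarrow> 'r poly total_frac set set \<Rightarrow> 'r poly total_frac set set" where
  "N_smul p c f act \<phi> =
     quotient_act (D0_f_delta0 c f act) (H_act f act) (cont_fn_op p c \<phi>)"

definition N_localized ::
  "nat \<Rightarrow> 'v set \<Rightarrow> ('v::comm_ring_1 \<Rightarrow> 'r::comm_ring_1) \<Rightarrow> 'r \<Rightarrow>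
     (('r poly \<Rightarrow> 'r poly) \<Rightarrow> 'r poly total_frac \<Rightarrow> 'r poly total_frac) \<Rightarrow> (nat \<Rightarrow> int) \<Rightarrow>
     ('r poly total_frac set set \<times> ((nat \<Rightarrow> int) \<Rightarrow> 'v)) set set" where
  "N_localized p M c f act \<alpha> =
     localized_module (N_smul p c f act) (N_module c f act)
       (padic_cont_fns p - colon_ideal p M \<alpha>)"

text \<open>The zero element \<open>0 / 1\<close> of the localization; the zero of \<open>N\<^sub>f\<close> is the trivial coset.\<close>

definition N_localized_zero ::
  "nat \<Rightarrow> 'v set \<Rightarrow> ('v::comm_ring_1 \<Rightarrow> 'r::comm_ring_1) \<Rightarrow> 'r \<Rightarrow>
     (('r poly \<Rightarrow> 'r poly) \<Rightarrow> 'r poly total_frac \<Rightarrow> 'r poly total_frac) \<Rightarrow> (nat \<Rightarrow> int) \<Rightarrow>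
     ('r poly total_frac set set \<times> ((nat \<Rightarrow> int) \<Rightarrow> 'v)) set" where
  "N_localized_zero p M c f act \<alpha> =
     localization_rel (N_smul p c f act) (N_module c f act)
       (padic_cont_fns p - colon_ideal p M \<alpha>)
       `` {(D0_f_delta0 c f act, restrict (\<lambda>_. 1) (padic_int p))}"

text \<open>The quantified \<open>act\<close> is the unique action extending the one on \<open>R[t]\<close>.\<close>

definition bernstein_sato_roots ::
  "nat \<Rightarrow> 'v set \<Rightarrow> ('v::comm_ring_1 \<Rightarrow> 'r::comm_ring_1) \<Rightarrow> 'r \<Rightarrow> (nat \<Rightarrow> int) set" where
  "bernstein_sato_roots p M c f =
     {\<alpha> \<in> padic_int p. \<exists>act.
        extends_diff_op_action (poly_algebra_map c) (loc_f_ft f) act \<and>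
        N_localized p M c f act \<alpha> \<noteq> {N_localized_zero p M c f act \<alpha>}}"

end

theory Submission
  imports Defs
begin

text \<open>
  Why the roots are rational. Write \<open>R = V[x\<^sub>1, \<dots>, x\<^sub>n]\<close>, and let \<open>Frob\<close> be the ring endomorphism
  of \<open>R\<close> that is \<open>F\<close> on \<open>V\<close> and raises each variable to its \<open>p\<close>-th power. Since \<open>F\<close> is bijective,
  \<open>R\<close> is free over \<open>Frob\<^sup>e(R)\<close> on the monomials with all exponents below \<open>p\<^sup>e\<close>. The additive maps
  that are linear over \<open>Frob\<^sup>e(R)\<close> form a ring \<open>D\<^sup>(\<^sup>e\<^sup>)\<close> (\<open>level_ops e\<close>); because \<open>p\<close> is nilpotent in
  \<open>V\<close> they are differential operators (\<open>diff_ops_if_power_linear\<close>, here applied to \<open>R[t]\<close>). A number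
  \<open>q\<close> is called a jump of \<open>f\<close> at level \<open>e\<close> if \<open>f\<^sup>q\<close> is not in \<open>D\<^sup>(\<^sup>e\<^sup>) f\<^sup>q\<^sup>+\<^sup>1\<close>. The proof compares roots
  with jumps and then counts jumps.

  Roots are limits of jumps (\<open>jumps_if_bernstein_sato_root\<close>). Suppose that no jump of level \<open>e\<close> is
  congruent to \<open>\<alpha>\<close> modulo \<open>p\<^sup>e\<close>, so that for each \<open>\<nu> \<equiv> \<alpha>\<close> some \<open>\<delta>\<^sub>\<nu> \<in> D\<^sup>(\<^sup>e\<^sup>)\<close> maps \<open>f\<^sup>\<nu>\<^sup>+\<^sup>1\<close> to \<open>f\<^sup>\<nu>\<close>. For
  a large power \<open>Q\<close> of \<open>p\<close> write
  \<open>1 / (f - t) = (\<Sum>a<Q. f\<^sup>Q\<^sup>-\<^sup>1\<^sup>-\<^sup>a t\<^sup>a) / (f\<^sup>Q - t\<^sup>Q)\<close>. The denominator is a scalar for operators of a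
  suitable level, so these act on the numerator. Applying \<open>\<delta>\<^sub>\<nu>\<close> to the coefficient of \<open>t\<^sup>a\<close>, with
  \<open>\<nu> \<equiv> -1 - a\<close>, gives one operator \<open>\<Delta>\<close> of degree \<open>0\<close> with \<open>\<Delta> f \<delta>\<^sub>0 = u \<delta>\<^sub>0\<close>, where \<open>u\<close> is the indicator
  function of \<open>\<alpha> + p\<^sup>e \<int>\<^sub>p\<close>. Operators of degree \<open>0\<close> commute with continuous functions, so \<open>u\<close> kills all
  of \<open>N\<^sub>f\<close>, and \<open>u(\<alpha>) = 1\<close> makes the localization at \<open>\<alpha>\<close> vanish (\<open>localization_trivial\<close>).

  Jumps are rare. As \<open>Frob f - f\<^sup>p\<close> is nilpotent, some power \<open>g = f ^ (p ^ K)\<close> satisfies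
  \<open>Frob g = g\<^sup>p\<close> exactly (\<open>Frob_prime_power\<close>). For such \<open>g\<close> the jumps of level \<open>e\<close> are closed under
  reduction modulo \<open>p\<^sup>e\<close> (\<open>jumps_mod\<close>), and integer division by \<open>p\<close> maps jumps of level \<open>e + 1\<close> to jumps
  of level \<open>e\<close> (\<open>jumps_div\<close>, by the Frobenius splitting). The number of jumps below \<open>p\<^sup>e\<close> is bounded
  independently of \<open>e\<close> (\<open>card_jumps_le\<close>): for \<open>j \<le> p\<^sup>e\<close> the module \<open>D\<^sup>(\<^sup>e\<^sup>) g\<^sup>j\<close> is determined by the
  polynomials \<open>r\<close> of degree at most \<open>deg g\<close> with \<open>Frob\<^sup>e r \<in> D\<^sup>(\<^sup>e\<^sup>) g\<^sup>j\<close>, and the polynomials of bounded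
  degree form a \<open>V\<close>-module of finite length.

  Conclusion (\<open>padic_rational_if_jumps\<close>). Deleting \<open>K + i\<close> digits of a root \<open>\<alpha>\<close> gives, for every
  \<open>i\<close>, a limit of jumps of \<open>g\<close>. There are boundedly many of these, so two deletions agree: the
  digits of \<open>\<alpha>\<close> are eventually periodic, and \<open>\<alpha>\<close> is rational.
\<close>


section \<open>Lengths of modules over artinian local rings\<close>

lemma module_mult: "module ((*) :: 'a::comm_ring_1 \<Rightarrow> 'a \<Rightarrow> 'a)"
  by (simp add: module_def algebra_simps)

lemma module_hom_mult: "module_hom (*) (*) ((*) (v :: 'a::comm_ring_1))"
  by (auto intro!: module_hom.intro module_hom_axioms.intro module_mult
      simp: distrib_left mult.left_commute)

lemma principal_ideal: "ring_ideal (range (\<lambda>w :: 'a::comm_ring_1. w * v))"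
proof -
  interpret R: module "(*) :: 'a \<Rightarrow> 'a \<Rightarrow> 'a" by (rule module_mult)
  note R.scale_scale [simp del]
  show ?thesis
  proof (rule R.subspaceI)
    show "0 \<in> range (\<lambda>w. w * v)" using rangeI[of "\<lambda>w. w * v" 0] by simp
    fix y z assume "y \<in> range (\<lambda>w. w * v)" "z \<in> range (\<lambda>w. w * v)"
    then obtain a b where "y = a * v" "z = b * v" by (elim rangeE)
    then show "y + z \<in> range (\<lambda>w. w * v)" using rangeI[of "\<lambda>w. w * v" "a + b"] by (simp add: distrib_right)
  next
    fix r y assume "y \<in> range (\<lambda>w. w * v)"
    then obtain a where "y = a * v" by (elim rangeE)
    then show "r * y \<in> range (\<lambda>w. w * v)" using rangeI[of "\<lambda>w. w * v" "r * a"] by (simp add: mult.assoc)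
  qed
qed

definition submodule_chain ::
  "('a::comm_ring_1 \<Rightarrow> 'b::ab_group_add \<Rightarrow> 'b) \<Rightarrow> 'b set \<Rightarrow> 'b set \<Rightarrow> (nat \<Rightarrow> 'b set) \<Rightarrow> bool" where
  "submodule_chain smul J I W \<longleftrightarrow>
     (\<forall>k. module.subspace smul (W k) \<and> J \<subseteq> W k \<and> W k \<subseteq> I \<and> W (Suc k) \<subseteq> W k)"

definition chain_drops :: "(nat \<Rightarrow> 'b set) \<Rightarrow> nat set" where
  "chain_drops W = {k. W (Suc k) \<noteq> W k}"

text \<open>The module \<open>I / J\<close> has length at most \<open>n\<close>, phrased through submodules between \<open>J\<close> and \<open>I\<close>, so
  that no quotient module has to be formed.\<close>

definition length_le ::
  "('a::comm_ring_1 \<Rightarrow> 'b::ab_group_add \<Rightarrow> 'b) \<Rightarrow> 'b set \<Rightarrow> 'b set \<Rightarrow> nat \<Rightarrow> bool" where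
  "length_le smul J I n \<longleftrightarrow>
     (\<forall>W. submodule_chain smul J I W \<longrightarrow> finite (chain_drops W) \<and> card (chain_drops W) \<le> n)"

lemma length_leD:
  assumes "length_le smul J I n" "submodule_chain smul J I W"
  shows "finite (chain_drops W)" "card (chain_drops W) \<le> n"
  using assms by (auto simp: length_le_def)

lemma length_le_self: "length_le smul J J 0"
proof -
  have "chain_drops W = {}" if "submodule_chain smul J J W" for W
    using that unfolding submodule_chain_def chain_drops_def
    by (metis (mono_tags, lifting) Collect_empty_eq subset_antisym)
  then show ?thesis by (simp add: length_le_def)
qed

lemma length_le_subset:
  assumes "length_le smul J I n" "J \<subseteq> J'" "I' \<subseteq> I"
  shows "length_le smul J' I' n"
  using assms unfolding length_le_def submodule_chain_def by (meson order_trans)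

lemma submodule_sums:
  assumes "module smul" "module.subspace smul A" "module.subspace smul B"
  shows "module.subspace smul {x + y |x y. x \<in> A \<and> y \<in> B}"
proof -
  interpret M: module smul by fact
  show ?thesis
  proof (rule M.subspaceI)
    show "0 \<in> {x + y |x y. x \<in> A \<and> y \<in> B}"
      using M.subspace_0[OF assms(2)] M.subspace_0[OF assms(3)] by force
    show "smul v z \<in> {x + y |x y. x \<in> A \<and> y \<in> B}" if "z \<in> {x + y |x y. x \<in> A \<and> y \<in> B}" for v z
      using that M.subspace_scale[OF assms(2)] M.subspace_scale[OF assms(3)]
      by (auto simp: M.scale_right_distrib) blast
    fix z z' assume "z \<in> {x + y |x y. x \<in> A \<and> y \<in> B}" "z' \<in> {x + y |x y. x \<in> A \<and> y \<in> B}"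
    then obtain x y x' y' where "z = x + y" "z' = x' + y'" "x \<in> A" "x' \<in> A" "y \<in> B" "y' \<in> B"
      by blast
    then have "z + z' = (x + x') + (y + y')" "x + x' \<in> A" "y + y' \<in> B"
      using M.subspace_add[OF assms(2)] M.subspace_add[OF assms(3)] by auto
    then show "z + z' \<in> {x + y |x y. x \<in> A \<and> y \<in> B}" by blast
  qed
qed

text \<open>By the modular law a chain can only drop where its intersection with \<open>B\<close> or its sum with \<open>B\<close>
  drops.\<close>

lemma length_le_trans:
  assumes "module smul" "length_le smul A B m" "length_le smul B C n"
    and B: "module.subspace smul B" and C: "module.subspace smul C" and "A \<subseteq> B" "B \<subseteq> C"
  shows "length_le smul A C (m + n)"
  unfolding length_le_def
proof (intro allI impI)
  interpret M: module smul by fact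
  fix W assume W: "submodule_chain smul A C W"
  let ?W1 = "\<lambda>k. W k \<inter> B" and ?W2 = "\<lambda>k. {x + y |x y. x \<in> W k \<and> y \<in> B}"
  have sub: "M.subspace (W k)" and mono: "W (Suc k) \<subseteq> W k" and "W k \<subseteq> C" for k
    using W by (auto simp: submodule_chain_def)
  have W1: "submodule_chain smul A B ?W1"
    using W assms(4,6) by (auto simp: submodule_chain_def intro: M.subspace_inter)
  have "?W2 k \<subseteq> C" for k
    using \<open>W k \<subseteq> C\<close> \<open>B \<subseteq> C\<close> M.subspace_add[OF C] by blast
  moreover have "B \<subseteq> ?W2 k" for k
    using M.subspace_0[OF sub] by force
  ultimately have W2: "submodule_chain smul B C ?W2"
    unfolding submodule_chain_def using submodule_sums[OF assms(1) sub B] mono by blast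
  have sub: "chain_drops W \<subseteq> chain_drops ?W1 \<union> chain_drops ?W2"
  proof (rule subsetI, rule ccontr)
    fix k assume k: "k \<in> chain_drops W"
      and "k \<notin> chain_drops ?W1 \<union> chain_drops ?W2"
    then have nk: "?W1 (Suc k) = ?W1 k" "?W2 (Suc k) = ?W2 k"
      by (simp_all add: chain_drops_def)
    have "W k \<subseteq> W (Suc k)"
    proof
      fix x assume x: "x \<in> W k"
      then have "x \<in> ?W2 k"
        using M.subspace_0[OF B] by force
      then obtain y b where yb: "x = y + b" "y \<in> W (Suc k)" "b \<in> B"
        using nk(2) by blast
      then have "b \<in> ?W1 k"
        using M.subspace_diff[OF sub[of k] x, of y] mono[of k] by auto
      then have "b \<in> W (Suc k)"
        using nk(1) by blast
      then show "x \<in> W (Suc k)"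
        using yb M.subspace_add[OF sub] by blast
    qed
    then show False using k mono by (auto simp: chain_drops_def)
  qed
  have "finite (chain_drops ?W1 \<union> chain_drops ?W2)"
    "card (chain_drops ?W1 \<union> chain_drops ?W2) \<le> m + n"
    using length_leD[OF assms(2) W1] length_leD[OF assms(3) W2]
    by (auto intro: order_trans[OF card_Un_le])
  then show "finite (chain_drops W) \<and> card (chain_drops W) \<le> m + n"
    using sub by (meson card_mono finite_subset order_trans)
qed

text \<open>A submodule between \<open>J\<close> and \<open>J + V x\<close> is recovered from the ideal of all \<open>v\<close> that multiply \<open>x\<close>
  into it.\<close>

lemma length_le_add_generator:
  assumes "module smul" and J: "module.subspace smul J"
    and len: "length_le (*) {v. smul v x \<in> J} UNIV n"
  shows "length_le smul J {j + smul v x |j v. j \<in> J} n"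
  unfolding length_le_def
proof (intro allI impI)
  interpret M: module smul by fact
  interpret R: module "(*) :: 'a \<Rightarrow> 'a \<Rightarrow> 'a" by (rule module_mult)
  note R.scale_scale [simp del]
  fix W assume W: "submodule_chain smul J {j + smul v x |j v. j \<in> J} W"
  then have sub: "M.subspace (W k)" and mono: "W (Suc k) \<subseteq> W k" and JW: "J \<subseteq> W k"
    and WI: "W k \<subseteq> {j + smul v x |j v. j \<in> J}" for k
    by (auto simp: submodule_chain_def)
  define Q where "Q k = {v. smul v x \<in> W k}" for k
  have "R.subspace (Q k)" for k
    using sub[of k] by (auto simp: R.subspace_def Q_def M.subspace_def M.scale_left_distrib simp flip: M.scale_scale)
  then have "submodule_chain (*) {v. smul v x \<in> J} UNIV Q"
    using mono JW by (auto simp: submodule_chain_def Q_def subset_iff)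
  note lenQ = length_leD[OF len this]
  have "chain_drops W \<subseteq> chain_drops Q"
  proof (rule subsetI, rule ccontr)
    fix k assume k: "k \<in> chain_drops W" and "k \<notin> chain_drops Q"
    then have nk: "Q (Suc k) = Q k"
      by (simp add: chain_drops_def)
    have "W k \<subseteq> W (Suc k)"
    proof
      fix y assume y: "y \<in> W k"
      then obtain j v where jv: "y = j + smul v x" "j \<in> J"
        using WI by blast
      then have "v \<in> Q k"
        using M.subspace_diff[OF sub y, of j] JW by (auto simp: Q_def)
      then have "smul v x \<in> W (Suc k)"
        using nk by (auto simp: Q_def)
      then show "y \<in> W (Suc k)"
        using jv JW M.subspace_add[OF sub] by blast
    qed
    then show False using k mono by (auto simp: chain_drops_def)
  qed
  then show "finite (chain_drops W) \<and> card (chain_drops W) \<le> n"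
    using lenQ by (meson card_mono finite_subset order_trans)
qed

text \<open>Multiplication by \<open>v\<close> identifies \<open>I / Ann\<^sub>I(v)\<close> with \<open>v I\<close>.\<close>

lemma length_le_kernel:
  assumes "length_le (*) {0} ((*) v ` I) n" "ring_ideal I"
  shows "length_le (*) {y \<in> I. v * y = 0} (I :: 'a::comm_ring_1 set) n"
  unfolding length_le_def
proof (intro allI impI)
  interpret R: module "(*) :: 'a \<Rightarrow> 'a \<Rightarrow> 'a" by (rule module_mult)
  note R.scale_scale [simp del]
  fix W assume W: "submodule_chain (*) {y \<in> I. v * y = 0} I W"
  then have sub: "R.subspace (W k)" and mono: "W (Suc k) \<subseteq> W k" 
    and JW: "{y \<in> I. v * y = 0} \<subseteq> W k" and WI: "W k \<subseteq> I" for k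
    by (auto simp: submodule_chain_def)
  have h: "module_hom (*) (*) ((*) v)"
    by (rule module_hom_mult)
  have "submodule_chain (*) {0} ((*) v ` I) (\<lambda>k. (*) v ` W k)"
    unfolding submodule_chain_def
  proof (intro allI conjI)
    fix k
    show "R.subspace ((*) v ` W k)" by (rule module_hom.subspace_image[OF h sub])
    then show "{0} \<subseteq> (*) v ` W k" using R.subspace_0 by blast
    show "(*) v ` W k \<subseteq> (*) v ` I" "(*) v ` W (Suc k) \<subseteq> (*) v ` W k"
      using WI mono by (simp_all add: image_mono)
  qed
  note lenQ = length_leD[OF assms(1) this]
  have "chain_drops W \<subseteq> chain_drops (\<lambda>k. (*) v ` W k)"
  proof (rule subsetI, rule ccontr)
    fix k assume k: "k \<in> chain_drops W" and "k \<notin> chain_drops (\<lambda>k. (*) v ` W k)"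
    then have nk: "(*) v ` W (Suc k) = (*) v ` W k"
      by (simp add: chain_drops_def)
    have "W k \<subseteq> W (Suc k)"
    proof
      fix y assume y: "y \<in> W k"
      then obtain z where z: "z \<in> W (Suc k)" "v * y = v * z"
        using nk by blast
      then have "z \<in> W k" using mono by blast
      then have "y - z \<in> I" using R.subspace_diff[OF sub y, of z] WI by blast
      then have "y - z \<in> W (Suc k)"
        using JW[of "Suc k"] z(2) by (auto simp: right_diff_distrib)
      then show "y \<in> W (Suc k)"
        using z R.subspace_add[OF sub] by fastforce
    qed
    then show False using k mono by (auto simp: chain_drops_def)
  qed
  then show "finite (chain_drops W) \<and> card (chain_drops W) \<le> n"
    using lenQ by (meson card_mono finite_subset order_trans)
qed

text \<open>Used twice: with \<open>x = 1\<close> it yields maximal ideals, and in a vector space it yields hyperplanes.\<close>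

lemma maximal_submodule_avoiding:
  assumes "module smul" "module.subspace smul J0" "J0 \<subseteq> I" "x \<notin> J0"
  shows "\<exists>J. module.subspace smul J \<and> J0 \<subseteq> J \<and> J \<subseteq> I \<and> x \<notin> J \<and>
    (\<forall>J'. module.subspace smul J' \<and> J \<subseteq> J' \<and> J' \<subseteq> I \<and> x \<notin> J' \<longrightarrow> J' = J)"
proof -
  interpret M: module smul by fact
  let ?A = "{J. M.subspace J \<and> J0 \<subseteq> J \<and> J \<subseteq> I \<and> x \<notin> J}"
  have "\<exists>U\<in>?A. \<forall>X\<in>?A. U \<subseteq> X \<longrightarrow> X = U"
  proof (rule subset_Zorn_nonempty)
    show "?A \<noteq> {}" using assms by blast
    fix C assume C: "C \<noteq> {}" "subset.chain ?A C"
    then have CA: "C \<subseteq> ?A" and lin: "\<And>X Y. X \<in> C \<Longrightarrow> Y \<in> C \<Longrightarrow> X \<subseteq> Y \<or> Y \<subseteq> X"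
      by (auto simp: subset_chain_def)
    have "M.subspace (\<Union>C)"
    proof (rule M.subspaceI)
      show "0 \<in> \<Union>C" using C(1) CA M.subspace_0 by fastforce
      show "smul v y \<in> \<Union>C" if "y \<in> \<Union>C" for v y
        using that CA M.subspace_scale by fast
      fix y z assume "y \<in> \<Union>C" "z \<in> \<Union>C"
      then obtain Y Z where YZ: "y \<in> Y" "z \<in> Z" "Y \<in> C" "Z \<in> C" by blast
      then obtain X where "X \<in> C" "y \<in> X" "z \<in> X" using lin by blast
      then show "y + z \<in> \<Union>C" using CA M.subspace_add by blast
    qed
    then show "\<Union>C \<in> ?A" using C(1) CA by blast
  qed
  then obtain U where U: "U \<in> ?A" "\<forall>X\<in>?A. U \<subseteq> X \<longrightarrow> X = U" by (elim bexE)
  have "J' = U" if "M.subspace J'" "U \<subseteq> J'" "J' \<subseteq> I" "x \<notin> J'" for J'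
  proof -
    have "J' \<in> ?A" using that U(1) by auto
    then show ?thesis using U(2) that(2) by blast
  qed
  then show ?thesis using U(1) by (intro exI[of _ U]) simp
qed

lemma local_ring_unit:
  assumes "local_ring_with M" "v \<notin> (M :: 'a::comm_ring_1 set)"
  shows "v dvd 1"
proof (rule ccontr)
  interpret R: module "(*) :: 'a \<Rightarrow> 'a \<Rightarrow> 'a" by (rule module_mult)
  note R.scale_scale [simp del]
  assume "\<not> v dvd 1"
  have sub: "R.subspace (range (\<lambda>w. w * v))"
    by (rule principal_ideal)
  have "1 \<notin> range (\<lambda>w. w * v)"
    using \<open>\<not> v dvd 1\<close> by (metis dvd_triv_right rangeE)
  from maximal_submodule_avoiding[OF module_mult sub subset_UNIV this]
  obtain J where J: "R.subspace J" "range (\<lambda>w. w * v) \<subseteq> J" "1 \<notin> J"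
    "\<forall>J'. R.subspace J' \<and> J \<subseteq> J' \<and> J' \<subseteq> UNIV \<and> 1 \<notin> J' \<longrightarrow> J' = J"
    by (elim exE conjE)
  have one: "I = UNIV" if "1 \<in> I" "R.subspace I" for I
    using R.subspace_scale[OF that(2,1)] by auto
  have "max_ideal J"
    unfolding max_ideal_def
  proof (intro conjI allI impI)
    fix I assume "R.subspace I \<and> J \<subseteq> I"
    then show "I = J \<or> I = UNIV" using J(4) one[of I] by blast
  qed (use J in auto)
  then have "J = M" using assms(1) by (simp add: local_ring_with_def)
  moreover have "v \<in> J" using J(2) by (metis mult_1 rangeI subsetD)
  ultimately show False using assms(2) by simp
qed

lemma artinian_ringD:
  fixes I :: "nat \<Rightarrow> 'a::comm_ring_1 set"
  assumes artinian: "artinian_ring TYPE('a)"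
    and ideal: "\<And>k. ring_ideal (I k)" and mono: "\<And>k. I (Suc k) \<subseteq> I k"
  shows "\<exists>N. \<forall>k\<ge>N. I k = I N"
  by (rule artinian[unfolded artinian_ring_def, THEN spec[where x = I], THEN mp])
    (intro conjI allI ideal mono)

lemma artinian_minimal_ideal:
  assumes "artinian_ring TYPE('a::comm_ring_1)" "ring_ideal (I0 :: 'a set)" "P I0"
  shows "\<exists>I. ring_ideal I \<and> P I \<and> (\<forall>J. ring_ideal J \<and> J \<subset> I \<longrightarrow> \<not> P J)"
proof (rule ccontr)
  assume no: "\<not> ?thesis"
  let ?S = "{I. ring_ideal I \<and> P I}"
  have step: "\<exists>J. J \<in> ?S \<and> J \<subset> I" if "I \<in> ?S" for I
  proof -
    have "\<not> (\<forall>J. ring_ideal J \<and> J \<subset> I \<longrightarrow> \<not> P J)"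
      using no that by simp
    then show ?thesis by (simp add: conj_ac)
  qed
  have "\<exists>g. \<forall>k. g k \<in> ?S \<and> g (Suc k) \<subset> g k"
  proof (rule dependent_nat_choice[of "\<lambda>_ I. I \<in> ?S" "\<lambda>_ I J. J \<subset> I"])
    show "\<exists>I. I \<in> ?S" using assms(2,3) by (intro exI[of _ I0]) simp
    show "\<exists>J. J \<in> ?S \<and> J \<subset> I" if "I \<in> ?S" for I using step[OF that] .
  qed
  then obtain g where g: "\<forall>k. g k \<in> ?S \<and> g (Suc k) \<subset> g k" by (elim exE)
  have "ring_ideal (g k)" "g (Suc k) \<subseteq> g k" for k
    using spec[OF g, of k] by (simp_all add: psubset_imp_subset)
  then have "\<exists>N. \<forall>k\<ge>N. g k = g N"
    by (rule artinian_ringD[OF assms(1)])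
  then obtain N where N: "\<forall>k\<ge>N. g k = g N" ..
  have "g (Suc N) = g N" by (rule N[rule_format]) simp
  then show False
    using spec[OF g, of N] by simp
qed

context
  fixes M :: "'a::comm_ring_1 set"
  assumes artinian: "artinian_ring TYPE('a)" and local_ring: "local_ring_with M"
begin

lemma max_ideal_local: "max_ideal M"
  using local_ring by (simp add: local_ring_with_def)

text \<open>The chain of ideals \<open>V v\<^sup>k\<close> becomes stationary, \<open>v\<^sup>N = w v\<^sup>N\<^sup>+\<^sup>1\<close>, and \<open>1 - w v\<close> is a unit.\<close>

lemma artinian_local_nilpotent:
  assumes "v \<in> M"
  obtains k where "v ^ k = 0"
proof -
  interpret R: module "(*) :: 'a \<Rightarrow> 'a \<Rightarrow> 'a" by (rule module_mult)
  note R.scale_scale [simp del]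
  let ?I = "\<lambda>k. range (\<lambda>w. w * v ^ k)"
  have "R.subspace (?I k)" for k
    by (rule principal_ideal)
  moreover have "?I (Suc k) \<subseteq> ?I k" for k
  proof
    fix y assume "y \<in> ?I (Suc k)"
    then obtain w where "y = w * v ^ Suc k" by (elim rangeE)
    then show "y \<in> ?I k" using rangeI[of "\<lambda>w. w * v ^ k" "w * v"] by (simp add: mult.assoc)
  qed
  ultimately have "\<exists>N. \<forall>k\<ge>N. ?I k = ?I N"
    by (rule artinian_ringD[OF artinian])
  then obtain N where "\<forall>k\<ge>N. ?I k = ?I N" ..
  then have "?I N = ?I (Suc N)" by (metis lessI less_imp_le)
  moreover have "v ^ N \<in> ?I N" using rangeI[of "\<lambda>w. w * v ^ N" 1] by simp
  ultimately have "v ^ N \<in> ?I (Suc N)" by (rule subst)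
  then obtain w where w: "v ^ N = w * v ^ Suc N" by (elim rangeE)
  have "1 - w * v \<notin> M"
  proof
    assume "1 - w * v \<in> M"
    moreover have M: "R.subspace M" "M \<noteq> UNIV" using max_ideal_local by (auto simp: max_ideal_def)
    ultimately have "1 \<in> M"
      using R.subspace_add[OF M(1), of "1 - w * v" "w * v"] R.subspace_scale[OF M(1) assms] by simp
    then have "r \<in> M" for r using R.subspace_scale[OF M(1), of 1 r] by simp
    then show False using M(2) by blast
  qed
  then obtain u where "1 = (1 - w * v) * u"
    using local_ring_unit[OF local_ring] by (metis dvdE)
  moreover have "v ^ N * (1 - w * v) = v ^ N - w * v ^ Suc N"
    by (simp add: algebra_simps)
  moreover have "v ^ N - w * v ^ Suc N = 0"
    by (simp only: w[symmetric] diff_self)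
  ultimately have "v ^ N = 0"
    by (metis mult.assoc mult.right_neutral mult_zero_left)
  then show thesis by (rule that)
qed

text \<open>Let \<open>I\<close> be minimal among the ideals of infinite length. For \<open>v\<close> in the maximal ideal, \<open>v I\<close> is
  a proper subideal of \<open>I\<close>, since \<open>v\<close> is nilpotent, so it has finite length; hence the kernel of
  multiplication by \<open>v\<close> on \<open>I\<close> cannot be proper. Thus the maximal ideal kills \<open>I\<close>, and \<open>I\<close> is a vector
  space over the residue field. A hyperplane of it has finite length, and so has \<open>I\<close>.\<close>

lemma artinian_local_finite_length: "\<exists>n. length_le (*) {0} (UNIV :: 'a set) n"
proof (rule ccontr)
  interpret R: module "(*) :: 'a \<Rightarrow> 'a \<Rightarrow> 'a" by (rule module_mult)
  note R.scale_scale [simp del]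
  assume "\<not> ?thesis"
  then obtain I :: "'a set" where I: "R.subspace I" "\<not> (\<exists>n. length_le (*) {0} I n)"
    and min: "\<And>J. R.subspace J \<Longrightarrow> J \<subset> I \<Longrightarrow> \<exists>n. length_le (*) {0} J n"
    using artinian_minimal_ideal[OF artinian R.subspace_UNIV, of "\<lambda>I. \<not> (\<exists>n. length_le (*) {0} I n)"]
    by meson
  have I0: "I \<noteq> {0}" using I(2) length_le_self by blast
  have h: "module_hom (*) (*) ((*) v)" for v :: 'a
    by (rule module_hom_mult)
  have MI: "v * y = 0" if "v \<in> M" "y \<in> I" for v y
  proof -
    obtain k where k: "v ^ k = 0" using artinian_local_nilpotent[OF \<open>v \<in> M\<close>] .
    have sub: "(*) v ` I \<subseteq> I" using R.subspace_scale[OF I(1)] by blast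
    have "(*) v ` I \<noteq> I"
    proof
      assume eq: "(*) v ` I = I"
      have "(*) (v ^ j) ` I = I" for j
      proof (induction j)
        case (Suc j)
        have "(*) (v ^ Suc j) ` I = (*) v ` (*) (v ^ j) ` I" by (auto simp: image_image mult.assoc)
        then show ?case using Suc eq by simp
      qed auto
      from this[of k] have "(\<lambda>y. 0) ` I = I" by (simp add: k)
      then show False using I0 R.subspace_0[OF I(1)] by (metis empty_iff image_constant)
    qed
    then obtain m where m: "length_le (*) {0} ((*) v ` I) m"
      using min[of "(*) v ` I"] sub module_hom.subspace_image[OF h I(1)] by blast
    let ?A = "{y \<in> I. v * y = 0}"
    have A: "R.subspace ?A"
      using I(1) by (auto simp: R.subspace_def algebra_simps)
    have "?A = I"
    proof (rule ccontr)
      assume "?A \<noteq> I"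
      then obtain l where "length_le (*) {0} ?A l" using min[OF A] by blast
      then have "length_le (*) {0} I (l + m)"
        by (rule length_le_trans[OF module_mult _ length_le_kernel[OF m I(1)] A I(1)])
          (use R.subspace_0[OF I(1)] in auto)
      then show False using I(2) by blast
    qed
    then show ?thesis using \<open>y \<in> I\<close> by blast
  qed
  obtain x where x: "x \<in> I" "x \<noteq> 0" using I0 R.subspace_0[OF I(1)] by blast
  have "{0} \<subseteq> I" "x \<notin> {0}" using x R.subspace_0[OF I(1)] by auto
  from maximal_submodule_avoiding[OF module_mult R.subspace_single_0 this]
  obtain J where J: "R.subspace J" "J \<subseteq> I" "x \<notin> J"
    and maxJ: "\<forall>J'. R.subspace J' \<and> J \<subseteq> J' \<and> J' \<subseteq> I \<and> x \<notin> J' \<longrightarrow> J' = J"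
    by (elim exE conjE)
  let ?gen = "\<lambda>y. {j + v * y |j v. j \<in> J}"
  have gen: "R.subspace (?gen y)" for y
  proof -
    have "R.subspace {j + z |j z. j \<in> J \<and> z \<in> range (\<lambda>v. v * y)}"
    proof (rule submodule_sums[OF module_mult J(1)])
      show "R.subspace (range (\<lambda>v. v * y))"
        by (rule principal_ideal)
    qed
    moreover have "?gen y = {j + z |j z. j \<in> J \<and> z \<in> range (\<lambda>v. v * y)}" by auto
    ultimately show ?thesis by simp
  qed
  have genI: "?gen y \<subseteq> I" if "y \<in> I" for y
    using that J(2) R.subspace_add[OF I(1)] R.subspace_scale[OF I(1)] by blast
  have Jgen: "J \<subseteq> ?gen y" for y
  proof
    fix j assume "j \<in> J"
    moreover have "j = j + 0 * y" by simp
    ultimately show "j \<in> ?gen y" by blast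
  qed
  have "I \<subseteq> ?gen x"
  proof
    fix y assume y: "y \<in> I"
    show "y \<in> ?gen x"
    proof (cases "y \<in> J")
      case True
      then show ?thesis using Jgen by blast
    next
      case False
      have "y = 0 + 1 * y" by simp
      then have "y \<in> ?gen y" using R.subspace_0[OF J(1)] by blast
      then have "x \<in> ?gen y" using maxJ gen[of y] Jgen[of y] genI[OF y] False by blast
      then obtain j v where jv: "x = j + v * y" "j \<in> J" by blast
      then have "v \<notin> M" using MI[OF _ y] J(3) by auto
      then obtain u where u: "1 = v * u" using local_ring_unit[OF local_ring] by (metis dvdE)
      have "y = (v * u) * y" by (simp flip: u)
      also have "\<dots> = (- u) * j + u * x" using jv by (simp add: algebra_simps)
      finally show ?thesis using R.subspace_scale[OF J(1) jv(2)] by blast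
    qed
  qed
  then have Ix: "I = ?gen x" using genI[OF x(1)] by blast
  have "J \<noteq> I" using x(1) J(3) by blast
  then obtain a where a: "length_le (*) {0} J a" using min[OF J(1)] J(2) by blast
  have "length_le (*) M UNIV 1"
    unfolding length_le_def
  proof (intro allI impI)
    fix W assume W: "submodule_chain (*) M UNIV W"
    then have WM: "W k = M \<or> W k = UNIV" for k
      using max_ideal_local unfolding submodule_chain_def max_ideal_def by metis
    have anti: "W l \<subseteq> W k" if "k \<le> l" for k l
      using W that lift_Suc_antimono_le[of W k l] by (auto simp: submodule_chain_def)
    have "k = l" if "k \<in> chain_drops W" "l \<in> chain_drops W" for k l
      using that
    proof (induction k l rule: linorder_wlog)
      case (le k l)
      show ?case
      proof (rule ccontr)
        assume "k \<noteq> l"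
        then have "W (Suc l) \<subseteq> W l" "W l \<subseteq> W (Suc k)" "W (Suc k) \<subseteq> W k"
          using anti le by auto
        then show False using le(2,3) WM[of k] WM[of l] WM[of "Suc k"] WM[of "Suc l"]
          by (auto simp: chain_drops_def)
      qed
    qed auto
    then have "chain_drops W = {} \<or> (\<exists>k. chain_drops W = {k})" by blast
    then show "finite (chain_drops W) \<and> card (chain_drops W) \<le> 1" by auto
  qed
  then have "length_le (*) {v. v * x \<in> J} UNIV 1"
    by (rule length_le_subset) (use MI x R.subspace_0[OF J(1)] in auto)
  then have "length_le (*) J I 1"
    unfolding Ix by (rule length_le_add_generator[OF module_mult J(1)])
  then have "length_le (*) {0} I (a + 1)"
    by (rule length_le_trans[OF module_mult a _ J(1) I(1)])
      (use J R.subspace_0[OF J(1)] in auto)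
  then show False using I(2) by blast
qed

end

lemma finitely_generated_finite_length:
  fixes smul :: "'a::comm_ring_1 \<Rightarrow> 'b::ab_group_add \<Rightarrow> 'b"
  assumes "module smul" and n: "length_le (*) {0} (UNIV :: 'a set) n" and "finite B"
  shows "\<exists>m. length_le smul {0} (module.span smul B) m"
  using \<open>finite B\<close>
proof (induction B)
  interpret M: module smul by fact
  case empty
  then show ?case using length_le_self by auto
next
  interpret M: module smul by fact
  case (insert b B)
  then obtain m where m: "length_le smul {0} (M.span B) m" by blast
  have "length_le (*) {v. smul v b \<in> M.span B} UNIV n"
    by (rule length_le_subset[OF n]) (auto simp: M.span_zero)
  then have "length_le smul (M.span B) {j + smul v b |j v. j \<in> M.span B} n"
    by (rule length_le_add_generator[OF assms(1) M.subspace_span])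
  moreover have "{j + smul v b |j v. j \<in> M.span B} = M.span (insert b B)"
  proof (intro equalityI subsetI)
    fix y assume "y \<in> {j + smul v b |j v. j \<in> M.span B}"
    then obtain j v where "y = j + smul v b" "j \<in> M.span B" by blast
    then have "y - smul v b \<in> M.span B" by simp
    then show "y \<in> M.span (insert b B)" unfolding M.span_insert by blast
  next
    fix y assume "y \<in> M.span (insert b B)"
    then obtain v where "y - smul v b \<in> M.span B" by (auto simp: M.span_insert)
    moreover have "y = (y - smul v b) + smul v b" by simp
    ultimately show "y \<in> {j + smul v b |j v. j \<in> M.span B}" by blast
  qed
  ultimately have "length_le smul {0} (M.span (insert b B)) (m + n)"
    using m by (intro length_le_trans[OF assms(1), of _ "M.span B"])
      (auto simp: M.subspace_span M.span_zero M.span_mono subset_insertI)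
  then show ?case by blast
qed


section \<open>Powers modulo nilpotents\<close>

definition nilpotent_elem :: "'a::comm_ring_1 \<Rightarrow> bool" where
  "nilpotent_elem r \<longleftrightarrow> (\<exists>k. r ^ k = 0)"

lemma nilpotent_elem_0 [simp]: "nilpotent_elem 0"
  unfolding nilpotent_elem_def by (intro exI[of _ 1]) simp

lemma nilpotent_elem_mult: "nilpotent_elem r \<Longrightarrow> nilpotent_elem (s * r)"
  unfolding nilpotent_elem_def by (metis mult_zero_right power_mult_distrib)

lemma nilpotent_elem_mult_left: "nilpotent_elem r \<Longrightarrow> nilpotent_elem (r * s)"
  unfolding mult.commute[of r] by (rule nilpotent_elem_mult)

lemma nilpotent_elem_add:
  assumes "nilpotent_elem r" "nilpotent_elem s"
  shows "nilpotent_elem (r + s)"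
proof -
  obtain k l where kl: "r ^ k = 0" "s ^ l = 0"
    using assms unfolding nilpotent_elem_def by blast
  have zero: "t ^ j = 0" if "t ^ i = 0" "i \<le> j" for t :: 'a and i j
  proof -
    have "t ^ j = t ^ i * t ^ (j - i)" using that(2) by (simp flip: power_add)
    then show ?thesis by (simp add: that(1))
  qed
  have "(r + s) ^ (k + l) = (\<Sum>i\<le>k + l. of_nat ((k + l) choose i) * r ^ i * s ^ (k + l - i))"
    by (rule binomial_ring)
  also have "\<dots> = 0"
  proof (intro sum.neutral ballI)
    fix i
    show "of_nat ((k + l) choose i) * r ^ i * s ^ (k + l - i) = 0"
    proof (cases "k \<le> i")
      case True
      then show ?thesis using zero[OF kl(1)] by simp
    next
      case False
      then show ?thesis using zero[OF kl(2), of "k + l - i"] by simp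
    qed
  qed
  finally show ?thesis unfolding nilpotent_elem_def by blast
qed

lemma nilpotent_elem_uminus: "nilpotent_elem r \<Longrightarrow> nilpotent_elem (- r)"
  using nilpotent_elem_mult[of r "-1"] by simp

lemma nilpotent_elem_diff: "nilpotent_elem r \<Longrightarrow> nilpotent_elem s \<Longrightarrow> nilpotent_elem (r - s)"
  using nilpotent_elem_add[OF _ nilpotent_elem_uminus] by fastforce

lemma prime_dvd_add_power_diff:
  fixes x y :: "'a::comm_ring_1"
  assumes "prime p"
  shows "of_nat p dvd (x + y) ^ p - (x ^ p + y ^ p)"
proof -
  obtain q where q: "p = Suc q" "q \<noteq> 0"
    using prime_gt_1_nat[OF assms] by (cases p) auto
  have "(x + y) ^ p = (\<Sum>i\<le>Suc q. of_nat (p choose i) * x ^ i * y ^ (p - i))"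
    unfolding q(1)[symmetric] by (rule binomial_ring)
  also have "\<dots> = y ^ p + (\<Sum>i\<in>{1..q}. of_nat (p choose i) * x ^ i * y ^ (p - i)) + x ^ p"
    unfolding sum.atMost_Suc using q by (simp add: atMost_atLeast0 sum.atLeast_Suc_atMost)
  finally have "(x + y) ^ p - (x ^ p + y ^ p) = (\<Sum>i\<in>{1..q}. of_nat (p choose i) * x ^ i * y ^ (p - i))"
    by (simp add: algebra_simps)
  also have "of_nat p dvd \<dots>"
  proof (intro dvd_sum dvd_mult2)
    fix i assume "i \<in> {1..q}"
    then have "p dvd (p choose i)" using q assms by (intro dvd_choose_prime) auto
    then show "(of_nat p :: 'a) dvd of_nat (p choose i)" by (metis dvd_def of_nat_mult)
  qed
  finally show ?thesis .
qed

lemma dvd_power_diff: "(x - y :: 'a::comm_ring_1) dvd x ^ n - y ^ n"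
  by (simp add: power_diff_sumr2)

text \<open>In \<open>a\<^sup>p - b\<^sup>p = (a - b) (\<Sum>j<p. b\<^sup>p\<^sup>-\<^sup>1\<^sup>-\<^sup>j a\<^sup>j)\<close> the second factor is congruent to
  \<open>p b\<^sup>p\<^sup>-\<^sup>1\<close> modulo \<open>a - b\<close>, and \<open>p\<close> divides \<open>a - b\<close>, so it contributes another factor \<open>p\<close>.\<close>

lemma dvd_power_prime_diff:
  fixes a b :: "'a::comm_ring_1"
  assumes "of_nat p ^ Suc i dvd a - b"
  shows "of_nat p ^ Suc (Suc i) dvd a ^ p - b ^ p"
proof -
  have p: "of_nat p dvd a - b"
    using assms by (metis dvd_mult_left power_Suc)
  have "of_nat p dvd (\<Sum>j<p. b ^ (p - Suc j) * a ^ j)"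
  proof -
    have "(\<Sum>j<p. b ^ (p - Suc j) * a ^ j)
        = (\<Sum>j<p. b ^ (p - Suc j) * (a ^ j - b ^ j)) + (\<Sum>j<p. b ^ (p - 1))"
      unfolding sum.distrib[symmetric]
    proof (rule sum.cong)
      fix j assume "j \<in> {..<p}"
      then have "b ^ (p - 1) = b ^ (p - Suc j) * b ^ j" by (simp flip: power_add)
      then show "b ^ (p - Suc j) * a ^ j = b ^ (p - Suc j) * (a ^ j - b ^ j) + b ^ (p - 1)"
        by (simp add: algebra_simps)
    qed simp
    moreover have "of_nat p dvd (\<Sum>j<p. b ^ (p - Suc j) * (a ^ j - b ^ j))"
      by (intro dvd_sum dvd_mult dvd_trans[OF p dvd_power_diff])
    ultimately show ?thesis by (simp add: dvd_add)
  qed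
  then have "of_nat p ^ Suc i * of_nat p dvd (a - b) * (\<Sum>j<p. b ^ (p - Suc j) * a ^ j)"
    using assms by (rule mult_dvd_mono[rotated])
  then show ?thesis by (simp add: power_diff_sumr2 mult.commute)
qed

lemma prime_dvd_add_prime_power_diff:
  fixes x y :: "'a::comm_ring_1"
  assumes "prime p"
  shows "of_nat p dvd (x + y) ^ (p ^ k) - (x ^ (p ^ k) + y ^ (p ^ k))"
proof (induction k)
  case (Suc k)
  let ?a = "(x + y) ^ (p ^ k)" and ?b = "x ^ (p ^ k) + y ^ (p ^ k)"
  have "?a - ?b dvd ?a ^ p - ?b ^ p" by (rule dvd_power_diff)
  then have "of_nat p dvd (?a ^ p - ?b ^ p) + (?b ^ p - ((x ^ (p ^ k)) ^ p + (y ^ (p ^ k)) ^ p))"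
    using Suc prime_dvd_add_power_diff[OF assms] by (intro dvd_add) (blast intro: dvd_trans)+
  then show ?case by (simp add: power_mult[symmetric] mult.commute algebra_simps)
qed simp

text \<open>A sufficiently high \<open>p\<^sup>l\<close>-th power turns a nilpotent difference into a multiple of \<open>p\<close>; each
  further \<open>p\<close>-th power gains another factor \<open>p\<close>, until the nilpotence of \<open>p\<close> is reached.\<close>

lemma prime_powers_eq_if_nilpotent_diff:
  fixes a b :: "'a::comm_ring_1"
  assumes "prime p" "nilpotent_elem (of_nat p :: 'a)" "nilpotent_elem (a - b)"
  shows "\<exists>K. \<forall>k\<ge>K. a ^ (p ^ k) = b ^ (p ^ k)"
proof -
  obtain l m where l: "(a - b) ^ l = 0" and m: "(of_nat p :: 'a) ^ m = 0"
    using assms(2,3) unfolding nilpotent_elem_def by blast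
  have "l \<le> p ^ l"
    using prime_gt_1_nat[OF assms(1)] by (simp add: less_imp_le)
  then have "(a - b) ^ (p ^ l) = (a - b) ^ l * (a - b) ^ (p ^ l - l)"
    by (simp flip: power_add)
  then have "(a - b) ^ (p ^ l) = 0" by (simp add: l)
  then have "of_nat p dvd a ^ (p ^ l) - b ^ (p ^ l)"
    using prime_dvd_add_prime_power_diff[OF assms(1), of "a - b" b l] by simp
  then have "of_nat p ^ Suc i dvd a ^ (p ^ (l + i)) - b ^ (p ^ (l + i))" for i
  proof (induction i)
    case (Suc i)
    have "of_nat p ^ Suc (Suc i) dvd (a ^ (p ^ (l + i))) ^ p - (b ^ (p ^ (l + i))) ^ p"
      by (rule dvd_power_prime_diff[OF Suc.IH[OF Suc.prems]])
    then show ?case by (simp add: power_mult[symmetric] mult.commute)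
  qed simp
  from this[of m] have "a ^ (p ^ (l + m)) = b ^ (p ^ (l + m))" by (simp add: m)
  moreover have "r ^ (p ^ k) = (r ^ (p ^ (l + m))) ^ (p ^ (k - (l + m)))" if "l + m \<le> k" for r :: 'a and k
    using that by (simp flip: power_mult power_add)
  ultimately show ?thesis by metis
qed


section \<open>A criterion for differential operators\<close>

inductive_set generated_algebra ::
  "('v \<Rightarrow> 's::comm_ring_1) \<Rightarrow> 's set \<Rightarrow> 's set" for e G where
  const: "e v \<in> generated_algebra e G"
| generator: "s \<in> G \<Longrightarrow> s \<in> generated_algebra e G"
| add: "s \<in> generated_algebra e G \<Longrightarrow> t \<in> generated_algebra e G \<Longrightarrow> s + t \<in> generated_algebra e G"
| mult: "s \<in> generated_algebra e G \<Longrightarrow> t \<in> generated_algebra e G \<Longrightarrow> s * t \<in> generated_algebra e G"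

lemma linear_endosI:
  assumes "unital_ring_hom e" "\<And>a b. \<phi> (a + b) = \<phi> a + \<phi> b" "\<And>v a. \<phi> (e v * a) = e v * \<phi> a"
  shows "\<phi> \<in> linear_endos e"
  using assms unfolding linear_endos_def unital_ring_hom_def module_hom_def module_hom_axioms_def module_def
  by (simp add: algebra_simps)

lemma linear_endosD:
  assumes "\<phi> \<in> linear_endos e"
  shows "\<phi> (a + b) = \<phi> a + \<phi> b" "\<phi> (e v * a) = e v * \<phi> a"
  using assms unfolding linear_endos_def module_hom_def module_hom_axioms_def by auto

lemma additive_zero:
  assumes "\<And>a b :: 'a::ab_group_add. \<phi> (a + b) = \<phi> a + \<phi> b"
  shows "\<phi> 0 = (0 :: 'b::ab_group_add)"
  using assms[of 0 0] by simp

lemma additive_sum: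
  assumes "\<And>a b :: 'a::ab_group_add. \<phi> (a + b) = \<phi> a + (\<phi> b :: 'b::ab_group_add)"
  shows "\<phi> (\<Sum>i\<in>I. g i) = (\<Sum>i\<in>I. \<phi> (g i))"
  by (induction I rule: infinite_finite_induct) (simp_all add: assms additive_zero[of \<phi>, OF assms])

definition ad :: "'s::comm_ring_1 \<Rightarrow> ('s \<Rightarrow> 's) \<Rightarrow> 's \<Rightarrow> 's" where
  "ad s \<phi> = (\<lambda>x. \<phi> (s * x) - s * \<phi> x)"

lemma ad_linear:
  assumes "unital_ring_hom e" "\<phi> \<in> linear_endos e"
  shows "ad s \<phi> \<in> linear_endos e"
  using linear_endosD[OF assms(2)]
  by (intro linear_endosI assms(1)) (simp_all add: ad_def distrib_left right_diff_distrib mult.left_commute[of s "e _"])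

text \<open>Order at most \<open>k - 1\<close> in the sense of iterated commutators, tested only with elements of
  \<open>G\<close>; for \<open>G\<close> the whole ring this is Grothendieck's filtration
  (\<open>diff_ops_iff_ad_order\<close>).\<close>

primrec ad_order :: "'s::comm_ring_1 set \<Rightarrow> nat \<Rightarrow> ('s \<Rightarrow> 's) \<Rightarrow> bool" where
  "ad_order G 0 \<phi> \<longleftrightarrow> \<phi> = (\<lambda>_. 0)"
| "ad_order G (Suc k) \<phi> \<longleftrightarrow> (\<forall>s\<in>G. ad_order G k (ad s \<phi>))"

lemma ad_order_zero: "ad_order G k (\<lambda>_. 0)"
  by (induction k) (simp_all add: ad_def)

lemma ad_order_add:
  "ad_order G k \<phi> \<Longrightarrow> ad_order G k \<psi> \<Longrightarrow> ad_order G k (\<lambda>x. \<phi> x + \<psi> x)"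
proof (induction k arbitrary: \<phi> \<psi>)
  case (Suc k)
  have "ad s (\<lambda>x. \<phi> x + \<psi> x) = (\<lambda>x. ad s \<phi> x + ad s \<psi> x)" for s
    by (simp add: ad_def algebra_simps)
  then show ?case using Suc by simp
qed simp

lemma ad_order_mult: "ad_order G k \<phi> \<Longrightarrow> ad_order G k (\<lambda>x. r * \<phi> x)"
proof (induction k arbitrary: \<phi>)
  case (Suc k)
  have "ad s (\<lambda>x. r * \<phi> x) = (\<lambda>x. r * ad s \<phi> x)" for s
    by (simp add: ad_def algebra_simps)
  then show ?case using Suc by simp
qed simp

lemma ad_order_comp_mult: "ad_order G k \<phi> \<Longrightarrow> ad_order G k (\<lambda>x. \<phi> (r * x))"
proof (induction k arbitrary: \<phi>)
  case (Suc k)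
  have "ad s (\<lambda>x. \<phi> (r * x)) = (\<lambda>x. ad s \<phi> (r * x))" for s
    by (simp add: ad_def mult.left_commute)
  then show ?case using Suc by simp
qed simp

text \<open>Commutators with a generating set suffice, since \<open>ad\<close> is a derivation in its first argument:
  \<open>ad (s t) \<phi> = (ad s \<phi>) t + s (ad t \<phi>)\<close>.\<close>

lemma ad_order_ad:
  assumes lin: "\<phi> \<in> linear_endos e" and ord: "ad_order G (Suc k) \<phi>"
    and "s \<in> generated_algebra e G"
  shows "ad_order G k (ad s \<phi>)"
  using assms(3)
proof induction
  case (const v)
  have "ad (e v) \<phi> = (\<lambda>_. 0)"
    by (simp add: ad_def linear_endosD[OF lin])
  then show ?case by (simp add: ad_order_zero)
next
  case (generator s)
  then show ?case using ord by simp
next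
  case (add s t)
  have "ad (s + t) \<phi> = (\<lambda>x. ad s \<phi> x + ad t \<phi> x)"
    by (simp add: ad_def linear_endosD[OF lin] algebra_simps)
  then show ?case using add by (simp add: ad_order_add)
next
  case (mult s t)
  have "ad (s * t) \<phi> = (\<lambda>x. ad s \<phi> (t * x) + s * ad t \<phi> x)"
    by (simp add: ad_def algebra_simps)
  then show ?case
    using mult by (simp add: ad_order_add ad_order_mult ad_order_comp_mult)
qed

text \<open>On an element \<open>\<Sum> r \<otimes> s\<close> of the kernel of multiplication, \<open>\<Sum> r \<phi> s = \<Sum> r (\<phi> s - s \<phi>)\<close>.\<close>

lemma ad_order_tensor_act:
  assumes lin: "\<phi> \<in> linear_endos e" and ord: "ad_order G (Suc k) \<phi>"
    and gen: "generated_algebra e G = UNIV" and T: "T \<in> diagonal_ideal"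
  shows "ad_order G k (tensor_act T \<phi>)"
proof -
  have "ad_order G k (\<lambda>x. \<Sum>(r, s)\<leftarrow>T. r * ad s \<phi> x)" for T
  proof (induction T)
    case (Cons rs T)
    then show ?case
      using ad_order_ad[OF lin ord, of "snd rs"] gen
      by (auto simp: case_prod_unfold intro!: ad_order_add ad_order_mult)
  qed (simp add: ad_order_zero)
  moreover have "tensor_act T \<phi> x = (\<Sum>(r, s)\<leftarrow>T. r * ad s \<phi> x) + multiplication_map T * \<phi> x" for x
    by (induction T) (auto simp: tensor_act_def multiplication_map_def ad_def algebra_simps)
  moreover have "multiplication_map T = 0"
    using T by (simp add: diagonal_ideal_def)
  ultimately have "tensor_act T \<phi> = (\<lambda>x. \<Sum>(r, s)\<leftarrow>T. r * ad s \<phi> x)"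
    by (simp add: fun_eq_iff)
  then show ?thesis
    using \<open>\<And>T. ad_order G k (\<lambda>x. \<Sum>(r, s)\<leftarrow>T. r * ad s \<phi> x)\<close> by simp
qed

lemma tensor_act_linear:
  assumes "unital_ring_hom e" "\<phi> \<in> linear_endos e"
  shows "tensor_act T \<phi> \<in> linear_endos e"
proof (rule linear_endosI[OF assms(1)])
  note l = linear_endosD[OF assms(2)]
  show "tensor_act T \<phi> (a + b) = tensor_act T \<phi> a + tensor_act T \<phi> b" for a b
    by (induction T) (auto simp: tensor_act_def distrib_left l(1) algebra_simps)
  show "tensor_act T \<phi> (e v * a) = e v * tensor_act T \<phi> a" for v a
    by (induction T) (auto simp: tensor_act_def l(2) distrib_left mult.left_commute[of _ "e v"])
qed

lemma tensor_act_concat_zero: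
  "(\<And>T. T \<in> set Ts \<Longrightarrow> tensor_act T \<phi> = (\<lambda>_. 0)) \<Longrightarrow> tensor_act (concat Ts) \<phi> = (\<lambda>_. 0)"
  by (induction Ts) (auto simp: tensor_act_append, simp add: tensor_act_def)

lemma tensor_act_commute:
  assumes "\<phi> \<in> linear_endos e"
  shows "tensor_act T (tensor_act U \<phi>) = tensor_act U (tensor_act T \<phi>)"
proof
  fix x
  show "tensor_act T (tensor_act U \<phi>) x = tensor_act U (tensor_act T \<phi>) x"
  proof (induction T)
    case Nil
    then show ?case by (induction U) (auto simp: tensor_act_def)
  next
    case (Cons rs T)
    obtain r s where rs: "rs = (r, s)" by fastforce
    have "r * tensor_act U \<phi> (s * x) + tensor_act U (tensor_act T \<phi>) x
      = tensor_act U (\<lambda>x. r * \<phi> (s * x) + tensor_act T \<phi> x) x"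
      by (induction U) (auto simp: tensor_act_def algebra_simps)
    then show ?case using Cons rs by (simp add: tensor_act_def)
  qed
qed

lemma diff_ops_if_ad_order:
  assumes e: "unital_ring_hom e" and lin: "\<phi> \<in> linear_endos e" and ord: "ad_order G k \<phi>"
    and gen: "generated_algebra e G = UNIV"
  shows "\<phi> \<in> diff_ops e"
proof -
  have "\<phi> \<in> linear_endos e \<Longrightarrow> ad_order G k \<phi> \<Longrightarrow> T \<in> diagonal_ideal_power k \<Longrightarrow>
      tensor_act T \<phi> = (\<lambda>_. 0)" for T
  proof (induction k arbitrary: \<phi> T)
    case 0
    then show ?case by (induction T) (auto simp: tensor_act_def fun_eq_iff)
  next
    case (Suc k)
    obtain TUs where TUs: "T = concat (map (\<lambda>(T, U). tensor_mult T U) TUs)"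
      "set TUs \<subseteq> diagonal_ideal \<times> diagonal_ideal_power k"
      using Suc.prems(3) by auto
    show ?case
      unfolding TUs(1)
    proof (rule tensor_act_concat_zero)
      fix A assume "A \<in> set (map (\<lambda>(T, U). tensor_mult T U) TUs)"
      then obtain B U where BU: "A = tensor_mult B U" "B \<in> diagonal_ideal" "U \<in> diagonal_ideal_power k"
        using TUs(2) by auto
      have "tensor_act U (tensor_act B \<phi>) = (\<lambda>_. 0)"
        using Suc.prems(1,2) BU gen e
        by (intro Suc.IH tensor_act_linear ad_order_tensor_act) auto
      then show "tensor_act A \<phi> = (\<lambda>_. 0)"
        using Suc.prems(1) unfolding BU(1)
        by (simp add: tensor_act_tensor_mult tensor_act_commute[of \<phi> e B U])
    qed
  qed
  then show ?thesis using lin ord by (auto simp: diff_ops_def)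
qed

lemma ad_commute: "ad s (ad t \<phi>) = ad t (ad s \<phi>)"
  by (simp add: ad_def fun_eq_iff algebra_simps)

lemma ad_order_if_fold_zero:
  assumes "\<And>ws. set ws \<subseteq> G \<Longrightarrow> length ws = k \<Longrightarrow> fold ad ws \<phi> = (\<lambda>_. 0)"
  shows "ad_order G k \<phi>"
  using assms
proof (induction k arbitrary: \<phi>)
  case 0
  then show ?case using "0.prems"[of "[]"] by simp
next
  case (Suc k)
  have "fold ad ws (ad s \<phi>) = (\<lambda>_. 0)" if "s \<in> G" "set ws \<subseteq> G" "length ws = k" for s ws
    using Suc.prems[of "s # ws"] that by simp
  then show ?case using Suc.IH by simp
qed

lemma ad_funpow_commute: "(ad y ^^ k) (ad s \<phi>) = ad s ((ad y ^^ k) \<phi>)"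
  by (induction k) (simp_all add: ad_commute)

lemma fold_ad_collect:
  "fold ad ws \<phi> = fold ad (filter (\<lambda>s. s \<noteq> y) ws) ((ad y ^^ count_list ws y) \<phi>)"
proof (induction ws arbitrary: \<phi>)
  case (Cons s ws)
  then show ?case
    by (simp add: ad_funpow_commute funpow_Suc_right del: funpow.simps)
qed simp

lemma ad_funpow_zero: "(ad y ^^ k) (\<lambda>_. 0) = (\<lambda>_. 0)"
  by (induction k) (simp_all add: ad_def)

lemma fold_ad_zero: "fold ad ws (\<lambda>_. 0) = (\<lambda>_. 0)"
  by (induction ws) (simp_all add: ad_def)

text \<open>Commutators commute with each other, and in a long word over \<open>G\<close> some letter occurs so often
  that its occurrences can be collected into a vanishing power.\<close>

lemma ad_order_if_ad_nilpotent:
  assumes "finite G" "\<And>y. y \<in> G \<Longrightarrow> \<exists>m. (ad y ^^ m) \<phi> = (\<lambda>_. 0)"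
  shows "\<exists>k. ad_order G k \<phi>"
proof -
  obtain m where m: "\<And>y. y \<in> G \<Longrightarrow> (ad y ^^ m y) \<phi> = (\<lambda>_. 0)"
    using assms(2) by metis
  have "fold ad ws \<phi> = (\<lambda>_. 0)" if ws: "set ws \<subseteq> G" "length ws = Suc (sum m G)" for ws
  proof -
    have "\<exists>y\<in>G. m y \<le> count_list ws y"
    proof (rule ccontr)
      assume "\<not> ?thesis"
      then have "sum (count_list ws) G \<le> sum m G"
        by (intro sum_mono) (auto simp: not_le less_imp_le)
      then show False using sum_count_set[OF ws(1) assms(1)] ws(2) by simp
    qed
    then obtain y where y: "y \<in> G" "m y \<le> count_list ws y" by blast
    then have "(ad y ^^ count_list ws y) \<phi> = (ad y ^^ (count_list ws y - m y)) ((ad y ^^ m y) \<phi>)"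
      by (simp flip: funpow_add comp_apply[of "ad y ^^ _"])
    then have "(ad y ^^ count_list ws y) \<phi> = (\<lambda>_. 0)"
      using m[OF y(1)] by (simp add: ad_funpow_zero)
    then show ?thesis using fold_ad_collect[of ws \<phi> y] by (simp add: fold_ad_zero)
  qed
  then show ?thesis using ad_order_if_fold_zero[of G "Suc (sum m G)" \<phi>] by blast
qed

text \<open>The commutative ring \<open>S[z]\<close> acts on functions, \<open>z\<close> by precomposition with multiplication
  by \<open>y\<close>; then \<open>ad y\<close> is the action of \<open>z - y\<close>.\<close>

definition precomp_act :: "'s::comm_ring_1 \<Rightarrow> 's poly \<Rightarrow> ('s \<Rightarrow> 's) \<Rightarrow> 's \<Rightarrow> 's" where
  "precomp_act y P \<phi> = (\<lambda>x. \<Sum>k\<le>degree P. coeff P k * \<phi> (y ^ k * x))"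

lemma precomp_act_atMost:
  assumes "degree P \<le> d"
  shows "precomp_act y P \<phi> x = (\<Sum>k\<le>d. coeff P k * \<phi> (y ^ k * x))"
  unfolding precomp_act_def
  by (rule sum.mono_neutral_left) (use assms in \<open>auto simp: coeff_eq_0\<close>)

lemma precomp_act_add: "precomp_act y (P + Q) \<phi> x = precomp_act y P \<phi> x + precomp_act y Q \<phi> x"
  using precomp_act_atMost[of P "max (degree P) (degree Q)" y \<phi> x]
    precomp_act_atMost[of Q "max (degree P) (degree Q)" y \<phi> x]
    precomp_act_atMost[OF degree_add_le_max[of P Q], of y \<phi> x]
  by (simp add: sum.distrib algebra_simps)

lemma precomp_act_smult: "precomp_act y (smult a P) \<phi> x = a * precomp_act y P \<phi> x"
  using precomp_act_atMost[OF degree_smult_le[of a P], of y \<phi> x]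
    precomp_act_atMost[of P "degree P" y \<phi> x]
  by (simp add: sum_distrib_left mult.assoc)

lemma precomp_act_pCons: "precomp_act y (pCons a P) \<phi> x = a * \<phi> x + precomp_act y P \<phi> (y * x)"
proof -
  have "precomp_act y (pCons a P) \<phi> x = (\<Sum>k\<le>Suc (degree P). coeff (pCons a P) k * \<phi> (y ^ k * x))"
    by (rule precomp_act_atMost) (rule degree_pCons_le)
  also have "\<dots> = a * \<phi> x + precomp_act y P \<phi> (y * x)"
    unfolding sum.atMost_Suc_shift precomp_act_def by (simp add: mult_ac)
  finally show ?thesis .
qed

lemma precomp_act_zero: "precomp_act y 0 \<phi> = (\<lambda>_. 0)"
  by (simp add: precomp_act_def)

lemma precomp_act_mult: "precomp_act y (P * Q) \<phi> x = precomp_act y P (precomp_act y Q \<phi>) x"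
  by (induction P arbitrary: x)
    (simp_all add: precomp_act_zero precomp_act_pCons precomp_act_add precomp_act_smult mult_pCons_left)

lemma ad_funpow_precomp_act: "(ad y ^^ k) \<phi> = precomp_act y ([:- y, 1:] ^ k) \<phi>"
proof (induction k)
  case 0
  show ?case by (simp add: precomp_act_def)
next
  case (Suc k)
  then show ?case
    by (simp add: precomp_act_mult fun_eq_iff precomp_act_pCons precomp_act_zero ad_def
        del: mult_pCons_left)
qed

text \<open>With \<open>q = p\<^sup>k\<close>, \<open>(z - y)\<^sup>q\<close> equals \<open>z\<^sup>q - y\<^sup>q\<close> up to a multiple of \<open>p\<close>. The polynomial
  \<open>z\<^sup>q - y\<^sup>q\<close> annihilates \<open>\<phi>\<close> by assumption and \<open>p\<close> is nilpotent, so a power of \<open>z - y\<close>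
  annihilates \<open>\<phi>\<close>.\<close>

lemma ad_nilpotent_if_power_linear:
  fixes \<phi> :: "'s::comm_ring_1 \<Rightarrow> 's"
  assumes p: "prime p" "nilpotent_elem (of_nat p :: 's)"
    and \<phi>: "\<And>x. \<phi> (y ^ (p ^ k) * x) = y ^ (p ^ k) * \<phi> x"
  shows "\<exists>m. (ad y ^^ m) \<phi> = (\<lambda>_. 0)"
proof -
  obtain m where m: "(of_nat p :: 's) ^ m = 0" using p(2) by (auto simp: nilpotent_elem_def)
  define q where "q = p ^ k"
  define X where "X = [:- y, 1:] ^ q"
  define A where "A = monom 1 q - [:y ^ q:]"
  have "of_nat p dvd ([:- y, 1:] + [:y:]) ^ q - ([:- y, 1:] ^ q + [:y:] ^ q)"
    unfolding q_def by (rule prime_dvd_add_prime_power_diff[OF p(1)])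
  moreover have "([:- y, 1:] + [:y:]) ^ q - ([:- y, 1:] ^ q + [:y:] ^ q) = A - X"
    by (simp add: A_def X_def monom_altdef poly_const_pow)
  ultimately obtain H where "A - X = of_nat p * H" by (metis dvdE)
  then have "X - A = of_nat p * (- H)"
    by (metis minus_diff_eq mult_minus_right)
  moreover have "(of_nat p :: 's poly) ^ m = [:of_nat p ^ m:]"
    by (simp add: of_nat_poly poly_const_pow)
  ultimately have "(X - A) ^ m = 0"
    by (simp only: power_mult_distrib m pCons_0_0 mult_zero_left)
  moreover have "X - (X - A) dvd X ^ m - (X - A) ^ m"
    by (rule dvd_power_diff)
  ultimately have "A dvd X ^ m" by simp
  then obtain B where B: "X ^ m = B * A" by (metis dvdE mult.commute)
  have "precomp_act y A \<phi> x = 0" for x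
  proof -
    have "A = monom 1 q + smult (-1) [:y ^ q:]" by (simp add: A_def)
    then have "precomp_act y A \<phi> x = precomp_act y (monom 1 q) \<phi> x - y ^ q * \<phi> x"
      by (simp only: precomp_act_add precomp_act_smult) (simp add: precomp_act_pCons precomp_act_zero)
    also have "precomp_act y (monom 1 q) \<phi> x = (\<Sum>j\<le>q. coeff (monom 1 q) j * \<phi> (y ^ j * x))"
      by (rule precomp_act_atMost) (rule degree_monom_le)
    also have "\<dots> = (\<Sum>j\<le>q. if j = q then \<phi> (y ^ q * x) else 0)"
      by (intro sum.cong) auto
    finally show ?thesis by (simp add: \<phi> q_def)
  qed
  then have "precomp_act y A \<phi> = (\<lambda>_. 0)" by blast
  then have "(ad y ^^ (q * m)) \<phi> x = 0" for x
    unfolding ad_funpow_precomp_act power_mult X_def[symmetric] B precomp_act_mult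
    by (simp add: precomp_act_def)
  then have "(ad y ^^ (q * m)) \<phi> = (\<lambda>_. 0)" by blast
  then show ?thesis by blast
qed

lemma diff_ops_if_power_linear:
  fixes e :: "'v::comm_ring_1 \<Rightarrow> 's::comm_ring_1"
  assumes "unital_ring_hom e" "finite G" "generated_algebra e G = UNIV"
    and "prime p" "nilpotent_elem (of_nat p :: 's)"
    and "\<phi> \<in> linear_endos e" "\<And>y x. y \<in> G \<Longrightarrow> \<phi> (y ^ (p ^ k) * x) = y ^ (p ^ k) * \<phi> x"
  shows "\<phi> \<in> diff_ops e"
proof -
  have "\<exists>k. ad_order G k \<phi>"
    using assms by (intro ad_order_if_ad_nilpotent ad_nilpotent_if_power_linear)
  then show ?thesis using diff_ops_if_ad_order assms by blast
qed

lemma ad_order_Suc: "ad_order G k \<phi> \<Longrightarrow> ad_order G (Suc k) \<phi>"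
proof (induction k arbitrary: \<phi>)
  case 0
  then show ?case by (simp add: ad_def)
next
  case (Suc k)
  show ?case
    unfolding ad_order.simps(2)[of G "Suc k"] using Suc by simp
qed

lemma ad_order_mono: "k \<le> l \<Longrightarrow> ad_order G k \<phi> \<Longrightarrow> ad_order G l \<phi>"
  by (induction l rule: dec_induct) (auto intro: ad_order_Suc simp del: ad_order.simps)

lemma ad_order_if_diagonal_ideal_power:
  fixes \<phi> :: "'s::comm_ring_1 \<Rightarrow> 's"
  assumes "unital_ring_hom e" "\<phi> \<in> linear_endos e"
    and "\<And>T. T \<in> diagonal_ideal_power k \<Longrightarrow> tensor_act T \<phi> = (\<lambda>_. 0)"
  shows "ad_order UNIV k \<phi>"
  using assms(2,3)
proof (induction k arbitrary: \<phi>)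
  case 0
  have "tensor_act [(1, 1)] \<phi> = (\<lambda>_. 0)" by (rule 0) simp
  then show ?case by (simp add: tensor_act_def fun_eq_iff)
next
  case (Suc k)
  have "ad_order UNIV k (ad s \<phi>)" for s
  proof (rule Suc.IH)
    fix U :: "'s tensor" assume U: "U \<in> diagonal_ideal_power k"
    let ?T = "[(1, s), (- s, 1)]"
    have T: "ad s \<phi> = tensor_act ?T \<phi>" "?T \<in> diagonal_ideal"
      by (simp_all add: ad_def tensor_act_def fun_eq_iff diagonal_ideal_def multiplication_map_def)
    have "tensor_act (tensor_mult ?T U) \<phi> = (\<lambda>_. 0)"
      by (rule Suc.prems(2)) (use T(2) U in \<open>auto intro!: exI[of _ "[(?T, U)]"]\<close>)
    then show "tensor_act U (ad s \<phi>) = (\<lambda>_. 0)"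
      unfolding T(1) tensor_act_commute[OF Suc.prems(1), of U] tensor_act_tensor_mult[OF Suc.prems(1)] .
  qed (rule ad_linear[OF assms(1) Suc.prems(1)])
  then show ?case by simp
qed

lemma generated_algebra_UNIV: "generated_algebra e UNIV = UNIV"
  by (auto intro: generated_algebra.generator)

lemma diff_ops_iff_ad_order:
  assumes "unital_ring_hom e"
  shows "\<phi> \<in> diff_ops e \<longleftrightarrow> \<phi> \<in> linear_endos e \<and> (\<exists>k. ad_order UNIV k \<phi>)"
proof
  assume "\<phi> \<in> diff_ops e"
  then show "\<phi> \<in> linear_endos e \<and> (\<exists>k. ad_order UNIV k \<phi>)"
    using ad_order_if_diagonal_ideal_power[OF assms] unfolding diff_ops_def by blast
qed (use diff_ops_if_ad_order[OF assms] generated_algebra_UNIV in blast)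

lemma diff_opsD:
  assumes "\<delta> \<in> diff_ops e"
  shows "\<delta> (a + b) = \<delta> a + \<delta> b" "\<delta> (e v * a) = e v * \<delta> a"
  using assms linear_endosD[of \<delta> e] by (simp_all add: diff_ops_def)

lemma diff_ops_mult:
  assumes "unital_ring_hom e"
  shows "(\<lambda>y. s * y) \<in> diff_ops e"
proof -
  have "ad_order UNIV 1 (\<lambda>y. s * y)" by (simp add: ad_def fun_eq_iff mult.left_commute)
  moreover have "(\<lambda>y. s * y) \<in> linear_endos e"
    by (rule linear_endosI[OF assms]) (simp_all add: distrib_left mult.left_commute)
  ultimately show ?thesis unfolding diff_ops_iff_ad_order[OF assms] by blast
qed

lemma diff_ops_add:
  assumes e: "unital_ring_hom e" and "\<delta> \<in> diff_ops e" "\<epsilon> \<in> diff_ops e"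
  shows "(\<lambda>y. \<delta> y + \<epsilon> y) \<in> diff_ops e"
proof -
  obtain k l where "ad_order UNIV k \<delta>" "ad_order UNIV l \<epsilon>"
    using assms by (auto simp: diff_ops_iff_ad_order)
  then have "ad_order UNIV (max k l) (\<lambda>y. \<delta> y + \<epsilon> y)"
    by (intro ad_order_add) (auto intro: ad_order_mono[of k] ad_order_mono[of l])
  moreover have "(\<lambda>y. \<delta> y + \<epsilon> y) \<in> linear_endos e"
    by (rule linear_endosI[OF e]) (simp_all add: diff_opsD[OF assms(2)] diff_opsD[OF assms(3)] distrib_left add_ac)
  ultimately show ?thesis unfolding diff_ops_iff_ad_order[OF e] by blast
qed

lemma ad_order_comp:
  assumes "unital_ring_hom e"
  shows "\<delta> \<in> linear_endos e \<Longrightarrow> \<epsilon> \<in> linear_endos e \<Longrightarrow> ad_order UNIV k \<delta> \<Longrightarrow> ad_order UNIV l \<epsilon> \<Longrightarrow>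
    ad_order UNIV (k + l) (\<lambda>y. \<delta> (\<epsilon> y))"
proof (induction "k + l" arbitrary: k l \<delta> \<epsilon>)
  case 0
  then show ?case by simp
next
  case (Suc m)
  note add = linear_endosD(1)[OF Suc.prems(1)]
  show ?case
  proof (cases "k = 0 \<or> l = 0")
    case True
    then have "(\<lambda>y. \<delta> (\<epsilon> y)) = (\<lambda>_. 0)"
      using Suc.prems additive_zero[of \<delta>, OF add] by auto
    then show ?thesis by (simp only: ad_order_zero)
  next
    case False
    then obtain k' l' where kl: "k = Suc k'" "l = Suc l'" by (metis not0_implies_Suc)
    have "ad_order UNIV (k' + l) (\<lambda>y. ad s \<delta> (\<epsilon> y))" for s
      using Suc.hyps(2) Suc.prems kl by (intro Suc.hyps(1) ad_linear assms) auto
    moreover have "ad_order UNIV (k + l') (\<lambda>y. \<delta> (ad s \<epsilon> y))" for s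
      using Suc.hyps(2) Suc.prems kl by (intro Suc.hyps(1) ad_linear assms) auto
    moreover have "ad s (\<lambda>y. \<delta> (\<epsilon> y)) = (\<lambda>y. ad s \<delta> (\<epsilon> y) + \<delta> (ad s \<epsilon> y))" for s
    proof
      fix y
      have "\<delta> (\<epsilon> (s * y)) = \<delta> (ad s \<epsilon> y) + \<delta> (s * \<epsilon> y)"
        unfolding add[symmetric] by (simp add: ad_def)
      then show "ad s (\<lambda>y. \<delta> (\<epsilon> y)) y = ad s \<delta> (\<epsilon> y) + \<delta> (ad s \<epsilon> y)"
        by (simp add: ad_def)
    qed
    moreover have "k + l' = k' + l" using kl by simp
    ultimately have "ad_order UNIV (k' + l) (ad s (\<lambda>y. \<delta> (\<epsilon> y)))" for s
      by (simp only: ad_order_add)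
    then show ?thesis by (simp only: kl(1) add_Suc ad_order.simps(2) ball_UNIV simp_thms)
  qed
qed

lemma diff_ops_comp:
  assumes e: "unital_ring_hom e" and "\<delta> \<in> diff_ops e" "\<epsilon> \<in> diff_ops e"
  shows "\<delta> \<circ> \<epsilon> \<in> diff_ops e"
proof -
  have "\<exists>k. ad_order UNIV k (\<delta> \<circ> \<epsilon>)"
    using assms ad_order_comp[OF e] unfolding diff_ops_iff_ad_order[OF e] comp_def by blast
  moreover have "\<delta> \<circ> \<epsilon> \<in> linear_endos e"
    by (rule linear_endosI[OF e]) (simp_all add: diff_opsD[OF assms(2)] diff_opsD[OF assms(3)])
  ultimately show ?thesis unfolding diff_ops_iff_ad_order[OF e] by blast
qed

lemma diff_ops_ad:
  assumes "unital_ring_hom e" "\<delta> \<in> diff_ops e"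
  shows "ad s \<delta> \<in> diff_ops e"
proof -
  obtain k where "ad_order UNIV k \<delta>" "\<delta> \<in> linear_endos e"
    using assms diff_ops_iff_ad_order by blast
  then have "ad_order UNIV k (ad s \<delta>)" using ad_order_Suc[of UNIV k \<delta>] by simp
  then show ?thesis using ad_linear assms diff_ops_iff_ad_order \<open>\<delta> \<in> linear_endos e\<close> by blast
qed


section \<open>Coordinates in a polynomial ring\<close>

text \<open>Everything about the polynomial ring is deduced from the fact that it is a free
  \<open>V\<close>-module on the monomials: additive maps are compared on elements \<open>v x\<^sup>m\<close> only
  (\<open>additive_eqI\<close>).\<close>

locale polynomial_ring =
  fixes c :: "'v::comm_ring_1 \<Rightarrow> 'r::comm_ring_1" and n :: nat and x :: "nat \<Rightarrow> 'r"
  assumes polynomial_ring: "is_polynomial_ring c n x"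
begin

definition monomials :: "(nat \<Rightarrow>\<^sub>0 nat) set" where
  "monomials = {m. Poly_Mapping.keys m \<subseteq> {..<n}}"

definition mon :: "(nat \<Rightarrow>\<^sub>0 nat) \<Rightarrow> 'r" where
  "mon m = (\<Prod>i\<in>Poly_Mapping.keys m. x i ^ Poly_Mapping.lookup m i)"

definition formal :: "'r \<Rightarrow> (nat \<Rightarrow>\<^sub>0 nat) \<Rightarrow>\<^sub>0 'v" where
  "formal = inv_into {P. Poly_Mapping.keys P \<subseteq> monomials} (eval_formal_poly c x)"

text \<open>For additive \<open>\<tau>\<close> this is the \<open>\<tau>\<close>-semilinear map with \<open>v x\<^sup>m \<mapsto> \<tau>(v) B(m)\<close>.\<close>

definition semilinear_ext :: "('v \<Rightarrow> 'v) \<Rightarrow> ((nat \<Rightarrow>\<^sub>0 nat) \<Rightarrow> 'r) \<Rightarrow> 'r \<Rightarrow> 'r" where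
  "semilinear_ext \<tau> B r =
     (\<Sum>m\<in>Poly_Mapping.keys (formal r). c (\<tau> (Poly_Mapping.lookup (formal r) m)) * B m)"

lemma c_hom: "unital_ring_hom c"
  using polynomial_ring by (simp add: is_polynomial_ring_def)

lemma c_1 [simp]: "c 1 = 1" and c_add: "c (v + w) = c v + c w" and c_mult: "c (v * w) = c v * c w"
  using c_hom by (simp_all add: unital_ring_hom_def)

lemma c_0 [simp]: "c 0 = 0"
  using c_add[of 0 0] by simp

lemma bij_eval: "bij_betw (eval_formal_poly c x) {P. Poly_Mapping.keys P \<subseteq> monomials} UNIV"
proof -
  have "{P. \<forall>m\<in>Poly_Mapping.keys P. Poly_Mapping.keys m \<subseteq> {..<n}}
      = {P :: (nat \<Rightarrow>\<^sub>0 nat) \<Rightarrow>\<^sub>0 'v. Poly_Mapping.keys P \<subseteq> monomials}"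
    by (auto simp: monomials_def)
  then show ?thesis using polynomial_ring by (simp add: is_polynomial_ring_def)
qed

lemma keys_formal: "Poly_Mapping.keys (formal r) \<subseteq> monomials"
  and eval_formal: "eval_formal_poly c x (formal r) = r"
proof -
  have "r \<in> eval_formal_poly c x ` {P. Poly_Mapping.keys P \<subseteq> monomials}"
    using bij_betw_imp_surj_on[OF bij_eval] by simp
  from inv_into_into[OF this] f_inv_into_f[OF this]
  show "Poly_Mapping.keys (formal r) \<subseteq> monomials" "eval_formal_poly c x (formal r) = r"
    unfolding formal_def by simp_all
qed

lemma formal_eqI: "Poly_Mapping.keys P \<subseteq> monomials \<Longrightarrow> eval_formal_poly c x P = r \<Longrightarrow> formal r = P"
  unfolding formal_def using inv_into_f_f[OF bij_betw_imp_inj_on[OF bij_eval]] by blast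

lemma eval_formal_poly_sum:
  assumes "finite A" "Poly_Mapping.keys P \<subseteq> A"
  shows "eval_formal_poly c x P = (\<Sum>m\<in>A. c (Poly_Mapping.lookup P m) * mon m)"
  unfolding eval_formal_poly_def mon_def[symmetric]
  using assms by (intro sum.mono_neutral_left) (auto simp: in_keys_iff)

lemma semilinear_ext_sum:
  assumes "finite A" "Poly_Mapping.keys (formal r) \<subseteq> A" "\<tau> 0 = 0"
  shows "semilinear_ext \<tau> B r = (\<Sum>m\<in>A. c (\<tau> (Poly_Mapping.lookup (formal r) m)) * B m)"
  unfolding semilinear_ext_def
  using assms by (intro sum.mono_neutral_left) (auto simp: in_keys_iff)

lemma formal_add: "formal (r + s) = formal r + formal s"
proof (rule formal_eqI)
  let ?A = "Poly_Mapping.keys (formal r) \<union> Poly_Mapping.keys (formal s)"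
  have k: "Poly_Mapping.keys (formal r + formal s) \<subseteq> ?A" by (rule keys_add)
  then show "Poly_Mapping.keys (formal r + formal s) \<subseteq> monomials"
    using keys_formal by blast
  have "eval_formal_poly c x (formal r + formal s)
      = eval_formal_poly c x (formal r) + eval_formal_poly c x (formal s)"
    using k by (simp add: eval_formal_poly_sum[where A = ?A] lookup_add c_add distrib_right sum.distrib)
  then show "eval_formal_poly c x (formal r + formal s) = r + s" by (simp add: eval_formal)
qed

lemma formal_monomial: "m \<in> monomials \<Longrightarrow> formal (c v * mon m) = Poly_Mapping.single m v"
  by (rule formal_eqI)
    (simp_all add: eval_formal_poly_sum[where A = "{m}"])

lemma semilinear_ext_add:
  assumes "\<And>v w. \<tau> (v + w) = \<tau> v + \<tau> w"
  shows "semilinear_ext \<tau> B (r + s) = semilinear_ext \<tau> B r + semilinear_ext \<tau> B s"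
proof -
  let ?A = "Poly_Mapping.keys (formal r) \<union> Poly_Mapping.keys (formal s)"
  have "Poly_Mapping.keys (formal (r + s)) \<subseteq> ?A"
    unfolding formal_add by (rule keys_add)
  then show ?thesis
    using additive_zero[of \<tau>, OF assms]
    by (simp add: semilinear_ext_sum[where A = ?A] formal_add lookup_add assms c_add distrib_right sum.distrib)
qed

lemma semilinear_ext_monomial:
  assumes "\<And>v w. \<tau> (v + w) = \<tau> v + \<tau> w" "m \<in> monomials"
  shows "semilinear_ext \<tau> B (c v * mon m) = c (\<tau> v) * B m"
  using assms(2) additive_zero[of \<tau>, OF assms(1)]
  by (simp add: semilinear_ext_sum[where A = "{m}"] formal_monomial)

lemma monomial_induct [case_names monomial add]:
  assumes monomial: "\<And>v m. m \<in> monomials \<Longrightarrow> P (c v * mon m)"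
    and add: "\<And>r s. P r \<Longrightarrow> P s \<Longrightarrow> P (r + s)"
  shows "P r"
proof -
  have zero: "P 0"
    using monomial[of 0 0] by (simp add: monomials_def)
  have "P (\<Sum>m\<in>A. c (Poly_Mapping.lookup (formal r) m) * mon m)" if "finite A" "A \<subseteq> monomials" for A
    using that by (induction A) (auto intro: zero monomial add)
  from this[OF finite_keys keys_formal[of r]]
  show ?thesis using eval_formal[of r] by (simp add: eval_formal_poly_sum[OF finite_keys order_refl])
qed

lemma additive_eqI:
  fixes \<phi> \<psi> :: "'r \<Rightarrow> 'b::ab_group_add"
  assumes "\<And>r s. \<phi> (r + s) = \<phi> r + \<phi> s" "\<And>r s. \<psi> (r + s) = \<psi> r + \<psi> s"
    "\<And>v m. m \<in> monomials \<Longrightarrow> \<phi> (c v * mon m) = \<psi> (c v * mon m)"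
  shows "\<phi> r = \<psi> r"
  by (induction r rule: monomial_induct) (simp_all add: assms)

lemma mon_eq_prod: "finite A \<Longrightarrow> Poly_Mapping.keys m \<subseteq> A \<Longrightarrow> mon m = (\<Prod>i\<in>A. x i ^ Poly_Mapping.lookup m i)"
  unfolding mon_def by (intro prod.mono_neutral_left) (auto simp: in_keys_iff)

lemma mon_0 [simp]: "mon 0 = 1"
  by (simp add: mon_def)

lemma mon_add: "mon (m + m') = mon m * mon m'"
proof -
  let ?A = "Poly_Mapping.keys m \<union> Poly_Mapping.keys m'"
  have "Poly_Mapping.keys (m + m') \<subseteq> ?A" by (rule keys_add)
  then show ?thesis
    by (simp add: mon_eq_prod[where A = ?A] lookup_add power_add prod.distrib)
qed

lemma zero_in_monomials [simp]: "0 \<in> monomials"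
  by (simp add: monomials_def)

lemma add_in_monomials: "m \<in> monomials \<Longrightarrow> m' \<in> monomials \<Longrightarrow> m + m' \<in> monomials"
  unfolding monomials_def using keys_add[of m m'] by blast

lemma lookup_map [simp]:
  "f 0 = 0 \<Longrightarrow> Poly_Mapping.lookup (Poly_Mapping.map f m) i = f (Poly_Mapping.lookup m i)"
  by transfer (simp add: when_def)

lemma map_in_monomials: "f 0 = 0 \<Longrightarrow> m \<in> monomials \<Longrightarrow> Poly_Mapping.map f m \<in> monomials"
  unfolding monomials_def by (auto simp: in_keys_iff subset_iff) (metis gr0I)

lemma mon_power: "mon m ^ q = mon (Poly_Mapping.map ((*) q) m)"
proof -
  have "Poly_Mapping.keys (Poly_Mapping.map ((*) q) m) \<subseteq> Poly_Mapping.keys m"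
    by (auto simp: in_keys_iff)
  then show ?thesis
    by (simp add: mon_eq_prod[where A = "Poly_Mapping.keys m"] prod_power_distrib power_mult[symmetric]
        mult.commute)
qed

lemma finite_bounded_monomials: "finite {m \<in> monomials. \<forall>i. Poly_Mapping.lookup m i < q}"
proof -
  have "inj_on (\<lambda>m. restrict (Poly_Mapping.lookup m) {..<n}) monomials"
  proof (rule inj_onI, rule poly_mapping_eqI)
    fix m m' i
    assume mm: "m \<in> monomials" "m' \<in> monomials"
      "restrict (Poly_Mapping.lookup m) {..<n} = restrict (Poly_Mapping.lookup m') {..<n}"
    show "Poly_Mapping.lookup m i = Poly_Mapping.lookup m' i"
    proof (cases "i < n")
      case True
      then show ?thesis using fun_cong[OF mm(3), of i] by simp
    next
      case False
      then have "i \<notin> Poly_Mapping.keys m" "i \<notin> Poly_Mapping.keys m'"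
        using mm(1,2) by (auto simp: monomials_def)
      then show ?thesis by (simp add: in_keys_iff)
    qed
  qed
  then have "inj_on (\<lambda>m. restrict (Poly_Mapping.lookup m) {..<n})
      {m \<in> monomials. \<forall>i. Poly_Mapping.lookup m i < q}"
    by (rule inj_on_subset) auto
  moreover have "(\<lambda>m. restrict (Poly_Mapping.lookup m) {..<n}) ` {m \<in> monomials. \<forall>i. Poly_Mapping.lookup m i < q}
      \<subseteq> {..<n} \<rightarrow>\<^sub>E {..<q}"
    by (intro image_subsetI restrict_PiE_iff[THEN iffD2]) auto
  moreover have "finite ({..<n} \<rightarrow>\<^sub>E {..<q})" by (intro finite_PiE) auto
  ultimately show ?thesis
    by (meson finite_imageD finite_subset)
qed

lemma generated: "generated_algebra c (x ` {..<n}) = UNIV"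
proof -
  have one: "1 \<in> generated_algebra c (x ` {..<n})"
    using generated_algebra.const[of c 1] by simp
  have pow: "s ^ k \<in> generated_algebra c (x ` {..<n})" if "s \<in> generated_algebra c (x ` {..<n})" for s k
    by (induction k) (auto intro: one that generated_algebra.mult)
  have "mon m \<in> generated_algebra c (x ` {..<n})" if "m \<in> monomials" for m
  proof -
    have "(\<Prod>i\<in>A. x i ^ Poly_Mapping.lookup m i) \<in> generated_algebra c (x ` {..<n})"
      if "finite A" "A \<subseteq> {..<n}" for A
      using that by (induction A) (auto intro: one pow generated_algebra.intros)
    then show ?thesis using that unfolding mon_def monomials_def by simp
  qed
  then have "r \<in> generated_algebra c (x ` {..<n})" for r
    by (induction r rule: monomial_induct) (auto intro: generated_algebra.intros)
  then show ?thesis by blast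
qed

inductive_set degree_le :: "nat \<Rightarrow> 'r set" for d where
  monomial: "m \<in> monomials \<Longrightarrow> (\<Sum>i<n. Poly_Mapping.lookup m i) \<le> d \<Longrightarrow> c v * mon m \<in> degree_le d"
| add: "r \<in> degree_le d \<Longrightarrow> s \<in> degree_le d \<Longrightarrow> r + s \<in> degree_le d"

lemma zero_in_degree_le [simp]: "0 \<in> degree_le d"
  using degree_le.monomial[of 0 d 0] by simp

lemma one_in_degree_le [simp]: "1 \<in> degree_le d"
  using degree_le.monomial[of 0 d 1] by simp

lemma degree_le_mono:
  assumes "d \<le> d'"
  shows "degree_le d \<subseteq> degree_le d'"
proof
  fix r assume "r \<in> degree_le d"
  then show "r \<in> degree_le d'"
    by induction (use assms in \<open>auto intro: degree_le.intros\<close>)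
qed

lemma degree_le_exists: "\<exists>d. r \<in> degree_le d"
proof (induction r rule: monomial_induct)
  case (monomial v m)
  then show ?case using degree_le.monomial by blast
next
  case (add r s)
  then obtain d d' where "r \<in> degree_le d" "s \<in> degree_le d'" by blast
  then have "r \<in> degree_le (max d d')" "s \<in> degree_le (max d d')"
    using degree_le_mono[of d "max d d'"] degree_le_mono[of d' "max d d'"] by auto
  then show ?case by (auto intro: degree_le.add)
qed

lemma degree_le_mult_monomial:
  assumes "s \<in> degree_le d'" "m \<in> monomials" "(\<Sum>i<n. Poly_Mapping.lookup m i) \<le> d"
  shows "(c v * mon m) * s \<in> degree_le (d + d')"
  using assms(1)
proof induction
  case (monomial m' w)
  have "(c v * mon m) * (c w * mon m') = c (v * w) * mon (m + m')"
    by (simp add: c_mult mon_add mult_ac)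
  also have "\<dots> \<in> degree_le (d + d')"
    using monomial assms
    by (intro degree_le.monomial add_in_monomials) (auto simp: lookup_add sum.distrib)
  finally show ?case .
next
  case (add r s)
  then show ?case by (simp add: distrib_left degree_le.add)
qed

lemma degree_le_mult:
  assumes "r \<in> degree_le d" "s \<in> degree_le d'"
  shows "r * s \<in> degree_le (d + d')"
  using assms(1)
  by induction (auto simp: distrib_right intro: degree_le.add degree_le_mult_monomial[OF assms(2)])

lemma degree_le_power: "r \<in> degree_le d \<Longrightarrow> r ^ k \<in> degree_le (k * d)"
  by (induction k) (auto intro: degree_le_mult)

lemma degree_le_scale: "r \<in> degree_le d \<Longrightarrow> c v * r \<in> degree_le d"
  using degree_le_mult_monomial[of r d 0 0 v] by simp

lemma module_c: "module (\<lambda>v r. c v * r)"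
  by (simp add: module_def c_add c_mult distrib_left distrib_right mult.assoc)

lemma degree_le_finite_length:
  assumes "length_le (*) {0} (UNIV :: 'v set) l"
  shows "\<exists>L. length_le (\<lambda>v r. c v * r) {0} (degree_le d) L"
proof -
  interpret M: module "\<lambda>v r. c v * r" by (rule module_c)
  note M.scale_scale [simp del]
  let ?B = "mon ` {m \<in> monomials. (\<Sum>i<n. Poly_Mapping.lookup m i) \<le> d}"
  have "{m \<in> monomials. (\<Sum>i<n. Poly_Mapping.lookup m i) \<le> d}
      \<subseteq> {m \<in> monomials. \<forall>i. Poly_Mapping.lookup m i < Suc d}"
  proof (intro subsetI CollectI conjI allI)
    fix m i
    assume m: "m \<in> {m \<in> monomials. (\<Sum>i<n. Poly_Mapping.lookup m i) \<le> d}"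
    show "Poly_Mapping.lookup m i < Suc d"
    proof (cases "i < n")
      case True
      then have "Poly_Mapping.lookup m i \<le> (\<Sum>i<n. Poly_Mapping.lookup m i)"
        by (intro member_le_sum) auto
      then show ?thesis using m by simp
    next
      case False
      then have "i \<notin> Poly_Mapping.keys m" using m by (auto simp: monomials_def)
      then show ?thesis by (simp add: in_keys_iff)
    qed
  qed auto
  then have "finite ?B" by (intro finite_imageI finite_subset[OF _ finite_bounded_monomials])
  then obtain L where L: "length_le (\<lambda>v r. c v * r) {0} (M.span ?B) L"
    using finitely_generated_finite_length[OF module_c assms] by blast
  have "r \<in> M.span ?B" if "r \<in> degree_le d" for r
    using that
  proof induction
    case (monomial m v)
    then show ?case by (intro M.span_scale M.span_base) auto
  next
    case (add r s)
    then show ?case by (intro M.span_add)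
  qed
  then show ?thesis using length_le_subset[OF L order_refl, of "degree_le d"] by blast
qed

end


section \<open>Frobenius lifts, operators of level \<open>e\<close>, and jumps\<close>

locale frobenius_polynomial_ring = polynomial_ring c n x
  for c :: "'v::comm_ring_1 \<Rightarrow> 'r::comm_ring_1" and n :: nat and x :: "nat \<Rightarrow> 'r" +
  fixes F :: "'v \<Rightarrow> 'v" and p :: nat
  assumes F_hom: "unital_ring_hom F" and F_bij: "bij F" and p_pos: "p > 0"
begin

text \<open>This is the \<open>e\<close>-th iterate of the Frobenius lift (\<open>Frob_Frob\<close>), given in closed form.\<close>

definition Frob :: "nat \<Rightarrow> 'r \<Rightarrow> 'r" where
  "Frob e = semilinear_ext (F ^^ e) (\<lambda>m. mon m ^ (p ^ e))"

abbreviation mon_mod :: "nat \<Rightarrow> (nat \<Rightarrow>\<^sub>0 nat) \<Rightarrow> (nat \<Rightarrow>\<^sub>0 nat)" where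
  "mon_mod q \<equiv> Poly_Mapping.map (\<lambda>k. k mod q)"

abbreviation mon_div :: "nat \<Rightarrow> (nat \<Rightarrow>\<^sub>0 nat) \<Rightarrow> (nat \<Rightarrow>\<^sub>0 nat)" where
  "mon_div q \<equiv> Poly_Mapping.map (\<lambda>k. k div q)"

text \<open>For fixed \<open>e\<close>, the values at \<open>r\<close> are the coordinates of \<open>r\<close> with respect to the basis of \<open>R\<close> over \<open>Frob\<^sup>e(R)\<close> formed by the
  monomials with exponents below \<open>p\<^sup>e\<close> (\<open>cartier_decomposition\<close>).\<close>

definition cartier :: "nat \<Rightarrow> (nat \<Rightarrow>\<^sub>0 nat) \<Rightarrow> 'r \<Rightarrow> 'r" where
  "cartier e a = semilinear_ext (inv F ^^ e)
     (\<lambda>m. if mon_mod (p ^ e) m = a then mon (mon_div (p ^ e) m) else 0)"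

lemma F_pow_hom: "(F ^^ e) (v + w) = (F ^^ e) v + (F ^^ e) w"
    "(F ^^ e) (v * w) = (F ^^ e) v * (F ^^ e) w" "(F ^^ e) 1 = 1"
  using F_hom by (induction e) (simp_all add: unital_ring_hom_def)

lemma F_pow_inv: "(inv F ^^ e) ((F ^^ e) v) = v" "(F ^^ e) ((inv F ^^ e) v) = v"
  using inv_fn_o_fn_is_id[OF F_bij, of e] fn_o_inv_fn_is_id[OF F_bij, of e] by (simp_all add: fun_eq_iff)

lemma inv_F_pow_hom: "(inv F ^^ e) (v + w) = (inv F ^^ e) v + (inv F ^^ e) w"
    "(inv F ^^ e) (v * w) = (inv F ^^ e) v * (inv F ^^ e) w"
proof -
  have "(inv F ^^ e) (v + w) = (inv F ^^ e) ((F ^^ e) ((inv F ^^ e) v) + (F ^^ e) ((inv F ^^ e) w))"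
    by (simp only: F_pow_inv)
  also have "\<dots> = (inv F ^^ e) v + (inv F ^^ e) w"
    by (simp only: F_pow_hom(1)[symmetric] F_pow_inv(1))
  finally show "(inv F ^^ e) (v + w) = (inv F ^^ e) v + (inv F ^^ e) w" .
  have "(inv F ^^ e) (v * w) = (inv F ^^ e) ((F ^^ e) ((inv F ^^ e) v) * (F ^^ e) ((inv F ^^ e) w))"
    by (simp only: F_pow_inv)
  also have "\<dots> = (inv F ^^ e) v * (inv F ^^ e) w"
    by (simp only: F_pow_hom(2)[symmetric] F_pow_inv(1))
  finally show "(inv F ^^ e) (v * w) = (inv F ^^ e) v * (inv F ^^ e) w" .
qed

lemma Frob_add: "Frob e (r + s) = Frob e r + Frob e s"
  unfolding Frob_def by (rule semilinear_ext_add) (rule F_pow_hom)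

lemma Frob_monomial: "m \<in> monomials \<Longrightarrow> Frob e (c v * mon m) = c ((F ^^ e) v) * mon m ^ (p ^ e)"
  unfolding Frob_def by (rule semilinear_ext_monomial) (rule F_pow_hom)

lemma cartier_add: "cartier e a (r + s) = cartier e a r + cartier e a s"
  unfolding cartier_def by (rule semilinear_ext_add) (rule inv_F_pow_hom)

lemma cartier_monomial:
  "m \<in> monomials \<Longrightarrow> cartier e a (c v * mon m) =
     c ((inv F ^^ e) v) * (if mon_mod (p ^ e) m = a then mon (mon_div (p ^ e) m) else 0)"
  unfolding cartier_def by (rule semilinear_ext_monomial) (rule inv_F_pow_hom)

lemma Frob_mult: "Frob e (r * s) = Frob e r * Frob e s"
proof -
  have *: "Frob e (c v * mon m * s) = Frob e (c v * mon m) * Frob e s" if "m \<in> monomials" for v m s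
  proof (rule additive_eqI[of "\<lambda>s. Frob e (c v * mon m * s)"])
    fix w m' assume m': "m' \<in> monomials"
    have "c v * mon m * (c w * mon m') = c (v * w) * mon (m + m')"
      by (simp add: c_mult mon_add mult_ac)
    then have "Frob e (c v * mon m * (c w * mon m')) = c ((F ^^ e) (v * w)) * mon (m + m') ^ (p ^ e)"
      using that m' by (simp only: Frob_monomial add_in_monomials)
    also have "\<dots> = c ((F ^^ e) v) * mon m ^ (p ^ e) * (c ((F ^^ e) w) * mon m' ^ (p ^ e))"
      by (simp add: F_pow_hom c_mult mon_add power_mult_distrib mult_ac)
    also have "\<dots> = Frob e (c v * mon m) * Frob e (c w * mon m')"
      using that m' by (simp only: Frob_monomial)
    finally show "Frob e (c v * mon m * (c w * mon m')) = Frob e (c v * mon m) * Frob e (c w * mon m')" .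
  qed (simp_all add: Frob_add distrib_left)
  show ?thesis
    by (rule additive_eqI[of "\<lambda>r. Frob e (r * s)" "\<lambda>r. Frob e r * Frob e s"])
      (simp_all only: Frob_add distrib_right *)
qed

lemma Frob_c: "Frob e (c v) = c ((F ^^ e) v)"
  using Frob_monomial[of 0 e v] by simp

lemma Frob_mon: "m \<in> monomials \<Longrightarrow> Frob e (mon m) = mon m ^ (p ^ e)"
  using Frob_monomial[of m e 1] F_pow_hom(3) by simp

lemma Frob_1 [simp]: "Frob e 1 = 1"
  using Frob_c[of e 1] F_pow_hom(3) by simp

lemma Frob_power: "Frob e (r ^ k) = Frob e r ^ k"
  by (induction k) (simp_all add: Frob_mult)

lemma Frob_Frob: "Frob e (Frob e' r) = Frob (e + e') r"
proof (rule additive_eqI[of "\<lambda>r. Frob e (Frob e' r)"])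
  fix v m assume "m \<in> monomials"
  then show "Frob e (Frob e' (c v * mon m)) = Frob (e + e') (c v * mon m)"
    by (simp add: Frob_mult Frob_c Frob_mon Frob_power funpow_add power_add power_mult mult.commute)
qed (simp_all add: Frob_add)

lemma Frob_x:
  assumes "i < n"
  shows "Frob e (x i) = x i ^ (p ^ e)"
proof -
  have "mon (Poly_Mapping.single i 1) = x i" by (simp add: mon_def)
  moreover have "Poly_Mapping.single i 1 \<in> monomials"
    using assms by (simp add: monomials_def)
  ultimately show ?thesis using Frob_mon by metis
qed

text \<open>On monomials: multiplication by \<open>x\<^sup>q\<^sup>m\<close> does not change exponents modulo \<open>q\<close> and adds \<open>m\<close> to
  their quotients by \<open>q\<close>.\<close>

lemma cartier_Frob_mult: "cartier e a (Frob e r * s) = r * cartier e a s"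
proof -
  let ?q = "p ^ e"
  have *: "cartier e a (Frob e (c v * mon m) * s) = c v * mon m * cartier e a s" if m: "m \<in> monomials" for v m s
  proof (rule additive_eqI[of "\<lambda>s. cartier e a (Frob e (c v * mon m) * s)"])
    fix w m' assume m': "m' \<in> monomials"
    let ?m = "Poly_Mapping.map ((*) ?q) m + m'"
    have "?m \<in> monomials" using m m' by (intro add_in_monomials map_in_monomials) auto
    moreover have "mon_mod ?q ?m = mon_mod ?q m'"
      by (rule poly_mapping_eqI) (simp add: lookup_add)
    moreover have "mon_div ?q ?m = m + mon_div ?q m'"
      using p_pos by (intro poly_mapping_eqI) (simp add: lookup_add)
    moreover have "Frob e (c v * mon m) * (c w * mon m') = c ((F ^^ e) v * w) * mon ?m"
      using m by (simp add: Frob_monomial mon_power mon_add c_mult mult_ac)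
    ultimately have "cartier e a (Frob e (c v * mon m) * (c w * mon m'))
        = c ((inv F ^^ e) ((F ^^ e) v * w)) * (if mon_mod ?q m' = a then mon (m + mon_div ?q m') else 0)"
      by (simp only: cartier_monomial)
    also have "\<dots> = c v * mon m * (c ((inv F ^^ e) w) * (if mon_mod ?q m' = a then mon (mon_div ?q m') else 0))"
      by (simp add: inv_F_pow_hom F_pow_inv c_mult mon_add mult_ac)
    also have "\<dots> = c v * mon m * cartier e a (c w * mon m')"
      using m' by (simp only: cartier_monomial)
    finally show "cartier e a (Frob e (c v * mon m) * (c w * mon m'))
        = c v * mon m * cartier e a (c w * mon m')" .
  qed (simp_all add: cartier_add distrib_left)
  show ?thesis
    by (rule additive_eqI[of "\<lambda>r. cartier e a (Frob e r * s)" "\<lambda>r. r * cartier e a s"])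
      (simp_all only: Frob_add cartier_add distrib_right *)
qed

lemma cartier_0_one: "cartier e 0 1 = 1"
proof -
  have "(inv F ^^ e) 1 = 1" using F_pow_inv(1)[of e 1] F_pow_hom(3) by simp
  moreover have "mon_mod (p ^ e) 0 = 0" "mon_div (p ^ e) 0 = 0"
    by (rule poly_mapping_eqI, simp)+
  ultimately show ?thesis using cartier_monomial[of 0 e 0 1] by simp
qed

lemma cartier_Frob: "cartier e 0 (Frob e r) = r"
  using cartier_Frob_mult[of e 0 r 1] by (simp add: cartier_0_one)

definition residue_monomials :: "nat \<Rightarrow> (nat \<Rightarrow>\<^sub>0 nat) set" where
  "residue_monomials e = {a \<in> monomials. \<forall>i. Poly_Mapping.lookup a i < p ^ e}"

lemma Frob_0 [simp]: "Frob e 0 = 0"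
  by (rule additive_zero) (rule Frob_add)

lemma cartier_decomposition: "(\<Sum>a\<in>residue_monomials e. Frob e (cartier e a r) * mon a) = r"
proof (rule additive_eqI[of "\<lambda>r. \<Sum>a\<in>residue_monomials e. Frob e (cartier e a r) * mon a"])
  let ?q = "p ^ e"
  fix v m assume m: "m \<in> monomials"
  let ?t = "Frob e (c ((inv F ^^ e) v) * mon (mon_div ?q m)) * mon (mon_mod ?q m)"
  have "mon_mod ?q m \<in> residue_monomials e"
    using m p_pos by (auto simp: residue_monomials_def intro: map_in_monomials)
  moreover have "finite (residue_monomials e)"
    unfolding residue_monomials_def by (rule finite_bounded_monomials)
  moreover have "Frob e (cartier e a (c v * mon m)) * mon a = (if mon_mod ?q m = a then ?t else 0)" for a
    using m by (auto simp: cartier_monomial)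
  ultimately have "(\<Sum>a\<in>residue_monomials e. Frob e (cartier e a (c v * mon m)) * mon a) = ?t"
    by simp
  also have "\<dots> = c v * mon (Poly_Mapping.map ((*) ?q) (mon_div ?q m) + mon_mod ?q m)"
    using m by (simp add: Frob_monomial map_in_monomials F_pow_inv mon_power mon_add mult_ac)
  also have "Poly_Mapping.map ((*) ?q) (mon_div ?q m) + mon_mod ?q m = m"
    by (rule poly_mapping_eqI) (simp add: lookup_add)
  finally show "(\<Sum>a\<in>residue_monomials e. Frob e (cartier e a (c v * mon m)) * mon a) = c v * mon m" .
qed (simp_all add: cartier_add Frob_add distrib_right sum.distrib)

lemma cartier_degree_le:
  assumes "r \<in> degree_le d"
  shows "cartier e a r \<in> degree_le (d div p ^ e)"
  using assms
proof induction
  case (monomial m v)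
  have "p ^ e * (\<Sum>i<n. Poly_Mapping.lookup (mon_div (p ^ e) m) i) \<le> (\<Sum>i<n. Poly_Mapping.lookup m i)"
    unfolding sum_distrib_left by (intro sum_mono) simp
  then have "p ^ e * (\<Sum>i<n. Poly_Mapping.lookup (mon_div (p ^ e) m) i) \<le> d"
    using monomial(2) by linarith
  then have "(\<Sum>i<n. Poly_Mapping.lookup (mon_div (p ^ e) m) i) \<le> d div p ^ e"
    using p_pos by (simp add: less_eq_div_iff_mult_less_eq mult.commute)
  then show ?case
    using monomial(1) by (auto simp: cartier_monomial intro!: degree_le.monomial map_in_monomials)
qed (simp add: cartier_add degree_le.add)

definition level_ops :: "nat \<Rightarrow> ('r \<Rightarrow> 'r) set" where
  "level_ops e = {\<delta>. (\<forall>r s. \<delta> (r + s) = \<delta> r + \<delta> s) \<and> (\<forall>r s. \<delta> (Frob e r * s) = Frob e r * \<delta> s)}"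

lemma level_opsI:
  assumes "\<And>r s. \<delta> (r + s) = \<delta> r + \<delta> s" "\<And>r s. \<delta> (Frob e r * s) = Frob e r * \<delta> s"
  shows "\<delta> \<in> level_ops e"
  using assms by (simp add: level_ops_def)

lemma level_opsD:
  assumes "\<delta> \<in> level_ops e"
  shows "\<delta> (r + s) = \<delta> r + \<delta> s" "\<delta> (Frob e r * s) = Frob e r * \<delta> s"
  using assms by (simp_all add: level_ops_def)

text \<open>The \<open>D\<^sup>(\<^sup>e\<^sup>)\<close>-submodule \<open>D\<^sup>(\<^sup>e\<^sup>) h\<close> of \<open>R\<close>.\<close>

definition orbit :: "nat \<Rightarrow> 'r \<Rightarrow> 'r set" where
  "orbit e h = {\<delta> h |\<delta>. \<delta> \<in> level_ops e}"

lemma orbitI: "\<delta> \<in> level_ops e \<Longrightarrow> h' = \<delta> h \<Longrightarrow> h' \<in> orbit e h"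
  unfolding orbit_def by blast

lemma orbit_add: "r \<in> orbit e h \<Longrightarrow> s \<in> orbit e h \<Longrightarrow> r + s \<in> orbit e h"
  unfolding orbit_def
proof clarify
  fix \<delta> \<epsilon> assume "\<delta> \<in> level_ops e" "\<epsilon> \<in> level_ops e"
  then have "(\<lambda>z. \<delta> z + \<epsilon> z) \<in> level_ops e"
    by (intro level_opsI) (simp_all add: level_opsD distrib_left add_ac)
  then show "\<exists>\<gamma>. \<delta> h + \<epsilon> h = \<gamma> h \<and> \<gamma> \<in> level_ops e"
    by (intro exI[of _ "\<lambda>z. \<delta> z + \<epsilon> z"]) simp
qed

lemma orbit_mult: "r \<in> orbit e h \<Longrightarrow> s * r \<in> orbit e h"
  unfolding orbit_def
proof clarify
  fix \<delta> assume "\<delta> \<in> level_ops e"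
  then have "(\<lambda>z. s * \<delta> z) \<in> level_ops e"
    by (intro level_opsI) (simp_all add: level_opsD distrib_left mult.left_commute)
  then show "\<exists>\<gamma>. s * \<delta> h = \<gamma> h \<and> \<gamma> \<in> level_ops e"
    by (intro exI[of _ "\<lambda>z. s * \<delta> z"]) simp
qed

lemma orbit_zero: "0 \<in> orbit e h"
  by (rule orbitI[of "\<lambda>_. 0"]) (auto intro: level_opsI)

lemma orbit_sum: "(\<And>i. i \<in> I \<Longrightarrow> g i \<in> orbit e h) \<Longrightarrow> (\<Sum>i\<in>I. g i) \<in> orbit e h"
  by (induction I rule: infinite_finite_induct) (auto intro: orbit_add orbit_zero)

lemma orbit_mult_subset: "orbit e (s * h) \<subseteq> orbit e h"
  unfolding orbit_def
proof clarify
  fix \<delta> assume "\<delta> \<in> level_ops e"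
  then have "(\<lambda>z. \<delta> (s * z)) \<in> level_ops e"
    by (intro level_opsI) (simp_all add: level_opsD distrib_left mult.left_commute[of s])
  then show "\<exists>\<gamma>. \<delta> (s * h) = \<gamma> h \<and> \<gamma> \<in> level_ops e"
    by (intro exI[of _ "\<lambda>z. \<delta> (s * z)"]) simp
qed

lemma Frob_cartier_in_orbit: "Frob e (cartier e a h) \<in> orbit e h"
  by (rule orbitI[of "\<lambda>z. Frob e (cartier e a z)"])
    (auto intro!: level_opsI simp: cartier_add Frob_add cartier_Frob_mult Frob_mult)

definition jumps :: "nat \<Rightarrow> 'r \<Rightarrow> nat set" where
  "jumps e g = {q. g ^ q \<notin> orbit e (g ^ Suc q)}"

lemma level_ops_mono: "e \<le> e' \<Longrightarrow> level_ops e \<subseteq> level_ops e'"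
proof
  fix \<delta> assume le: "e \<le> e'" and \<delta>: "\<delta> \<in> level_ops e"
  show "\<delta> \<in> level_ops e'"
  proof (rule level_opsI)
    fix r s
    have "Frob e' r = Frob e (Frob (e' - e) r)" using le by (simp add: Frob_Frob)
    then show "\<delta> (Frob e' r * s) = Frob e' r * \<delta> s"
      by (simp only: level_opsD(2)[OF \<delta>])
  qed (rule level_opsD(1)[OF \<delta>])
qed

lemma jumps_antimono: "e \<le> e' \<Longrightarrow> jumps e' g \<subseteq> jumps e g"
  using level_ops_mono[of e e'] unfolding jumps_def orbit_def by blast

text \<open>Write \<open>q = t k + r\<close> with \<open>r < t\<close>. If \<open>\<delta>\<close> maps \<open>g\<^sup>t\<^sup>(\<^sup>k\<^sup>+\<^sup>1\<^sup>)\<close> to \<open>g\<^sup>t\<^sup>k\<close>, then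
  \<open>g\<^sup>r \<delta> g\<^sup>t\<^sup>-\<^sup>r\<^sup>-\<^sup>1\<close> maps \<open>g\<^sup>q\<^sup>+\<^sup>1\<close> to \<open>g\<^sup>q\<close>.\<close>

lemma jumps_power_div:
  assumes "q \<in> jumps e g" "t > 0"
  shows "q div t \<in> jumps e (g ^ t)"
proof (rule ccontr)
  assume "q div t \<notin> jumps e (g ^ t)"
  then have "(g ^ t) ^ (q div t) \<in> orbit e ((g ^ t) ^ Suc (q div t))"
    by (simp add: jumps_def)
  then have "g ^ (q mod t) * (g ^ t) ^ (q div t) \<in> orbit e ((g ^ t) ^ Suc (q div t))"
    by (rule orbit_mult)
  moreover have "g ^ (q mod t) * (g ^ t) ^ (q div t) = g ^ q"
    by (simp flip: power_mult power_add)
  moreover have "(g ^ t) ^ Suc (q div t) = g ^ (t - Suc (q mod t)) * g ^ Suc q"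
  proof -
    have "t - Suc (q mod t) + Suc q = t * Suc (q div t)"
      using mod_less_divisor[OF assms(2), of q] mult_div_mod_eq[of t q] unfolding mult_Suc_right by linarith
    then show ?thesis by (simp only: power_mult[symmetric] power_add[symmetric])
  qed
  ultimately have "g ^ q \<in> orbit e (g ^ Suc q)"
    using orbit_mult_subset by (metis subsetD)
  then show False using assms(1) by (simp add: jumps_def)
qed

text \<open>Let \<open>\<delta>\<close> have level \<open>e\<close> and let \<open>C\<close> be the splitting \<open>cartier 1 0\<close> of \<open>Frob\<close>. Then
  \<open>Frob \<circ> \<delta> \<circ> C\<close> has level \<open>e + 1\<close> and maps \<open>Frob h\<close> to \<open>Frob (\<delta> h)\<close>.\<close>

lemma jumps_div:
  assumes g: "Frob 1 g = g ^ p" and "q \<in> jumps (Suc e) g"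
  shows "q div p \<in> jumps e g"
proof (rule ccontr)
  assume "q div p \<notin> jumps e g"
  then obtain \<delta> where \<delta>: "\<delta> \<in> level_ops e" "g ^ (q div p) = \<delta> (g ^ Suc (q div p))"
    by (auto simp: jumps_def orbit_def)
  let ?\<epsilon> = "\<lambda>z. Frob 1 (\<delta> (cartier 1 0 z))"
  have "?\<epsilon> \<in> level_ops (Suc e)"
  proof (rule level_opsI)
    fix r s
    have "Frob (Suc e) r = Frob 1 (Frob e r)" by (simp add: Frob_Frob)
    then show "?\<epsilon> (Frob (Suc e) r * s) = Frob (Suc e) r * ?\<epsilon> s"
      by (simp add: cartier_Frob_mult level_opsD[OF \<delta>(1)] Frob_mult)
  qed (simp add: cartier_add level_opsD[OF \<delta>(1)] Frob_add)
  moreover have "Frob 1 (g ^ k) = (g ^ p) ^ k" for k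
    by (simp only: Frob_power g)
  then have "(g ^ p) ^ (q div p) = ?\<epsilon> ((g ^ p) ^ Suc (q div p))"
    using \<delta>(2) by (metis cartier_Frob)
  ultimately have "(g ^ p) ^ (q div p) \<in> orbit (Suc e) ((g ^ p) ^ Suc (q div p))"
    by (rule orbitI)
  then show False using jumps_power_div[OF assms(2) p_pos] by (simp add: jumps_def)
qed

text \<open>The factor \<open>g\<^sup>t = Frob\<^sup>e(h)\<close> is a scalar for operators of level \<open>e\<close>.\<close>

lemma jumps_mod:
  assumes g: "Frob e h = g ^ t" "t > 0" and "q \<in> jumps e g"
  shows "q mod t \<in> jumps e g"
proof (rule ccontr)
  assume "q mod t \<notin> jumps e g"
  then obtain \<delta> where \<delta>: "\<delta> \<in> level_ops e" "g ^ (q mod t) = \<delta> (g ^ Suc (q mod t))"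
    by (auto simp: jumps_def orbit_def)
  have h: "Frob e (h ^ (q div t)) = g ^ (t * (q div t))"
    by (simp only: Frob_power g power_mult)
  have "g ^ q = g ^ (t * (q div t) + q mod t)" by simp
  also have "\<dots> = Frob e (h ^ (q div t)) * \<delta> (g ^ Suc (q mod t))"
    by (simp only: power_add h \<delta>(2))
  also have "\<dots> = \<delta> (g ^ (t * (q div t) + Suc (q mod t)))"
    using level_opsD(2)[OF \<delta>(1), of "h ^ (q div t)" "g ^ Suc (q mod t)"]
    by (simp only: h power_add)
  also have "t * (q div t) + Suc (q mod t) = Suc q" by simp
  finally have "g ^ q = \<delta> (g ^ Suc q)" .
  then show False using assms(3) orbitI[OF \<delta>(1)] by (auto simp: jumps_def)
qed

text \<open>The bound is the length of the \<open>V\<close>-module of polynomials of degree at most \<open>d = deg g\<close>. For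
  \<open>j \<le> p\<^sup>e\<close> the coordinates of \<open>g\<^sup>j\<close> over \<open>Frob\<^sup>e(R)\<close> have degree at most \<open>j d / p\<^sup>e \<le> d\<close>, so
  whether \<open>g\<^sup>j\<close> lies in \<open>D\<^sup>(\<^sup>e\<^sup>) g\<^sup>j\<^sup>+\<^sup>1\<close> is visible in degrees at most \<open>d\<close>.\<close>

lemma card_jumps_le:
  assumes "length_le (*) {0} (UNIV :: 'v set) l"
  shows "\<exists>L. \<forall>e. card (jumps e g \<inter> {..<p ^ e}) \<le> L"
proof -
  obtain d where d: "g \<in> degree_le d" using degree_le_exists by blast
  obtain L where L: "length_le (\<lambda>v r. c v * r) {0} (degree_le d) L"
    using degree_le_finite_length[OF assms] by blast
  have "card (jumps e g \<inter> {..<p ^ e}) \<le> L" for e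
  proof -
    define W where "W j = {u \<in> degree_le d. Frob e u \<in> orbit e (g ^ j)}" for j
    have anti: "W (Suc j) \<subseteq> W j" for j
      unfolding W_def using orbit_mult_subset[of e g "g ^ j"] by auto
    have "submodule_chain (\<lambda>v r. c v * r) {0} (degree_le d) W"
      unfolding submodule_chain_def
    proof (intro allI conjI)
      fix j
      show "module.subspace (\<lambda>v r. c v * r) (W j)"
        unfolding module.subspace_def[OF module_c]
        by (auto simp: W_def Frob_add Frob_mult orbit_zero intro: degree_le.add orbit_add degree_le_scale orbit_mult)
      show "{0} \<subseteq> W j" "W j \<subseteq> degree_le d" by (auto simp: W_def orbit_zero)
    qed (rule anti)
    note drops = length_leD[OF L this]
    have "jumps e g \<inter> {..<p ^ e} \<subseteq> chain_drops W"
    proof (rule subsetI, rule ccontr)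
      fix j assume j: "j \<in> jumps e g \<inter> {..<p ^ e}" and "j \<notin> chain_drops W"
      then have W: "W j = W (Suc j)" by (simp add: chain_drops_def)
      have "Frob e (cartier e a (g ^ j)) \<in> orbit e (g ^ Suc j)" for a
      proof -
        have "cartier e a (g ^ j) \<in> degree_le (j * d div p ^ e)"
          by (intro cartier_degree_le degree_le_power d)
        moreover have "j * d \<le> p ^ e * d" using j by simp
        then have "j * d div p ^ e \<le> p ^ e * d div p ^ e" by (rule div_le_mono)
        then have "j * d div p ^ e \<le> d" using p_pos by simp
        ultimately have "cartier e a (g ^ j) \<in> W j"
          using degree_le_mono Frob_cartier_in_orbit by (auto simp: W_def)
        then show ?thesis unfolding W by (simp add: W_def)
      qed
      then have "(\<Sum>a\<in>residue_monomials e. Frob e (cartier e a (g ^ j)) * mon a) \<in> orbit e (g ^ Suc j)"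
        by (intro orbit_sum) (simp only: mult.commute[of _ "mon _"] orbit_mult)
      then show False using j by (simp add: cartier_decomposition jumps_def)
    qed
    then show ?thesis using drops by (meson card_mono order_trans)
  qed
  then show ?thesis by blast
qed

end


section \<open>Limits of jumps are rational\<close>

lemma padic_int_mod:
  assumes "\<alpha> \<in> padic_int p" "j \<le> k"
  shows "\<alpha> k mod int p ^ j = \<alpha> j"
  using assms(2)
proof (induction k rule: dec_induct)
  case base
  then show ?case using assms(1) by (simp add: padic_int_def)
next
  case (step k)
  have "\<alpha> (Suc k) mod int p ^ j = (\<alpha> (Suc k) mod int p ^ k) mod int p ^ j"
    using step(1) by (intro mod_mod_cancel[symmetric] le_imp_power_dvd)
  also have "\<alpha> (Suc k) mod int p ^ k = \<alpha> k" using assms(1) by (simp add: padic_int_def)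
  finally show ?case using step.IH by simp
qed

lemma padic_rationalsI:
  assumes \<alpha>: "\<alpha> \<in> padic_int p" and "prime p" and B: "B > 0" "\<not> int p dvd B"
    and eq: "\<And>k. int p ^ k dvd B * \<alpha> k - A"
  shows "\<alpha> \<in> padic_rationals p"
proof -
  define g where "g = gcd A B"
  define a where "a = A div g"
  define b where "b = B div g"
  have g: "g > 0" "A = g * a" "B = g * b"
    using B by (simp_all add: g_def a_def b_def)
  have q: "quotient_of (Fract A B) = (a, b)"
    using B by (simp add: quotient_of_Fract Rat.normalize_def Let_def g_def a_def b_def)
  have "\<not> int p dvd b" "\<not> int p dvd g" using B(2) g(3) by auto
  have "prime (int p)" using \<open>prime p\<close> by simp
  then have "coprime (int p ^ k) g" for k
    using \<open>\<not> int p dvd g\<close> by (simp add: prime_imp_coprime)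
  moreover have "int p ^ k dvd g * (b * \<alpha> k - a)" for k
    using eq[of k] g by (simp add: algebra_simps)
  ultimately have "int p ^ k dvd b * \<alpha> k - a" for k
    using coprime_dvd_mult_right_iff by blast
  then have "(b mod int p ^ k * \<alpha> k) mod int p ^ k = a mod int p ^ k" for k
    by (simp add: mod_mult_left_eq mod_eq_dvd_iff)
  then have "padic_mult p (padic_of_int p b) \<alpha> = padic_of_int p a"
    by (simp add: padic_mult_def padic_of_int_def)
  then show ?thesis
    unfolding padic_rationals_def using \<alpha> q \<open>\<not> int p dvd b\<close> by (auto intro!: exI[of _ "Fract A B"])
qed

text \<open>If the numbers left after deleting \<open>i\<close> and \<open>j\<close> base-\<open>p\<close> digits of \<open>\<nu>\<close> agree modulo \<open>p\<^sup>k\<close>, then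
  \<open>\<nu>\<close> approximates the rational number \<open>A / (p\<^sup>j\<^sup>-\<^sup>i - 1)\<close> modulo \<open>p\<^sup>k\<close>, where \<open>A\<close> depends on the
  deleted digits only.\<close>

lemma shifted_digits_congruence:
  fixes \<nu> i j k p :: nat
  assumes "p > 0" "i \<le> j" and eq: "(\<nu> div p ^ i) mod p ^ k = (\<nu> div p ^ j) mod p ^ k"
  shows "int p ^ k dvd (int p ^ (j - i) - 1) * int \<nu> - (int p ^ (j - i) * int (\<nu> mod p ^ i) - int (\<nu> mod p ^ j))"
proof -
  have "int p ^ k dvd int (\<nu> div p ^ i) - int (\<nu> div p ^ j)"
    using eq by (metis mod_eq_dvd_iff of_nat_mod of_nat_power)
  then have "int p ^ k dvd int p ^ j * (int (\<nu> div p ^ i) - int (\<nu> div p ^ j))"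
    by (rule dvd_mult)
  also have "int p ^ j * (int (\<nu> div p ^ i) - int (\<nu> div p ^ j))
      = int p ^ (j - i) * (int p ^ i * int (\<nu> div p ^ i)) - int p ^ j * int (\<nu> div p ^ j)"
    using assms(2) by (simp add: algebra_simps flip: power_add)
  also have "int p ^ i * int (\<nu> div p ^ i) = int \<nu> - int (\<nu> mod p ^ i)"
    by (metis add_diff_cancel_right' mult_div_mod_eq of_nat_add of_nat_mult of_nat_power)
  also have "int p ^ j * int (\<nu> div p ^ j) = int \<nu> - int (\<nu> mod p ^ j)"
    by (metis add_diff_cancel_right' mult_div_mod_eq of_nat_add of_nat_mult of_nat_power)
  finally show ?thesis by (simp add: algebra_simps)
qed

text \<open>What the argument uses of an artinian local base ring on which \<open>F\<close> induces the Frobenius map of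
  the residue field: there the maximal ideal contains \<open>p\<close> and all \<open>F v - v\<^sup>p\<close>, and its elements are
  nilpotent.\<close>

locale frobenius_lift = frobenius_polynomial_ring c n x F p
  for c :: "'v::comm_ring_1 \<Rightarrow> 'r::comm_ring_1" and n x F p +
  assumes prime_p: "prime p" and p_nilpotent: "nilpotent_elem (of_nat p :: 'v)"
    and F_lift: "\<And>v. nilpotent_elem (F v - v ^ p)"
begin

lemma c_power: "c (v ^ k) = c v ^ k"
  by (induction k) (simp_all add: c_mult)

lemma c_diff: "c (v - w) = c v - c w"
  using c_add[of "v - w" w] by simp

lemma c_of_nat: "c (of_nat k) = of_nat k"
  by (induction k) (simp_all add: c_add)

lemma c_nilpotent: "nilpotent_elem v \<Longrightarrow> nilpotent_elem (c v)"
  unfolding nilpotent_elem_def by (metis c_power c_0)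

lemma p_nilpotent': "nilpotent_elem (of_nat p :: 'r)"
  using c_nilpotent[OF p_nilpotent] by (simp add: c_of_nat)

text \<open>The elements with this property form a subring, because \<open>(s + t)\<^sup>p - s\<^sup>p - t\<^sup>p\<close> is a multiple of
  \<open>p\<close>; it contains \<open>V\<close> and the variables.\<close>

lemma Frob_minus_power_nilpotent: "nilpotent_elem (Frob 1 r - r ^ p)"
proof -
  have "r \<in> generated_algebra c (x ` {..<n})" by (simp add: generated)
  then show ?thesis
  proof induction
    case (const v)
    have "Frob 1 (c v) - c v ^ p = c (F v - v ^ p)" by (simp add: Frob_c c_diff c_power)
    then show ?case using c_nilpotent[OF F_lift] by simp
  next
    case (generator s)
    then show ?case using Frob_x[of _ 1] by auto
  next
    case (add s t)
    obtain z where "(s + t) ^ p - (s ^ p + t ^ p) = of_nat p * z"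
      using prime_dvd_add_power_diff[OF prime_p, of s t] by (elim dvdE)
    then have "Frob 1 (s + t) - (s + t) ^ p = (Frob 1 s - s ^ p) + (Frob 1 t - t ^ p) - of_nat p * z"
      by (simp add: Frob_add algebra_simps)
    then show ?case
      using add p_nilpotent' by (simp only: nilpotent_elem_add nilpotent_elem_diff nilpotent_elem_mult_left)
  next
    case (mult s t)
    have "Frob 1 (s * t) - (s * t) ^ p = (Frob 1 s - s ^ p) * Frob 1 t + s ^ p * (Frob 1 t - t ^ p)"
      by (simp add: Frob_mult power_mult_distrib algebra_simps)
    then show ?case
      using mult by (simp only: nilpotent_elem_add nilpotent_elem_mult nilpotent_elem_mult_left)
  qed
qed

lemma Frob_prime_power: "\<exists>K. Frob 1 (r ^ (p ^ K)) = (r ^ (p ^ K)) ^ p"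
proof -
  obtain K where "Frob 1 r ^ (p ^ K) = (r ^ p) ^ (p ^ K)"
    using prime_powers_eq_if_nilpotent_diff[OF prime_p p_nilpotent' Frob_minus_power_nilpotent] by blast
  then show ?thesis by (metis Frob_power power_commutes power_mult mult.commute)
qed

lemma Frob_iterate: "Frob 1 g = g ^ p \<Longrightarrow> Frob e g = g ^ (p ^ e)"
proof (induction e)
  case 0
  have "Frob 0 g = g"
    by (rule additive_eqI[of "Frob 0" "\<lambda>r. r"]) (simp_all add: Frob_add Frob_monomial)
  then show ?case by simp
next
  case (Suc e)
  have "Frob (Suc e) g = Frob 1 (Frob e g)" by (simp add: Frob_Frob)
  also have "\<dots> = g ^ (p ^ Suc e)"
    using Suc by (simp only: Frob_power power_mult[symmetric] power_Suc)
  finally show ?case .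
qed

lemma jumps_shift:
  assumes g: "Frob 1 g = g ^ p"
  shows "q \<in> jumps (e + i) g \<Longrightarrow> q div p ^ i \<in> jumps e g"
proof (induction i arbitrary: q)
  case (Suc i)
  have "q div p \<in> jumps (e + i) g" using Suc.prems by (intro jumps_div[OF g]) simp
  from Suc.IH[OF this] show ?case by (simp add: div_mult2_eq)
qed simp

text \<open>For \<open>i \<le> L\<close> delete \<open>K + i\<close> digits of a jump \<open>\<nu> \<equiv> \<alpha>\<close> and keep \<open>k\<close> of the remaining ones. These
  \<open>L + 1\<close> numbers are jumps of \<open>g\<close> of level \<open>k\<close> below \<open>p\<^sup>k\<close>, so two of them coincide. The pair of
  shifts depends on \<open>k\<close>, but there are finitely many pairs and the resulting congruences get
  stronger with \<open>k\<close>, so one pair serves all \<open>k\<close>.\<close>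

theorem padic_rational_if_jumps:
  assumes len: "length_le (*) {0} (UNIV :: 'v set) l"
    and \<alpha>: "\<alpha> \<in> padic_int p" and jumps: "\<And>e. \<exists>\<nu>\<in>jumps e f. int \<nu> mod int p ^ e = \<alpha> e"
  shows "\<alpha> \<in> padic_rationals p"
proof -
  obtain K where K: "Frob 1 (f ^ (p ^ K)) = (f ^ (p ^ K)) ^ p"
    using Frob_prime_power by blast
  define g where "g = f ^ (p ^ K)"
  have g: "Frob 1 g = g ^ p" using K by (simp only: g_def)
  obtain L where L: "\<And>e. card (jumps e g \<inter> {..<p ^ e}) \<le> L"
    using card_jumps_le[OF len] by blast
  define B where "B i j = int p ^ (j - i) - 1" for i j :: nat
  define A where "A i j = int p ^ (j - i) * \<alpha> (K + i) - \<alpha> (K + j)" for i j :: nat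
  have pair: "\<exists>i j. i < j \<and> j \<le> L \<and> int p ^ k dvd B i j * \<alpha> k - A i j" if "k \<ge> K" for k
  proof -
    \<comment> \<open>each of the \<open>L\<close> divisions by \<open>p\<close> below costs one level\<close>
    obtain \<nu> where \<nu>: "\<nu> \<in> jumps (k + L) f" "int \<nu> mod int p ^ (k + L) = \<alpha> (k + L)"
      using jumps by blast
    have \<nu>_mod: "int (\<nu> mod p ^ j) = \<alpha> j" if "j \<le> k + L" for j
    proof -
      have "int (\<nu> mod p ^ j) = (int \<nu> mod int p ^ (k + L)) mod int p ^ j"
        using that by (simp add: mod_mod_cancel le_imp_power_dvd of_nat_mod)
      then show ?thesis using padic_int_mod[OF \<alpha> that] \<nu>(2) by simp
    qed
    define s where "s i = (\<nu> div p ^ (K + i)) mod p ^ k" for i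
    have "s i \<in> jumps k g \<inter> {..<p ^ k}" if "i \<le> L" for i
    proof -
      have "\<nu> div p ^ K \<in> jumps (k + L) g"
        unfolding g_def using \<nu>(1) p_pos by (intro jumps_power_div) simp_all
      then have "\<nu> div p ^ K \<in> jumps ((k + L - i) + i) g" using that by simp
      then have "\<nu> div p ^ K div p ^ i \<in> jumps (k + L - i) g"
        by (rule jumps_shift[OF g])
      moreover have "k \<le> k + L - i" using that by linarith
      ultimately have "\<nu> div p ^ K div p ^ i \<in> jumps k g"
        using jumps_antimono by blast
      then have "\<nu> div p ^ (K + i) \<in> jumps k g"
        by (simp add: div_mult2_eq power_add)
      then have "s i \<in> jumps k g"
        unfolding s_def using p_pos by (intro jumps_mod[of k g] Frob_iterate g) auto
      then show ?thesis using p_pos by (simp add: s_def)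
    qed
    then have "s ` {..L} \<subseteq> jumps k g \<inter> {..<p ^ k}" by auto
    then have "card (s ` {..L}) \<le> card (jumps k g \<inter> {..<p ^ k})" by (intro card_mono) auto
    also have "\<dots> < card {..L}" using L[of k] by simp
    finally have "\<not> inj_on s {..L}" by (rule pigeonhole)
    then obtain i' j' where ij': "i' \<le> L" "j' \<le> L" "s i' = s j'" "i' \<noteq> j'"
      unfolding inj_on_def by auto
    define i j where "i = min i' j'" and "j = max i' j'"
    have ij: "i < j" "j \<le> L" "s i = s j"
      using ij' by (auto simp: i_def j_def min_def max_def)
    have "int p ^ k dvd B i j * int \<nu> - A i j"
      using shifted_digits_congruence[of p "K + i" "K + j" \<nu> k] p_pos ij that
      by (simp add: s_def \<nu>_mod A_def B_def)
    moreover have "\<alpha> k = int \<nu> mod int p ^ k"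
      using \<nu>_mod[of k] by (simp add: of_nat_mod)
    then have "int p ^ k dvd int \<nu> - \<alpha> k"
      by (simp add: dvd_minus_mod)
    then have "int p ^ k dvd B i j * (int \<nu> - \<alpha> k)" by (rule dvd_mult)
    ultimately have "int p ^ k dvd (B i j * int \<nu> - A i j) - B i j * (int \<nu> - \<alpha> k)" by (rule dvd_diff)
    also have "\<dots> = B i j * \<alpha> k - A i j" by (simp add: algebra_simps)
    finally show ?thesis using ij by blast
  qed
  have down: "int p ^ k dvd B i j * \<alpha> k - A i j"
    if "int p ^ k' dvd B i j * \<alpha> k' - A i j" "k \<le> k'" for i j k k'
  proof -
    have "int p ^ k dvd \<alpha> k' - \<alpha> k"
      using padic_int_mod[OF \<alpha> that(2)] dvd_minus_mod[of "int p ^ k" "\<alpha> k'"] by simp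
    then have "int p ^ k dvd (B i j * \<alpha> k' - A i j) - B i j * (\<alpha> k' - \<alpha> k)"
      by (intro dvd_diff[OF dvd_trans[OF le_imp_power_dvd[OF that(2)] that(1)]] dvd_mult)
    then show ?thesis by (simp add: algebra_simps)
  qed
  have "\<exists>i j. i < j \<and> (\<forall>k. int p ^ k dvd B i j * \<alpha> k - A i j)"
  proof (rule ccontr)
    assume "\<not> ?thesis"
    then have "\<forall>i j. \<exists>k. i < j \<longrightarrow> \<not> int p ^ k dvd B i j * \<alpha> k - A i j" by simp
    then obtain k where k: "\<And>i j. i < j \<Longrightarrow> \<not> int p ^ k i j dvd B i j * \<alpha> (k i j) - A i j"
      unfolding choice_iff by blast
    \<comment> \<open>an upper bound for all the failing exponents of the finitely many pairs\<close>
    define k' where "k' = K + (\<Sum>i\<le>L. \<Sum>j\<le>L. k i j)"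
    obtain i j where ij: "i < j" "j \<le> L" "int p ^ k' dvd B i j * \<alpha> k' - A i j"
      using pair[of k'] by (auto simp: k'_def)
    have "k i j \<le> (\<Sum>j\<le>L. k i j)" using ij by (intro member_le_sum) auto
    also have "\<dots> \<le> (\<Sum>i\<le>L. \<Sum>j\<le>L. k i j)"
      using ij by (intro member_le_sum[of i _ "\<lambda>i. \<Sum>j\<le>L. k i j"]) auto
    finally have "k i j \<le> k'" by (simp add: k'_def)
    then show False using down[OF ij(3)] k[OF ij(1)] by blast
  qed
  then obtain i j where ij: "i < j" "\<And>k. int p ^ k dvd B i j * \<alpha> k - A i j" by blast
  have p1: "int p > 1" using prime_gt_1_nat[OF prime_p] by simp
  have "\<not> int p dvd B i j"
  proof
    assume "int p dvd B i j"
    moreover have "int p dvd int p ^ (j - i)" using ij(1) by simp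
    ultimately have "int p dvd int p ^ (j - i) - B i j" by (rule dvd_diff[rotated])
    then show False using p1 by (simp add: B_def)
  qed
  moreover have "B i j > 0" unfolding B_def using p1 ij(1) by simp
  ultimately show ?thesis using padic_rationalsI[OF \<alpha> prime_p] ij(2) by blast
qed

end


section \<open>The action of differential operators on localizations\<close>

lemma Frac_mult:
  "nonzerodivisor b \<Longrightarrow> nonzerodivisor d \<Longrightarrow> Frac a b * Frac c d = Frac (a * c) (b * d)"
  by transfer (simp add: frac_rel_def nonzerodivisor_mult)

lemma Frac_add:
  "nonzerodivisor b \<Longrightarrow> nonzerodivisor d \<Longrightarrow> Frac a b + Frac c d = Frac (a * d + c * b) (b * d)"
  by transfer (simp add: frac_rel_def nonzerodivisor_mult)

lemma Frac_uminus: "- Frac a b = Frac (- a) b"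
  by transfer (auto simp: frac_rel_def)

lemma Frac_0: "Frac 0 b = 0"
  by transfer (auto simp: frac_rel_def)

lemma Frac_inverse: "nonzerodivisor s \<Longrightarrow> Frac 1 s * Frac s 1 = 1"
proof -
  assume s: "nonzerodivisor s"
  have "Frac 1 s * Frac s 1 = Frac 1 1" by (simp add: s Frac_mult Frac_eq_iff)
  also have "\<dots> = 1" by transfer (simp add: frac_rel_def)
  finally show ?thesis .
qed

lemma poly_algebra_map_hom:
  "unital_ring_hom c \<Longrightarrow> unital_ring_hom (poly_algebra_map c)"
  by (simp add: unital_ring_hom_def poly_algebra_map_def one_pCons)

lemma nonzerodivisor_power: "nonzerodivisor s \<Longrightarrow> nonzerodivisor (s ^ k)"
  by (induction k) (simp_all add: nonzerodivisor_mult)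

lemma nonzerodivisor_const_poly:
  assumes "nonzerodivisor f"
  shows "nonzerodivisor [:f:]"
  unfolding nonzerodivisor_def
proof (intro allI impI)
  fix g assume "[:f:] * g = 0"
  then have "coeff ([:f:] * g) i = 0" for i by (simp only: coeff_0)
  then have "f * coeff g i = 0" for i by simp
  then show "g = 0" using assms by (intro poly_eqI) (simp add: nonzerodivisor_def)
qed

text \<open>Ensures that \<open>f - t\<close> and \<open>f\<^sup>Q - t\<^sup>Q\<close> may be inverted in the total ring of fractions of \<open>R[t]\<close>.\<close>

lemma nonzerodivisor_unit_lead_coeff:
  assumes "lead_coeff s dvd 1"
  shows "nonzerodivisor (s :: 'r::comm_ring_1 poly)"
  unfolding nonzerodivisor_def
proof (intro allI impI)
  fix g assume g: "s * g = 0"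
  obtain u where u: "1 = lead_coeff s * u" using assms by (elim dvdE)
  have "lead_coeff s * lead_coeff g = 0"
    using coeff_mult_degree_sum[of s g] g by simp
  then have "u * (lead_coeff s * lead_coeff g) = 0" by simp
  then have "lead_coeff g = 0" using u by (metis mult.assoc mult.commute mult_1)
  then show "g = 0" by simp
qed

text \<open>Fixes an action as in the definition of the roots; \<open>L\<close> and \<open>Lf\<close> below are
  \<open>R[t, f\<^sup>-\<^sup>1, (f - t)\<^sup>-\<^sup>1]\<close> and \<open>R[t, f\<^sup>-\<^sup>1]\<close>.\<close>

locale localized_action =
  fixes c :: "'v::comm_ring_1 \<Rightarrow> 'r::comm_ring_1" and f :: 'r
    and act :: "('r poly \<Rightarrow> 'r poly) \<Rightarrow> 'r poly total_frac \<Rightarrow> 'r poly total_frac"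
  assumes c_hom: "unital_ring_hom c" and f: "nonzerodivisor f"
    and act: "extends_diff_op_action (poly_algebra_map c) (loc_f_ft f) act"
begin

abbreviation "D \<equiv> diff_ops (poly_algebra_map c)"
abbreviation "D0 \<equiv> diff_ops_deg0 c"
abbreviation "L \<equiv> loc_f_ft f"
abbreviation "Lf \<equiv> loc_f f"

lemma map_hom: "unital_ring_hom (poly_algebra_map c)"
  by (rule poly_algebra_map_hom[OF c_hom])

lemma act_closed: "\<delta> \<in> D \<Longrightarrow> z \<in> L \<Longrightarrow> act \<delta> z \<in> L"
  and act_add_right: "\<delta> \<in> D \<Longrightarrow> z \<in> L \<Longrightarrow> z' \<in> L \<Longrightarrow> act \<delta> (z + z') = act \<delta> z + act \<delta> z'"
  and act_add_left: "\<delta> \<in> D \<Longrightarrow> \<epsilon> \<in> D \<Longrightarrow> z \<in> L \<Longrightarrow> act (\<lambda>y. \<delta> y + \<epsilon> y) z = act \<delta> z + act \<epsilon> z"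
  and act_comp: "\<delta> \<in> D \<Longrightarrow> \<epsilon> \<in> D \<Longrightarrow> z \<in> L \<Longrightarrow> act (\<delta> \<circ> \<epsilon>) z = act \<delta> (act \<epsilon> z)"
  and act_mult: "z \<in> L \<Longrightarrow> act (\<lambda>y. s * y) z = Frac s 1 * z"
  and act_Frac: "\<delta> \<in> D \<Longrightarrow> act \<delta> (Frac s 1) = Frac (\<delta> s) 1"
  using act unfolding extends_diff_op_action_def by simp_all

lemma nz_f: "nonzerodivisor ([:f:] ^ i)"
  by (intro nonzerodivisor_power nonzerodivisor_const_poly f)

lemma nz_ft: "nonzerodivisor [:f, -1:]"
  by (rule nonzerodivisor_unit_lead_coeff) simp

lemma Frac_f_in_Lf: "Frac g ([:f:] ^ i) \<in> Lf"
  unfolding loc_f_def by blast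

lemma Frac_one_in_Lf: "Frac g 1 \<in> Lf"
  using Frac_f_in_Lf[of g 0] by simp

lemma Lf_add: "z \<in> Lf \<Longrightarrow> z' \<in> Lf \<Longrightarrow> z + z' \<in> Lf"
proof -
  assume "z \<in> Lf" "z' \<in> Lf"
  then obtain g i g' i' where "z = Frac g ([:f:] ^ i)" "z' = Frac g' ([:f:] ^ i')"
    unfolding loc_f_def by blast
  then show "z + z' \<in> Lf"
    by (simp only: Frac_add[OF nz_f nz_f] power_add[symmetric] Frac_f_in_Lf)
qed

lemma Lf_mult: "z \<in> Lf \<Longrightarrow> z' \<in> Lf \<Longrightarrow> z * z' \<in> Lf"
proof -
  assume "z \<in> Lf" "z' \<in> Lf"
  then obtain g i g' i' where "z = Frac g ([:f:] ^ i)" "z' = Frac g' ([:f:] ^ i')"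
    unfolding loc_f_def by blast
  then show "z * z' \<in> Lf"
    by (simp only: Frac_mult[OF nz_f nz_f] power_add[symmetric] Frac_f_in_Lf)
qed

lemma Lf_uminus: "z \<in> Lf \<Longrightarrow> - z \<in> Lf"
  unfolding loc_f_def by (auto simp: Frac_uminus) blast

lemma Lf_diff: "z \<in> Lf \<Longrightarrow> z' \<in> Lf \<Longrightarrow> z - z' \<in> Lf"
  using Lf_add[of z "- z'"] Lf_uminus[of z'] by simp

lemma Lf_zero: "0 \<in> Lf"
  using Frac_one_in_Lf[of 0] by (simp add: Frac_0)

lemma Lf_subset: "Lf \<subseteq> L"
proof
  fix z assume "z \<in> Lf"
  then obtain g i where "z = Frac g ([:f:] ^ i * [:f, -1:] ^ 0)"
    unfolding loc_f_def by auto
  then show "z \<in> L" unfolding loc_f_ft_def by blast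
qed

text \<open>For \<open>z = g / s\<close> with \<open>s\<close> a power of \<open>f\<close>, \<open>s (\<delta> z) = \<delta> (s z) - (ad s \<delta>) z = \<delta> g - (ad s \<delta>) z\<close>,
  and \<open>ad s \<delta>\<close> has smaller order.\<close>

lemma act_Lf:
  assumes "\<delta> \<in> D" "z \<in> Lf"
  shows "act \<delta> z \<in> Lf"
proof -
  obtain g i where z: "z = Frac g ([:f:] ^ i)" using assms(2) unfolding loc_f_def by blast
  have zL: "z \<in> L" using assms(2) Lf_subset by blast
  let ?s = "[:f:] ^ i"
  have sz: "Frac ?s 1 * z = Frac g 1"
    using nz_f[of i] by (simp add: z Frac_mult Frac_eq_iff mult.commute)
  obtain k where "ad_order UNIV k \<delta>" using assms(1) diff_ops_iff_ad_order[OF map_hom] by blast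
  then show ?thesis using assms(1)
  proof (induction k arbitrary: \<delta>)
    case 0
    then have "\<delta> = (\<lambda>y. 0 * y)" by simp
    then have "act \<delta> z = Frac 0 1 * z" using act_mult[OF zL, of 0] by simp
    then show ?case by (simp add: Frac_0 Lf_zero)
  next
    case (Suc k)
    have ad: "ad ?s \<delta> \<in> D" by (rule diff_ops_ad[OF map_hom Suc.prems(2)])
    have m: "(\<lambda>y. ?s * y) \<in> D" by (rule diff_ops_mult[OF map_hom])
    have adz: "act (ad ?s \<delta>) z \<in> Lf" using Suc.IH[OF _ ad] Suc.prems(1) by simp
    have "\<delta> \<circ> (\<lambda>y. ?s * y) = (\<lambda>y. ((\<lambda>y. ?s * y) \<circ> \<delta>) y + ad ?s \<delta> y)"
      by (simp add: ad_def fun_eq_iff)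
    then have "act (\<delta> \<circ> (\<lambda>y. ?s * y)) z = act ((\<lambda>y. ?s * y) \<circ> \<delta>) z + act (ad ?s \<delta>) z"
      by (simp only: act_add_left[OF diff_ops_comp[OF map_hom m Suc.prems(2)] ad zL])
    moreover have "act (\<delta> \<circ> (\<lambda>y. ?s * y)) z = Frac (\<delta> g) 1"
      by (simp only: act_comp[OF Suc.prems(2) m zL] act_mult[OF zL] sz act_Frac[OF Suc.prems(2)])
    moreover have "act ((\<lambda>y. ?s * y) \<circ> \<delta>) z = Frac ?s 1 * act \<delta> z"
      by (simp only: act_comp[OF m Suc.prems(2) zL] act_mult[OF act_closed[OF Suc.prems(2) zL]])
    ultimately have "Frac ?s 1 * act \<delta> z = Frac (\<delta> g) 1 - act (ad ?s \<delta>) z"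
      by (simp add: algebra_simps)
    then have "Frac ?s 1 * act \<delta> z \<in> Lf" using adz by (simp add: Lf_diff Frac_one_in_Lf)
    then have "Frac 1 ?s * (Frac ?s 1 * act \<delta> z) \<in> Lf" using Frac_f_in_Lf Lf_mult by blast
    then show ?case by (simp add: mult.assoc[symmetric] Frac_inverse nz_f)
  qed
qed

end


section \<open>The module \<open>N\<^sub>f\<close> and its localizations\<close>

definition coeffwise :: "(nat \<Rightarrow> 'r \<Rightarrow> 'r) \<Rightarrow> 'r::comm_ring_1 poly \<Rightarrow> 'r poly" where
  "coeffwise d g = (\<Sum>a\<le>degree g. monom (d a (coeff g a)) a)"

lemma coeff_coeffwise:
  assumes "\<And>a. d a 0 = 0"
  shows "coeff (coeffwise d g) a = d a (coeff g a)"
proof -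
  have "coeff (coeffwise d g) a = (\<Sum>i\<le>degree g. if i = a then d a (coeff g a) else 0)"
    unfolding coeffwise_def coeff_sum by (intro sum.cong) auto
  then show ?thesis by (auto simp: assms coeff_eq_0)
qed

lemma cont_fn_op_coeffwise:
  "cont_fn_op p c \<phi> = coeffwise (\<lambda>a r. c (\<phi> (padic_of_int p (- 1 - int a))) * r)"
  by (simp add: cont_fn_op_def coeffwise_def fun_eq_iff)

lemma coeff_cont_fn_op:
  "coeff (cont_fn_op p c \<phi> g) a = c (\<phi> (padic_of_int p (- 1 - int a))) * coeff g a"
  unfolding cont_fn_op_coeffwise by (simp add: coeff_coeffwise)

context localized_action
begin

lemma D0_D: "\<delta> \<in> D0 \<Longrightarrow> \<delta> \<in> D"
  by (simp add: diff_ops_deg0_def)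

lemma D0_monom:
  assumes "\<delta> \<in> D0"
  shows "\<delta> (monom r a) = monom (coeff (\<delta> (monom r a)) a) a"
proof -
  obtain r' where "\<delta> (monom r a) = monom r' a" using assms by (auto simp: diff_ops_deg0_def)
  then show ?thesis by simp
qed

lemma coeff_D0:
  assumes "\<delta> \<in> D0"
  shows "coeff (\<delta> g) a = coeff (\<delta> (monom (coeff g a) a)) a"
proof -
  note add = diff_opsD(1)[OF D0_D[OF assms]]
  have zero: "\<delta> 0 = 0" by (rule additive_zero[of \<delta>, OF add])
  have "\<delta> g = \<delta> (\<Sum>i\<le>degree g. monom (coeff g i) i)"
    by (simp only: poly_as_sum_of_monoms)
  also have "\<dots> = (\<Sum>i\<le>degree g. \<delta> (monom (coeff g i) i))"
    by (rule additive_sum[of \<delta>, OF add])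
  finally have "coeff (\<delta> g) a = (\<Sum>i\<le>degree g. coeff (\<delta> (monom (coeff g i) i)) a)"
    by (simp add: coeff_sum)
  also have "\<dots> = (\<Sum>i\<le>degree g. if i = a then coeff (\<delta> (monom (coeff g a) a)) a else 0)"
    by (intro sum.cong refl, subst D0_monom[OF assms]) auto
  finally show ?thesis by (auto simp: zero coeff_eq_0)
qed

lemma cont_fn_op_commute:
  assumes "\<delta> \<in> D0"
  shows "cont_fn_op p c \<phi> \<circ> \<delta> = \<delta> \<circ> cont_fn_op p c \<phi>"
proof
  fix g
  have "coeff (\<delta> (cont_fn_op p c \<phi> g)) a = coeff (cont_fn_op p c \<phi> (\<delta> g)) a" for a
  proof -
    let ?v = "\<phi> (padic_of_int p (- 1 - int a))"
    have "monom (c ?v * coeff g a) a = poly_algebra_map c ?v * monom (coeff g a) a"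
      by (simp add: poly_algebra_map_def smult_monom)
    then have "\<delta> (monom (c ?v * coeff g a) a) = poly_algebra_map c ?v * \<delta> (monom (coeff g a) a)"
      by (simp only: diff_opsD(2)[OF D0_D[OF assms]])
    then show ?thesis
      using coeff_D0[OF assms, of "cont_fn_op p c \<phi> g" a] coeff_D0[OF assms, of g a]
      by (simp add: coeff_cont_fn_op poly_algebra_map_def)
  qed
  then show "(cont_fn_op p c \<phi> \<circ> \<delta>) g = (\<delta> \<circ> cont_fn_op p c \<phi>) g"
    by (intro poly_eqI) simp
qed

definition mult_f :: "'r poly \<Rightarrow> 'r poly" where
  "mult_f = (\<lambda>g. [:f:] * g)"

lemma D0_mult: "(\<lambda>g. [:r:] * g) \<in> D0"
  using diff_ops_mult[OF map_hom, of "[:r:]"] by (auto simp: diff_ops_deg0_def smult_monom)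

lemma D0_comp:
  assumes "\<delta> \<in> D0" "\<epsilon> \<in> D0"
  shows "\<delta> \<circ> \<epsilon> \<in> D0"
proof -
  have "\<exists>r'. (\<delta> \<circ> \<epsilon>) (monom r a) = monom r' a" for r a
    using D0_monom[OF assms(2), of r a] D0_monom[OF assms(1)] by (metis comp_apply)
  then show ?thesis
    using diff_ops_comp[OF map_hom D0_D[OF assms(1)] D0_D[OF assms(2)]] by (simp add: diff_ops_deg0_def)
qed

lemma D0_add:
  assumes "\<delta> \<in> D0" "\<epsilon> \<in> D0"
  shows "(\<lambda>g. \<delta> g + \<epsilon> g) \<in> D0"
proof -
  have "\<exists>r'. \<delta> (monom r a) + \<epsilon> (monom r a) = monom r' a" for r a
    using D0_monom[OF assms(1), of r a] D0_monom[OF assms(2), of r a] by (metis add_monom)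
  then show ?thesis
    using diff_ops_add[OF map_hom D0_D[OF assms(1)] D0_D[OF assms(2)]] by (simp add: diff_ops_deg0_def)
qed

lemma D0_zero: "(\<lambda>_. 0) \<in> D0"
  using D0_mult[of 0] by simp

lemma D0_uminus: "\<delta> \<in> D0 \<Longrightarrow> (\<lambda>g. - \<delta> g) \<in> D0"
  using D0_comp[OF D0_mult[of "-1"], of \<delta>] by (simp add: comp_def)

lemma mult_f_D0: "mult_f \<in> D0"
  unfolding mult_f_def by (rule D0_mult)

definition inv_f_minus_t :: "'r poly total_frac" where
  "inv_f_minus_t = Frac 1 [:f, -1:]"

lemma inv_f_minus_t_in_L: "inv_f_minus_t \<in> L"
proof -
  have "inv_f_minus_t = Frac 1 ([:f:] ^ 0 * [:f, -1:] ^ 1)" by (simp add: inv_f_minus_t_def)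
  then show ?thesis unfolding loc_f_ft_def by blast
qed

text \<open>The element \<open>\<delta> \<cdot> \<delta>\<^sub>0\<close> of \<open>H\<^sub>f\<close> (see \<open>H_act_delta0_mult\<close> and \<open>delta0_mult_id\<close>).\<close>

definition delta0_mult :: "('r poly \<Rightarrow> 'r poly) \<Rightarrow> 'r poly total_frac set" where
  "delta0_mult \<delta> = act \<delta> inv_f_minus_t +o Lf"

lemma Lf_plus_Lf: "Lf + Lf = Lf"
proof
  show "Lf + Lf \<subseteq> Lf" by (auto elim!: set_plus_elim intro: Lf_add)
  show "Lf \<subseteq> Lf + Lf" using set_plus_intro[OF _ Lf_zero] by fastforce
qed

lemma act_zero:
  assumes "\<delta> \<in> D"
  shows "act \<delta> 0 = 0"
proof -
  have "\<delta> 0 = 0" by (rule additive_zero) (rule diff_opsD(1)[OF assms])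
  then show ?thesis using act_Frac[OF assms, of 0] by (simp add: Frac_0)
qed

lemma H_act_coset:
  assumes \<delta>: "\<delta> \<in> D" and z: "z \<in> L"
  shows "H_act f act \<delta> (z +o Lf) = act \<delta> z +o Lf"
proof -
  have "act \<delta> ` (z +o Lf) = act \<delta> z +o act \<delta> ` Lf"
  proof -
    have "act \<delta> (z + l) = act \<delta> z + act \<delta> l" if "l \<in> Lf" for l
      using act_add_right[OF \<delta> z] Lf_subset that by blast
    moreover have "a +o B = (\<lambda>b. a + b) ` B" for a :: "'r poly total_frac" and B
      by (auto simp: elt_set_plus_def)
    ultimately show ?thesis by (simp add: image_image)
  qed
  moreover have "act \<delta> ` Lf + Lf = Lf"
  proof
    show "act \<delta> ` Lf + Lf \<subseteq> Lf"
      using act_Lf[OF \<delta>] by (auto elim!: set_plus_elim intro: Lf_add)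
    have "act \<delta> 0 \<in> act \<delta> ` Lf" by (rule imageI[OF Lf_zero])
    then have "0 \<in> act \<delta> ` Lf" by (simp only: act_zero[OF \<delta>])
    from set_plus_intro[OF this] show "Lf \<subseteq> act \<delta> ` Lf + Lf" by auto
  qed
  ultimately show ?thesis
    unfolding H_act_def quotient_act_def by (simp add: set_plus_rearrange3)
qed

lemma H_act_delta0_mult: "\<epsilon> \<in> D0 \<Longrightarrow> \<delta> \<in> D0 \<Longrightarrow> H_act f act \<epsilon> (delta0_mult \<delta>) = delta0_mult (\<epsilon> \<circ> \<delta>)"
  unfolding delta0_mult_def by (simp add: H_act_coset D0_D act_closed inv_f_minus_t_in_L act_comp)

lemma delta0_mult_add:
  assumes "\<delta> \<in> D0" "\<epsilon> \<in> D0"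
  shows "delta0_mult \<delta> + delta0_mult \<epsilon> = delta0_mult (\<lambda>g. \<delta> g + \<epsilon> g)"
  unfolding delta0_mult_def act_add_left[OF D0_D[OF assms(1)] D0_D[OF assms(2)] inv_f_minus_t_in_L]
  by (simp only: set_plus_rearrange Lf_plus_Lf)

lemma act_id: "z \<in> L \<Longrightarrow> act (\<lambda>g. g) z = z"
proof -
  assume "z \<in> L"
  then have "act (\<lambda>g. 1 * g) z = Frac 1 1 * z" by (rule act_mult)
  moreover have "(Frac 1 1 :: 'r poly total_frac) = 1" by transfer (simp add: frac_rel_def)
  ultimately show ?thesis by simp
qed

lemma delta0_mult_id: "delta0 f = delta0_mult (\<lambda>g. g)"
  unfolding delta0_def delta0_mult_def by (simp add: act_id inv_f_minus_t_in_L inv_f_minus_t_def[symmetric])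

lemma id_D0: "(\<lambda>g. g) \<in> D0"
  using D0_mult[of 1] by simp

lemma D0_delta0_eq: "D0_delta0 c f act = delta0_mult ` D0"
proof -
  have "H_act f act \<delta> (delta0 f) = delta0_mult \<delta>" if "\<delta> \<in> D0" for \<delta>
    unfolding delta0_mult_id by (simp add: H_act_delta0_mult that id_D0 comp_def)
  then show ?thesis unfolding D0_delta0_def by auto
qed

lemma D0_f_delta0_eq: "D0_f_delta0 c f act = (\<lambda>\<epsilon>. delta0_mult (\<epsilon> \<circ> mult_f)) ` D0"
proof -
  have *: "H_act f act \<delta> (H_act f act (\<lambda>g. [:f:] * g) (delta0 f)) = delta0_mult (\<delta> \<circ> mult_f)" if "\<delta> \<in> D0" for \<delta>
  proof -
    have "H_act f act mult_f (delta0 f) = delta0_mult mult_f"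
      unfolding delta0_mult_id H_act_delta0_mult[OF mult_f_D0 id_D0] by (simp add: comp_def)
    then show ?thesis
      unfolding mult_f_def[symmetric] by (simp only: H_act_delta0_mult[OF that mult_f_D0])
  qed
  show ?thesis
    unfolding D0_f_delta0_def Setcompr_eq_image by (rule image_cong) (simp_all only: *)
qed

text \<open>The class of \<open>\<delta> \<cdot> \<delta>\<^sub>0\<close> in \<open>N\<^sub>f\<close>.\<close>

definition N_class :: "('r poly \<Rightarrow> 'r poly) \<Rightarrow> 'r poly total_frac set set" where
  "N_class \<delta> = delta0_mult \<delta> +o D0_f_delta0 c f act"

lemma N_class_eq: "\<delta> \<in> D0 \<Longrightarrow> N_class \<delta> = (\<lambda>\<epsilon>. delta0_mult (\<lambda>g. \<delta> g + \<epsilon> (mult_f g))) ` D0"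
  unfolding N_class_def D0_f_delta0_eq elt_set_plus_def
  by (auto simp: delta0_mult_add D0_comp mult_f_D0 image_iff)

lemma N_module_eq: "N_module c f act = N_class ` D0"
  unfolding N_module_def N_class_def D0_delta0_eq by auto

lemma D0_f_delta0_N: "D0_f_delta0 c f act = N_class (\<lambda>_. 0)"
  unfolding N_class_eq[OF D0_zero] D0_f_delta0_eq by (simp add: comp_def)

lemma N_class_mult_f:
  assumes "\<eta> \<in> D0" "\<delta> \<in> D0" "act \<delta> inv_f_minus_t = act (\<eta> \<circ> mult_f) inv_f_minus_t"
  shows "N_class \<delta> = N_class (\<lambda>_. 0)"
proof -
  have "delta0_mult \<delta> = delta0_mult (\<eta> \<circ> mult_f)" using assms(3) by (simp add: delta0_mult_def)
  then have "N_class \<delta> = N_class (\<eta> \<circ> mult_f)" by (simp add: N_class_def)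
  also have "\<dots> = (\<lambda>\<epsilon>. delta0_mult (\<lambda>g. \<eta> (mult_f g) + \<epsilon> (mult_f g))) ` D0"
    using N_class_eq[OF D0_comp[OF assms(1) mult_f_D0]] by simp
  also have "\<dots> = (\<lambda>\<epsilon>. delta0_mult (\<lambda>g. 0 + \<epsilon> (mult_f g))) ` D0"
  proof (intro equalityI image_subsetI)
    fix \<epsilon> assume \<epsilon>: "\<epsilon> \<in> D0"
    show "delta0_mult (\<lambda>g. \<eta> (mult_f g) + \<epsilon> (mult_f g)) \<in> (\<lambda>\<epsilon>. delta0_mult (\<lambda>g. 0 + \<epsilon> (mult_f g))) ` D0"
      by (rule image_eqI[OF _ D0_add[OF assms(1) \<epsilon>]]) simp
    show "delta0_mult (\<lambda>g. 0 + \<epsilon> (mult_f g)) \<in> (\<lambda>\<epsilon>. delta0_mult (\<lambda>g. \<eta> (mult_f g) + \<epsilon> (mult_f g))) ` D0"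
      by (rule image_eqI[OF _ D0_add[OF D0_uminus[OF assms(1)] \<epsilon>]]) simp
  qed
  also have "\<dots> = N_class (\<lambda>_. 0)" by (rule N_class_eq[OF D0_zero, symmetric])
  finally show ?thesis .
qed

lemma N_smul_N_class:
  assumes op: "cont_fn_op p c \<phi> \<in> D0" and \<delta>: "\<delta> \<in> D0"
  shows "N_smul p c f act \<phi> (N_class \<delta>) = N_class (cont_fn_op p c \<phi> \<circ> \<delta>)"
proof -
  let ?\<phi> = "cont_fn_op p c \<phi>"
  have Zsum: "H_act f act ?\<phi> (delta0_mult (\<lambda>g. \<delta> g + \<epsilon> (mult_f g))) + delta0_mult (\<zeta> \<circ> mult_f)
      = delta0_mult (\<lambda>g. ?\<phi> (\<delta> g) + (?\<phi> (\<epsilon> (mult_f g)) + \<zeta> (mult_f g)))"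
    if "\<epsilon> \<in> D0" "\<zeta> \<in> D0" for \<epsilon> \<zeta>
  proof -
    have 1: "(\<lambda>g. \<delta> g + \<epsilon> (mult_f g)) \<in> D0"
      using D0_add[OF \<delta> D0_comp[OF that(1) mult_f_D0]] by (simp add: comp_def)
    have "H_act f act ?\<phi> (delta0_mult (\<lambda>g. \<delta> g + \<epsilon> (mult_f g))) + delta0_mult (\<zeta> \<circ> mult_f)
        = delta0_mult (\<lambda>g. (?\<phi> \<circ> (\<lambda>g. \<delta> g + \<epsilon> (mult_f g))) g + (\<zeta> \<circ> mult_f) g)"
      unfolding H_act_delta0_mult[OF op 1] by (rule delta0_mult_add[OF D0_comp[OF op 1] D0_comp[OF that(2) mult_f_D0]])
    then show ?thesis by (simp add: diff_opsD(1)[OF D0_D[OF op]] add.assoc)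
  qed
  have "N_smul p c f act \<phi> (N_class \<delta>) =
      {X + Y |X Y. X \<in> H_act f act ?\<phi> ` N_class \<delta> \<and> Y \<in> D0_f_delta0 c f act}"
    unfolding N_smul_def quotient_act_def set_plus_def by auto
  also have "\<dots> = N_class (?\<phi> \<circ> \<delta>)"
  proof (intro equalityI subsetI)
    fix A assume "A \<in> {X + Y |X Y. X \<in> H_act f act ?\<phi> ` N_class \<delta> \<and> Y \<in> D0_f_delta0 c f act}"
    then obtain \<epsilon> \<zeta> where \<epsilon>: "\<epsilon> \<in> D0" and \<zeta>: "\<zeta> \<in> D0"
      and A: "A = H_act f act ?\<phi> (delta0_mult (\<lambda>g. \<delta> g + \<epsilon> (mult_f g))) + delta0_mult (\<zeta> \<circ> mult_f)"
      unfolding N_class_eq[OF \<delta>] D0_f_delta0_eq by blast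
    show "A \<in> N_class (?\<phi> \<circ> \<delta>)"
      unfolding N_class_eq[OF D0_comp[OF op \<delta>]] A Zsum[OF \<epsilon> \<zeta>]
      by (rule image_eqI[OF _ D0_add[OF D0_comp[OF op \<epsilon>] \<zeta>]]) simp
  next
    fix A assume "A \<in> N_class (?\<phi> \<circ> \<delta>)"
    then obtain \<zeta> where \<zeta>: "\<zeta> \<in> D0" "A = delta0_mult (\<lambda>g. ?\<phi> (\<delta> g) + \<zeta> (mult_f g))"
      unfolding N_class_eq[OF D0_comp[OF op \<delta>]] by auto
    have "?\<phi> 0 = 0" by (rule additive_zero) (rule diff_opsD(1)[OF D0_D[OF op]])
    then have "A = H_act f act ?\<phi> (delta0_mult (\<lambda>g. \<delta> g + (\<lambda>_. 0) (mult_f g))) + delta0_mult (\<zeta> \<circ> mult_f)"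
      unfolding Zsum[OF D0_zero \<zeta>(1)] \<zeta>(2) by simp
    moreover have "delta0_mult (\<lambda>g. \<delta> g + (\<lambda>_. 0) (mult_f g)) \<in> N_class \<delta>"
      unfolding N_class_eq[OF \<delta>] by (rule image_eqI[OF refl D0_zero])
    moreover have "delta0_mult (\<zeta> \<circ> mult_f) \<in> D0_f_delta0 c f act"
      unfolding D0_f_delta0_eq using \<zeta>(1) by (rule imageI)
    ultimately show "A \<in> {X + Y |X Y. X \<in> H_act f act ?\<phi> ` N_class \<delta> \<and> Y \<in> D0_f_delta0 c f act}"
      by blast
  qed
  finally show ?thesis .
qed

text \<open>Degree-zero operators commute with \<open>u\<close>, so \<open>u \<cdot> \<delta>\<^sub>0 \<in> (\<D>)\<^sub>0 f \<delta>\<^sub>0\<close> makes \<open>u\<close> annihilate the whole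
  cyclic module \<open>N\<^sub>f\<close>; and \<open>u\<close> becomes a unit in the localization at \<open>\<alpha>\<close>.\<close>

theorem localization_trivial:
  assumes ops: "\<And>\<phi>. \<phi> \<in> padic_cont_fns p \<Longrightarrow> cont_fn_op p c \<phi> \<in> D0"
    and u: "u \<in> padic_cont_fns p" "u \<alpha> \<notin> M" and one: "restrict (\<lambda>_. 1) (padic_int p) \<in> padic_cont_fns p - colon_ideal p M \<alpha>"
    and \<Delta>: "\<Delta> \<in> D0" "act (cont_fn_op p c u) inv_f_minus_t = act (\<Delta> \<circ> mult_f) inv_f_minus_t"
  shows "N_localized p M c f act \<alpha> = {N_localized_zero p M c f act \<alpha>}"
proof -
  let ?W = "padic_cont_fns p - colon_ideal p M \<alpha>" and ?N = "N_module c f act"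
    and ?smul = "N_smul p c f act"
  have uW: "u \<in> ?W" using u by (simp add: colon_ideal_def)
  have kill: "?smul u (?smul s X) = N_class (\<lambda>_. 0)" if "X \<in> ?N" "s \<in> ?W" for X s
  proof -
    let ?s = "cont_fn_op p c s" and ?u = "cont_fn_op p c u"
    obtain \<delta> where \<delta>: "\<delta> \<in> D0" "X = N_class \<delta>" using \<open>X \<in> ?N\<close> N_module_eq by auto
    have s: "?s \<in> D0" and uop: "?u \<in> D0" using ops that(2) u(1) by auto
    note s\<delta> = D0_comp[OF s \<delta>(1)]
    have "?smul u (?smul s X) = N_class (?u \<circ> (?s \<circ> \<delta>))"
      unfolding \<delta>(2) N_smul_N_class[OF s \<delta>(1)] N_smul_N_class[OF uop s\<delta>] ..
    also have "?u \<circ> (?s \<circ> \<delta>) = (?s \<circ> \<delta>) \<circ> ?u" by (rule cont_fn_op_commute[OF s\<delta>])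
    also have "N_class ((?s \<circ> \<delta>) \<circ> ?u) = N_class (\<lambda>_. 0)"
    proof (rule N_class_mult_f[of "(?s \<circ> \<delta>) \<circ> \<Delta>"])
      show "(?s \<circ> \<delta>) \<circ> \<Delta> \<in> D0" "(?s \<circ> \<delta>) \<circ> ?u \<in> D0" by (intro D0_comp s\<delta> \<Delta>(1) uop)+
      show "act ((?s \<circ> \<delta>) \<circ> ?u) inv_f_minus_t = act (((?s \<circ> \<delta>) \<circ> \<Delta>) \<circ> mult_f) inv_f_minus_t"
        unfolding comp_assoc[of "?s \<circ> \<delta>" \<Delta>]
        by (simp only: act_comp[OF D0_D[OF s\<delta>] D0_D[OF uop] inv_f_minus_t_in_L] \<Delta>(2)
            act_comp[OF D0_D[OF s\<delta>] D0_D[OF D0_comp[OF \<Delta>(1) mult_f_D0]] inv_f_minus_t_in_L])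
    qed
    finally show ?thesis .
  qed
  let ?R = "localization_rel ?smul ?N ?W"
  have one_class: "?R `` {z} = ?N \<times> ?W" if z: "z \<in> ?N \<times> ?W" for z
  proof -
    have "(z, z') \<in> ?R" if z': "z' \<in> ?N \<times> ?W" for z'
    proof -
      obtain m s m' s' where eq: "z = (m, s)" "z' = (m', s')" by fastforce
      then have ms: "m \<in> ?N" "s \<in> ?W" "m' \<in> ?N" "s' \<in> ?W" using z z' by auto
      then have "?smul u (?smul s' m) = ?smul u (?smul s m')" by (simp only: kill)
      then show ?thesis using ms uW unfolding localization_rel_def eq by blast
    qed
    moreover have "z' \<in> ?N \<times> ?W" if "(z, z') \<in> ?R" for z'
      using that unfolding localization_rel_def by blast
    ultimately show ?thesis by blast
  qed
  have "D0_f_delta0 c f act \<in> ?N"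
    unfolding D0_f_delta0_N N_module_eq by (intro imageI D0_zero)
  then have zero: "(D0_f_delta0 c f act, restrict (\<lambda>_. 1) (padic_int p)) \<in> ?N \<times> ?W" using one by simp
  have "N_localized p M c f act \<alpha> = (\<Union>z\<in>?N \<times> ?W. {?R `` {z}})"
    by (simp only: N_localized_def localized_module_def quotient_def)
  also have "\<dots> = (\<Union>z\<in>?N \<times> ?W. {?N \<times> ?W})"
    by (intro SUP_cong refl) (simp only: one_class)
  also have "\<dots> = {?N \<times> ?W}" using zero by blast
  also have "?N \<times> ?W = N_localized_zero p M c f act \<alpha>"
    unfolding N_localized_zero_def by (rule one_class[OF zero, symmetric])
  finally show ?thesis .
qed

end


section \<open>Continuous functions as differential operators\<close>

lemma padic_int_cylinder_in_open:
  assumes "open U" "\<beta> \<in> U" "\<beta> \<in> padic_int p"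
  shows "\<exists>k. \<forall>\<gamma>\<in>padic_int p. \<gamma> k = \<beta> k \<longrightarrow> \<gamma> \<in> U"
proof -
  have "openin (product_topology (\<lambda>_. euclidean) UNIV) U"
    using assms(1) by (simp add: euclidean_product_topology)
  from product_topology_open_contains_basis[OF this assms(2)]
  obtain X where X: "\<beta> \<in> (\<Pi>\<^sub>E i\<in>UNIV. X i)" "finite {i. X i \<noteq> topspace euclidean}" "(\<Pi>\<^sub>E i\<in>UNIV. X i) \<subseteq> U"
    by blast
  let ?J = "{i. X i \<noteq> UNIV}"
  have J: "finite ?J" using X(2) by simp
  let ?k = "Max (insert 0 ?J)"
  have "\<gamma> \<in> U" if \<gamma>: "\<gamma> \<in> padic_int p" "\<gamma> ?k = \<beta> ?k" for \<gamma>
  proof -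
    have "\<gamma> i \<in> X i" for i
    proof (cases "i \<in> ?J")
      case True
      then have "i \<le> ?k" using J by (intro Max_ge) auto
      then have "\<gamma> i = \<beta> i"
        using padic_int_mod[OF \<gamma>(1), of i ?k] padic_int_mod[OF assms(3), of i ?k] \<gamma>(2) by simp
      then show ?thesis using X(1) by (simp add: PiE_iff)
    qed simp
    then show ?thesis using X(3) by (auto simp: PiE_iff)
  qed
  then show ?thesis by blast
qed

lemma compact_padic_int: "compact (padic_int p)"
proof -
  let ?P = "\<Pi>\<^sub>E k\<in>UNIV. {0..<int p ^ k}"
  have "compactin (product_topology (\<lambda>_. euclidean) (UNIV :: nat set)) ?P"
    unfolding compactin_PiE by (auto intro: finite_imp_compact)
  then have "compact ?P" by (simp add: euclidean_product_topology)
  moreover have "closed (\<Inter>k. {\<alpha> :: nat \<Rightarrow> int. \<alpha> (Suc k) mod int p ^ k = \<alpha> k})"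
  proof (intro closed_INT ballI closed_Collect_eq)
    fix k
    show "continuous_on UNIV (\<lambda>\<alpha> :: nat \<Rightarrow> int. \<alpha> (Suc k) mod int p ^ k)"
    proof (rule continuous_on_compose2[OF _ continuous_on_product_coordinates])
      show "continuous_on UNIV (\<lambda>z. z mod int p ^ k)"
        by (simp add: continuous_on_open_vimage open_discrete)
    qed simp
  qed simp
  ultimately have "compact (?P \<inter> (\<Inter>k. {\<alpha> :: nat \<Rightarrow> int. \<alpha> (Suc k) mod int p ^ k = \<alpha> k}))"
    by (rule compact_Int_closed)
  moreover have "?P \<inter> (\<Inter>k. {\<alpha> :: nat \<Rightarrow> int. \<alpha> (Suc k) mod int p ^ k = \<alpha> k}) = padic_int p"
    by (auto simp: padic_int_def PiE_iff)
  ultimately show ?thesis by simp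
qed

text \<open>Continuity gives a cylinder around each point on which \<open>\<phi>\<close> is constant; by compactness finitely
  many cylinders suffice.\<close>

lemma padic_cont_fn_locally_constant:
  assumes "\<phi> \<in> padic_cont_fns p"
  shows "\<exists>E. \<forall>\<beta>\<in>padic_int p. \<forall>\<gamma>\<in>padic_int p. \<beta> E = \<gamma> E \<longrightarrow> \<phi> \<beta> = \<phi> \<gamma>"
proof -
  let ?S = "padic_int p"
  have "\<exists>k. \<forall>\<gamma>\<in>?S. \<gamma> k = \<beta> k \<longrightarrow> \<phi> \<gamma> = \<phi> \<beta>" if "\<beta> \<in> ?S" for \<beta>
  proof -
    have "openin (top_of_set ?S) {\<gamma> \<in> ?S. \<phi> \<gamma> \<in> {\<phi> \<beta>}}"
      using assms openin_continuous_map_preimage[of "top_of_set ?S" "discrete_topology UNIV" \<phi> "{\<phi> \<beta>}"]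
      by (simp add: padic_cont_fns_def)
    then obtain U where U: "open U" "{\<gamma> \<in> ?S. \<phi> \<gamma> \<in> {\<phi> \<beta>}} = ?S \<inter> U"
      unfolding openin_open by blast
    then have "\<beta> \<in> U" using that by blast
    from padic_int_cylinder_in_open[OF U(1) this that] U(2) show ?thesis by blast
  qed
  then obtain k where k: "\<And>\<beta> \<gamma>. \<beta> \<in> ?S \<Longrightarrow> \<gamma> \<in> ?S \<Longrightarrow> \<gamma> (k \<beta>) = \<beta> (k \<beta>) \<Longrightarrow> \<phi> \<gamma> = \<phi> \<beta>"
    by metis
  have "open {\<gamma> :: nat \<Rightarrow> int. \<gamma> i = z}" for i z
  proof -
    have "open ((\<lambda>\<gamma> :: nat \<Rightarrow> int. \<gamma> i) -` {z})"
      by (intro open_vimage continuous_on_product_coordinates open_discrete)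
    then show ?thesis by (simp add: vimage_def)
  qed
  then obtain T where T: "T \<subseteq> ?S" "finite T" "?S \<subseteq> (\<Union>\<beta>\<in>T. {\<gamma>. \<gamma> (k \<beta>) = \<beta> (k \<beta>)})"
    by (rule compactE_image[OF compact_padic_int, of ?S "\<lambda>\<beta>. {\<gamma>. \<gamma> (k \<beta>) = \<beta> (k \<beta>)}" p]) auto
  let ?E = "Max (insert 0 (k ` T))"
  have "\<phi> \<gamma> = \<phi> \<gamma>'" if \<gamma>: "\<gamma> \<in> ?S" "\<gamma>' \<in> ?S" "\<gamma> ?E = \<gamma>' ?E" for \<gamma> \<gamma>'
  proof -
    obtain \<beta> where \<beta>: "\<beta> \<in> T" "\<gamma> (k \<beta>) = \<beta> (k \<beta>)" using T(3) \<gamma>(1) by blast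
    have "k \<beta> \<le> ?E" using \<beta>(1) T(2) by (intro Max_ge) auto
    then have "\<gamma>' (k \<beta>) = \<gamma> (k \<beta>)"
      using padic_int_mod[OF \<gamma>(1), of "k \<beta>" ?E] padic_int_mod[OF \<gamma>(2), of "k \<beta>" ?E] \<gamma>(3) by simp
    then have "\<phi> \<gamma> = \<phi> \<beta>" "\<phi> \<gamma>' = \<phi> \<beta>"
      using k[of \<beta>] \<beta> T(1) \<gamma> by auto
    then show ?thesis by simp
  qed
  then show ?thesis by blast
qed

lemma padic_of_int_in: "p > 0 \<Longrightarrow> padic_of_int p z \<in> padic_int p"
  by (auto simp: padic_int_def padic_of_int_def mod_mod_cancel le_imp_power_dvd)

lemma padic_cont_fn_cylinder:
  "restrict (\<lambda>\<beta>. h (\<beta> e)) (padic_int p) \<in> padic_cont_fns p"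
proof -
  have "continuous_map (top_of_set (padic_int p)) euclidean (\<lambda>\<beta> :: nat \<Rightarrow> int. \<beta> e)"
    using continuous_on_subset[OF continuous_on_product_coordinates] by simp
  then have "continuous_map (top_of_set (padic_int p)) (discrete_topology UNIV) (\<lambda>\<beta> :: nat \<Rightarrow> int. \<beta> e)"
    by (simp add: continuous_map_def open_openin[symmetric] open_discrete)
  moreover have "continuous_map (discrete_topology UNIV) (discrete_topology UNIV) h"
    by simp
  ultimately have "continuous_map (top_of_set (padic_int p)) (discrete_topology UNIV) (h \<circ> (\<lambda>\<beta>. \<beta> e))"
    by (rule continuous_map_compose)
  then have "continuous_map (top_of_set (padic_int p)) (discrete_topology UNIV)
      (restrict (\<lambda>\<beta>. h (\<beta> e)) (padic_int p))"
    by (rule continuous_map_eq) auto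
  then show ?thesis by (simp add: padic_cont_fns_def)
qed

context frobenius_lift
begin

abbreviation "poly_gens \<equiv> insert [:0, 1:] ((\<lambda>i. [:x i:]) ` {..<n})"

lemma generated_poly: "generated_algebra (poly_algebra_map c) poly_gens = UNIV"
proof -
  let ?A = "generated_algebra (poly_algebra_map c) poly_gens"
  have const: "[:r:] \<in> ?A" for r
  proof -
    have "r \<in> generated_algebra c (x ` {..<n})" by (simp add: generated)
    then show ?thesis
    proof induction
      case (const v)
      show ?case
        using generated_algebra.const[of "poly_algebra_map c" v] unfolding poly_algebra_map_def[of c v] .
    next
      case (generator s)
      then show ?case by (intro generated_algebra.generator) auto
    next
      case (add s t)
      then show ?case using generated_algebra.add[of "[:s:]" _ _ "[:t:]"] by simp
    next
      case (mult s t)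
      have "[:s * t:] = [:s:] * [:t:]" by simp
      then show ?case using mult.IH by (simp only: generated_algebra.mult)
    qed
  qed
  have "g \<in> ?A" for g
  proof (induction g)
    case 0
    then show ?case using const[of 0] by simp
  next
    case (pCons a g)
    have "[:a:] + [:0, 1:] * g \<in> ?A"
      by (intro generated_algebra.add generated_algebra.mult const pCons generated_algebra.generator) simp
    then show ?case by simp
  qed
  then show ?thesis by blast
qed

lemma poly_p_nilpotent: "nilpotent_elem (of_nat p :: 'r poly)"
proof -
  obtain m where "(of_nat p :: 'r) ^ m = 0" using p_nilpotent' by (auto simp: nilpotent_elem_def)
  moreover have "(of_nat p :: 'r poly) ^ m = [:of_nat p ^ m:]"
    by (simp add: of_nat_poly poly_const_pow)
  ultimately have "(of_nat p :: 'r poly) ^ m = 0" by simp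
  then show ?thesis unfolding nilpotent_elem_def by blast
qed

lemma level_ops_zero: "\<delta> \<in> level_ops e \<Longrightarrow> \<delta> 0 = 0"
  by (rule additive_zero) (rule level_opsD(1))

lemma level_ops_scale: "\<delta> \<in> level_ops e \<Longrightarrow> \<delta> (c v * r) = c v * \<delta> r"
  using level_opsD(2)[of \<delta> e "c ((inv F ^^ e) v)" r] by (simp add: Frob_c F_pow_inv)

text \<open>Periodicity in the exponent of \<open>t\<close> is linearity over \<open>t\<^sup>q\<close> with \<open>q = p\<^sup>e\<close>, so the operator is
  linear over \<open>V\<close> and over the \<open>q\<close>-th powers of all variables of \<open>R[t]\<close>.\<close>

lemma coeffwise_D0:
  assumes d: "\<And>a. d a \<in> level_ops e" and period: "\<And>a. d (a + p ^ e) = d a"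
  shows "coeffwise d \<in> diff_ops_deg0 c"
proof -
  note zero = level_ops_zero[OF d]
  have "coeffwise d \<in> linear_endos (poly_algebra_map c)"
    by (intro linear_endosI poly_algebra_map_hom c_hom poly_eqI)
      (simp_all add: coeff_coeffwise zero level_opsD[OF d] level_ops_scale[OF d] poly_algebra_map_def)
  moreover have "coeffwise d (y ^ (p ^ e) * g) = y ^ (p ^ e) * coeffwise d g" if "y \<in> poly_gens" for y g
  proof (cases "y = [:0, 1:]")
    case True
    have "coeff (coeffwise d (monom 1 (p ^ e) * g)) a = coeff (monom 1 (p ^ e) * coeffwise d g) a" for a
      using period[of "a - p ^ e"] by (cases "a < p ^ e") (simp_all add: coeff_coeffwise zero coeff_monom_mult)
    then show ?thesis unfolding True by (intro poly_eqI) (simp add: monom_altdef)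
  next
    case False
    then have "y \<in> (\<lambda>i. [:x i:]) ` {..<n}" using that by blast
    then obtain i where i: "i < n" "y = [:x i:]" by (elim imageE) simp
    have "y ^ (p ^ e) = [:Frob e (x i):]" using i by (simp add: poly_const_pow Frob_x)
    then show ?thesis
      by (intro poly_eqI) (simp add: coeff_coeffwise zero level_opsD[OF d])
  qed
  ultimately have "coeffwise d \<in> diff_ops (poly_algebra_map c)"
    using diff_ops_if_power_linear[OF poly_algebra_map_hom[OF c_hom] _ generated_poly prime_p poly_p_nilpotent, of "coeffwise d" e]
    by simp
  moreover have "coeffwise d (monom r a) = monom (d a r) a" for r a
    by (intro poly_eqI) (auto simp: coeff_coeffwise zero)
  ultimately show ?thesis unfolding diff_ops_deg0_def by blast
qed

lemma mult_in_level_ops: "(\<lambda>r. s * r) \<in> level_ops e"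
  by (rule level_opsI) (simp_all add: distrib_left mult.left_commute)

lemma cont_fn_op_D0:
  assumes "\<phi> \<in> padic_cont_fns p"
  shows "cont_fn_op p c \<phi> \<in> diff_ops_deg0 c"
proof -
  obtain E where E: "\<And>\<beta> \<gamma>. \<beta> \<in> padic_int p \<Longrightarrow> \<gamma> \<in> padic_int p \<Longrightarrow> \<beta> E = \<gamma> E \<Longrightarrow> \<phi> \<beta> = \<phi> \<gamma>"
    using padic_cont_fn_locally_constant[OF assms] by blast
  have "\<phi> (padic_of_int p (- 1 - int (a + p ^ E))) = \<phi> (padic_of_int p (- 1 - int a))" for a
  proof (intro E padic_of_int_in p_pos)
    have "(- 1 - int (a + p ^ E)) mod int p ^ E = (- 1 - int a) mod int p ^ E"
      by (simp add: mod_eq_dvd_iff)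
    then show "padic_of_int p (- 1 - int (a + p ^ E)) E = padic_of_int p (- 1 - int a) E"
      by (simp only: padic_of_int_def)
  qed
  then show ?thesis
    unfolding cont_fn_op_coeffwise by (intro coeffwise_D0[where e = E] mult_in_level_ops) simp
qed


section \<open>Roots are limits of jumps\<close>

text \<open>If \<open>f\<^sup>\<nu> \<in> D\<^sup>(\<^sup>e\<^sup>) f\<^sup>\<nu>\<^sup>+\<^sup>1\<close> for all \<open>\<nu> \<equiv> \<alpha>\<close> modulo \<open>p\<^sup>e\<close>, the witnessing operators, placed on the
  coefficients of \<open>t\<^sup>a\<close> with \<open>-1 - a \<equiv> \<alpha>\<close>, combine to a degree-zero operator \<open>\<Delta>\<close> for which
  \<open>\<Delta> f \<delta>\<^sub>0\<close> is \<open>\<delta>\<^sub>0\<close> multiplied by the indicator function of \<open>\<alpha> + p\<^sup>e \<int>\<^sub>p\<close>.\<close>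

lemma jumps_if_bernstein_sato_root:
  assumes f: "nonzerodivisor f" and root: "\<alpha> \<in> bernstein_sato_roots p M c f"
    and M: "1 \<notin> M"
  shows "\<exists>\<nu>\<in>jumps e f. int \<nu> mod int p ^ e = \<alpha> e"
proof (rule ccontr)
  assume no: "\<not> ?thesis"
  obtain act where act: "extends_diff_op_action (poly_algebra_map c) (loc_f_ft f) act"
    and nontrivial: "N_localized p M c f act \<alpha> \<noteq> {N_localized_zero p M c f act \<alpha>}"
    and \<alpha>: "\<alpha> \<in> padic_int p"
    using root unfolding bernstein_sato_roots_def by blast
  interpret localized_action c f act
    by (rule localized_action.intro[OF c_hom f act])
  obtain K where K: "Frob 1 (f ^ (p ^ K)) = (f ^ (p ^ K)) ^ p"
    using Frob_prime_power by blast
  define g where "g = f ^ (p ^ K)"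
  have g: "Frob e g = f ^ (p ^ (K + e))" for e
    using Frob_iterate[of g e] K by (simp add: g_def power_mult[symmetric] power_add)
  \<comment> \<open>\<open>f ^ P\<close> is a scalar at level \<open>e\<close>, so one operator per exponent modulo \<open>P\<close> suffices; the
     resulting operator on \<open>R[t]\<close> has period \<open>P\<close> and hence level \<open>K + e\<close>, where \<open>f ^ Q\<close> is a scalar\<close>
  define P where "P = p ^ (K + e)"
  define Q where "Q = p ^ (K + (K + e))"
  have P0: "P > 0" and Q0: "Q > 0" using p_pos by (simp_all add: P_def Q_def)
  have PQ: "P dvd Q" by (simp add: P_def Q_def le_imp_power_dvd)
  obtain \<delta> where \<delta>: "\<And>\<nu>. \<nu> \<notin> jumps e f \<Longrightarrow> \<delta> \<nu> \<in> level_ops e \<and> f ^ \<nu> = \<delta> \<nu> (f ^ Suc \<nu>)"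
  proof -
    have "\<exists>\<delta>. \<nu> \<notin> jumps e f \<longrightarrow> \<delta> \<in> level_ops e \<and> f ^ \<nu> = \<delta> (f ^ Suc \<nu>)" for \<nu>
      by (auto simp: jumps_def orbit_def)
    then have "\<forall>\<nu>. \<exists>\<delta>. \<nu> \<notin> jumps e f \<longrightarrow> \<delta> \<in> level_ops e \<and> f ^ \<nu> = \<delta> (f ^ Suc \<nu>)" ..
    then show ?thesis unfolding choice_iff using that by blast
  qed
  \<comment> \<open>the residue modulo \<open>P\<close> of the exponent of \<open>f\<close> that accompanies \<open>t\<^sup>a\<close> in \<open>G\<close> below\<close>
  define exponent where "exponent a = P - 1 - a mod P" for a
  define good where "good a \<longleftrightarrow> (- 1 - int a) mod int p ^ e = \<alpha> e" for a
  have exponent_mod: "int (exponent a) mod int p ^ e = (- 1 - int a) mod int p ^ e" for a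
  proof -
    have "int (exponent a) = int P - 1 - int (a mod P)"
      using mod_less_divisor[OF P0, of a] by (simp add: exponent_def)
    moreover have "int (a mod P) = int a - int P * int (a div P)"
      by (simp add: of_nat_mod of_nat_div minus_mult_div_eq_mod)
    ultimately have "int (exponent a) - (- 1 - int a) = int P * (1 + int (a div P))"
      by (simp add: algebra_simps)
    moreover have "int p ^ e dvd int P" by (simp add: P_def power_add)
    ultimately show ?thesis by (simp add: mod_eq_dvd_iff)
  qed
  define d where "d a = (if good a then \<delta> (exponent a) else (\<lambda>_. 0))" for a
  have d_level: "d a \<in> level_ops e" for a
  proof (cases "good a")
    case True
    then have "exponent a \<notin> jumps e f" using no exponent_mod[of a] by (auto simp: good_def)
    then show ?thesis using \<delta> True by (simp add: d_def)
  next
    case False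
    then show ?thesis by (simp add: d_def level_ops_def)
  qed
  then have d_level': "d a \<in> level_ops (K + e)" for a using level_ops_mono[of e "K + e"] by auto
  have exponent_period: "exponent (a + P) = exponent a" for a
    by (simp add: exponent_def)
  have good_period: "good (a + P) = good a" for a
    using exponent_mod[of "a + P"] exponent_mod[of a] by (simp add: good_def exponent_period)
  have d_period: "d (a + p ^ (K + e)) = d a" for a
    unfolding P_def[symmetric] by (simp add: d_def exponent_period good_period)
  have d_power: "d a (f ^ (Q - a)) = (if good a then f ^ (Q - 1 - a) else 0)" if "a < Q" for a
  proof (cases "good a")
    case True
    then have nj: "exponent a \<notin> jumps e f" using no exponent_mod[of a] by (auto simp: good_def)
    define j where "j = Q div P - 1 - a div P"
    have "Q - 1 - a = P * j + exponent a"
    proof -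
      obtain t where t: "Q = P * t" using PQ by (elim dvdE)
      have a: "a = P * (a div P) + a mod P" by simp
      have "a div P < t" using \<open>a < Q\<close> t P0 by (simp add: div_less_iff_less_mult mult.commute)
      then have "j + a div P + 1 = t" using t P0 by (simp add: j_def)
      then have "Q = P * (j + a div P + 1)" using t by simp
      then have "Q = P * j + P * (a div P) + P" by (simp add: distrib_left)
      moreover have "a mod P < P" using P0 by simp
      ultimately show ?thesis unfolding exponent_def using a by linarith
    qed
    moreover from this have "Q - a = P * j + Suc (exponent a)" using \<open>a < Q\<close> by linarith
    moreover have "f ^ (P * j) = Frob e (g ^ j)"
      by (simp only: Frob_power g P_def power_mult)
    ultimately have "d a (f ^ (Q - a)) = \<delta> (exponent a) (Frob e (g ^ j) * f ^ Suc (exponent a))"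
      "f ^ (Q - 1 - a) = Frob e (g ^ j) * f ^ exponent a"
      using True by (simp_all only: d_def power_add if_True)
    moreover have "\<delta> (exponent a) (Frob e (g ^ j) * f ^ Suc (exponent a)) = Frob e (g ^ j) * f ^ exponent a"
      using \<delta>[OF nj] level_opsD(2)[of "\<delta> (exponent a)" e "g ^ j" "f ^ Suc (exponent a)"] by argo
    ultimately show ?thesis using True by (simp only: if_True)
  next
    case False
    then show ?thesis by (simp add: d_def)
  qed
  define u where "u = restrict (\<lambda>\<beta>. if \<beta> e = \<alpha> e then 1 else 0 :: 'v) (padic_int p)"
  have u: "u \<in> padic_cont_fns p"
    unfolding u_def by (rule padic_cont_fn_cylinder[of "\<lambda>z. if z = \<alpha> e then 1 else 0"])
  have u_val: "u (padic_of_int p (- 1 - int a)) = (if good a then 1 else 0)" for a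
    using padic_of_int_in[OF p_pos] by (simp add: u_def good_def padic_of_int_def)
  let ?\<Delta> = "coeffwise d" and ?u = "cont_fn_op p c u"
  have \<Delta>: "?\<Delta> \<in> D0" by (rule coeffwise_D0[where d = d and e = "K + e", OF d_level' d_period])
  have uop: "?u \<in> D0" by (rule cont_fn_op_D0[OF u])
  \<comment> \<open>\<open>1 / (f - t) = G / s\<close> by the geometric sum\<close>
  define s where "s = [:f ^ Q:] - monom 1 Q"
  define G where "G = (\<Sum>a<Q. monom (f ^ (Q - Suc a)) a)"
  have coeff_G: "coeff G a = (if a < Q then f ^ (Q - Suc a) else 0)" for a
    unfolding G_def coeff_sum by (simp add: sum.delta')
  have sG: "s = [:f, -1:] * G"
  proof -
    have "monom 1 Q - [:f:] ^ Q = (monom 1 1 - [:f:]) * (\<Sum>a<Q. [:f:] ^ (Q - Suc a) * monom 1 1 ^ a)"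
      using power_diff_sumr2[of "monom 1 1" Q "[:f:]"] by (simp add: monom_power)
    also have "(\<Sum>a<Q. [:f:] ^ (Q - Suc a) * monom 1 1 ^ a) = G"
      unfolding G_def by (intro sum.cong) (simp_all add: poly_const_pow monom_power smult_monom)
    also have "monom 1 1 - [:f:] = - [:f, -1:]" by (simp add: monom_altdef)
    finally have eq: "monom 1 Q - [:f:] ^ Q = - [:f, -1:] * G" .
    have "s = - (monom 1 Q - [:f:] ^ Q)" by (simp add: s_def poly_const_pow)
    also have "\<dots> = [:f, -1:] * G" unfolding eq by (simp only: mult_minus_left minus_minus)
    finally show ?thesis .
  qed
  have coeff_s: "coeff (s * h) a = f ^ Q * coeff h a - (if a < Q then 0 else coeff h (a - Q))" for h a
    by (simp add: s_def left_diff_distrib coeff_monom_mult)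
  have nz_s: "nonzerodivisor s"
  proof (rule nonzerodivisor_unit_lead_coeff)
    have "degree s = Q"
    proof (rule antisym)
      show "degree s \<le> Q" unfolding s_def by (intro degree_diff_le degree_monom_le) simp
      show "Q \<le> degree s" using Q0 by (intro le_degree) (simp add: s_def coeff_pCons split: nat.splits)
    qed
    then have "lead_coeff s = - 1" using Q0 by (simp add: s_def coeff_pCons split: nat.splits)
    then show "lead_coeff s dvd 1" by simp
  qed
  have inv_f_minus_t: "Frac s 1 * inv_f_minus_t = Frac G 1"
    using nz_ft by (simp add: inv_f_minus_t_def Frac_mult Frac_eq_iff sG mult.commute)
  have commute: "\<Psi> \<circ> (\<lambda>h. s * h) = (\<lambda>h. s * h) \<circ> \<Psi> \<Longrightarrow> Frac s 1 * act \<Psi> inv_f_minus_t = Frac (\<Psi> G) 1"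
    if \<Psi>: "\<Psi> \<in> D" for \<Psi>
  proof -
    assume comm: "\<Psi> \<circ> (\<lambda>h. s * h) = (\<lambda>h. s * h) \<circ> \<Psi>"
    have m: "(\<lambda>h. s * h) \<in> D" by (rule diff_ops_mult[OF map_hom])
    have "Frac s 1 * act \<Psi> inv_f_minus_t = act ((\<lambda>h. s * h) \<circ> \<Psi>) inv_f_minus_t"
      by (simp only: act_comp[OF m \<Psi> inv_f_minus_t_in_L] act_mult[OF act_closed[OF \<Psi> inv_f_minus_t_in_L]])
    also have "\<dots> = act \<Psi> (Frac G 1)"
      by (simp only: comm[symmetric] act_comp[OF \<Psi> m inv_f_minus_t_in_L] act_mult[OF inv_f_minus_t_in_L] inv_f_minus_t)
    finally show ?thesis by (simp only: act_Frac[OF \<Psi>])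
  qed
  have Frob_Q: "f ^ Q = Frob (K + e) g" by (simp add: g Q_def)
  have d_zero: "d a 0 = 0" for a by (rule level_ops_zero[OF d_level])
  have diff: "d a (r - r') = d a r - d a r'" for a r r'
    using level_opsD(1)[OF d_level, of a "r - r'" r'] by simp
  have d_shift: "d (a + Q) = d a" for a
  proof -
    have "d (a + P * j) = d a" for j
    proof (induction j)
      case (Suc j)
      have "a + P * Suc j = (a + P * j) + P" by simp
      then show ?case using Suc d_period[of "a + P * j", folded P_def] by (simp only:)
    qed simp
    then show ?thesis using PQ by (elim dvdE) (simp only:)
  qed
  have "?\<Delta> \<circ> (\<lambda>h. s * h) = (\<lambda>h. s * h) \<circ> ?\<Delta>"
  proof
    fix h
    have "coeff (?\<Delta> (s * h)) a = coeff (s * ?\<Delta> h) a" for a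
      using d_shift[of "a - Q"]
      by (cases "a < Q") (simp_all add: coeff_coeffwise d_zero coeff_s diff Frob_Q level_opsD(2)[OF d_level'])
    then show "(?\<Delta> \<circ> (\<lambda>h. s * h)) h = ((\<lambda>h. s * h) \<circ> ?\<Delta>) h" by (intro poly_eqI) simp
  qed
  moreover have "mult_f \<circ> (\<lambda>h. s * h) = (\<lambda>h. s * h) \<circ> mult_f"
    by (simp add: mult_f_def fun_eq_iff)
  ultimately have "(?\<Delta> \<circ> mult_f) \<circ> (\<lambda>h. s * h) = (\<lambda>h. s * h) \<circ> (?\<Delta> \<circ> mult_f)"
    by (simp add: fun_eq_iff)
  then have 1: "Frac s 1 * act (?\<Delta> \<circ> mult_f) inv_f_minus_t = Frac ((?\<Delta> \<circ> mult_f) G) 1"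
    by (intro commute D0_D D0_comp \<Delta> mult_f_D0)
  have good_add: "good (a + Q) = good a" for a
  proof -
    have "good (a + P * j) = good a" for j
    proof (induction j)
      case (Suc j)
      have "a + P * Suc j = (a + P * j) + P" by simp
      then show ?case using Suc good_period[of "a + P * j"] by (simp only:)
    qed simp
    then show ?thesis using PQ by (elim dvdE) (simp only:)
  qed
  have coeff_u: "coeff (?u h) a = (if good a then coeff h a else 0)" for h a
    by (simp add: coeff_cont_fn_op u_val)
  have "?u \<circ> (\<lambda>h. s * h) = (\<lambda>h. s * h) \<circ> ?u"
  proof
    fix h
    have "coeff (?u (s * h)) a = coeff (s * ?u h) a" for a
      using good_add[of "a - Q"] by (cases "a < Q") (simp_all add: coeff_u coeff_s)
    then show "(?u \<circ> (\<lambda>h. s * h)) h = ((\<lambda>h. s * h) \<circ> ?u) h" by (intro poly_eqI) simp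
  qed
  then have 2: "Frac s 1 * act ?u inv_f_minus_t = Frac (?u G) 1"
    by (intro commute D0_D uop)
  have "(?\<Delta> \<circ> mult_f) G = ?u G"
  proof (rule poly_eqI)
    fix a
    show "coeff ((?\<Delta> \<circ> mult_f) G) a = coeff (?u G) a"
    proof (cases "a < Q")
      case True
      then have "Q - a = Suc (Q - Suc a)" by simp
      then have "f * f ^ (Q - Suc a) = f ^ (Q - a)" by (simp only: power_Suc)
      then show ?thesis
        using d_power[OF True] True
        by (simp add: coeff_coeffwise d_zero mult_f_def coeff_G coeff_u)
    qed (simp add: coeff_coeffwise d_zero mult_f_def coeff_G coeff_u)
  qed
  then have "Frac 1 s * (Frac s 1 * act ?u inv_f_minus_t) = Frac 1 s * (Frac s 1 * act (?\<Delta> \<circ> mult_f) inv_f_minus_t)"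
    using 1 2 by simp
  then have "act ?u inv_f_minus_t = act (?\<Delta> \<circ> mult_f) inv_f_minus_t"
    by (simp add: mult.assoc[symmetric] Frac_inverse[OF nz_s])
  moreover have "u \<alpha> \<notin> M" using \<alpha> M by (simp add: u_def)
  moreover have "restrict (\<lambda>_. 1) (padic_int p) \<in> padic_cont_fns p - colon_ideal p M \<alpha>"
    using padic_cont_fn_cylinder[of "\<lambda>_. 1" 0 p] \<alpha> M by (simp add: colon_ideal_def)
  ultimately have "N_localized p M c f act \<alpha> = {N_localized_zero p M c f act \<alpha>}"
    using localization_trivial[OF cont_fn_op_D0 u _ _ \<Delta>] by blast
  then show False using nontrivial by blast
qed

end

theorem theorem4p6:
  fixes \<mm> :: "'v::comm_ring_1 set"
    and \<pi> :: "'v \<Rightarrow> 'k::field"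
    and p :: nat
    and F :: "'v \<Rightarrow> 'v"
    and c :: "'v \<Rightarrow> 'r::comm_ring_1"
    and n :: nat
    and x :: "nat \<Rightarrow> 'r"
    and f :: 'r
  assumes "artinian_ring TYPE('v)"
    and "local_ring_with \<mm>"
    and "residue_map \<mm> \<pi>"
    and "CHAR('k) = p" and "p > 0"
    and "unital_ring_hom F" and "bij F" and "\<And>v. \<pi> (F v) = \<pi> v ^ p"
    and "is_polynomial_ring c n x"
    and "nonzerodivisor f"
  shows "bernstein_sato_roots p \<mm> c f \<subseteq> padic_rationals p"
proof
  have hom: "\<pi> 1 = 1" "\<pi> (v + w) = \<pi> v + \<pi> w" "\<pi> (v * w) = \<pi> v * \<pi> w" for v w
    using assms(3) by (simp_all add: residue_map_def unital_ring_hom_def)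
  have kernel: "v \<in> \<mm> \<longleftrightarrow> \<pi> v = 0" for v
    using assms(3) by (auto simp: residue_map_def)
  have \<pi>_0: "\<pi> 0 = 0" using hom(2)[of 0 0] by (simp only: add_0_right add_cancel_right_right)
  have \<pi>_power: "\<pi> (v ^ k) = \<pi> v ^ k" for v k by (induction k) (simp_all add: hom)
  have \<pi>_of_nat: "\<pi> (of_nat k) = of_nat k" for k by (induction k) (simp_all add: hom \<pi>_0)
  have \<pi>_diff: "\<pi> (v - w) = \<pi> v - \<pi> w" for v w using hom(2)[of "v - w" w] by simp
  have nilpotent: "nilpotent_elem v" if "\<pi> v = 0" for v
    using artinian_local_nilpotent[OF assms(1,2), of v] that by (auto simp: kernel nilpotent_elem_def)
  have "prime p"
    using prime_CHAR_semidom[where ?'a = 'k] assms(4,5) by simp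
  interpret frobenius_lift c n x F p
  proof
    show "nilpotent_elem (of_nat p :: 'v)"
      using assms(4) by (intro nilpotent) (auto simp: \<pi>_of_nat)
    show "nilpotent_elem (F v - v ^ p)" for v
      by (intro nilpotent) (simp add: \<pi>_diff \<pi>_power assms(8))
  qed (use assms \<open>prime p\<close> in simp_all)
  obtain l where l: "length_le (*) {0} (UNIV :: 'v set) l"
    using artinian_local_finite_length[OF assms(1,2)] by blast
  fix \<alpha> assume \<alpha>: "\<alpha> \<in> bernstein_sato_roots p \<mm> c f"
  have "1 \<notin> \<mm>" by (simp add: kernel hom)
  then have "\<exists>\<nu>\<in>jumps e f. int \<nu> mod int p ^ e = \<alpha> e" for e
    by (rule jumps_if_bernstein_sato_root[OF assms(10) \<alpha>])
  moreover have "\<alpha> \<in> padic_int p" using \<alpha> by (simp add: bernstein_sato_roots_def)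
  ultimately show "\<alpha> \<in> padic_rationals p"
    by (intro padic_rational_if_jumps[OF l])
qed

end
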